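(* Let $I$ be a (connected) simply-laced Dynkin diagram, and let $\widehat I$, the lattice $Q$ and the Euler form $\langle\cdot,\cdot\rangle_{\widehat I}$ be as defined in the context. Let $(x,y)_{\widehat I}=\langle x,y\rangle_{\widehat I}+\langle y,x\rangle_{\widehat I}$. Then $(\cdot,\cdot)_{\widehat I}$ (extended by bilinearity) is a positive definite symmetric form on $Q$, and $\widehat I\subset Q$ (each vertex being identified with its class in $Q$) is a root system with Dynkin diagram $I$.
   Context: $I$ is a Dynkin diagram of type $A$, $D$ or $E$, with Coxeter number $h$; $n_{ij}\in\{0,1\}$ is the number of edges between $i$ and $j$. Fix $p\colon I\to\mathbb Z_2$ with $p(i)=p(j)+1$ whenever $i,j$ are connected by an edge. Set $\widehat I=\{(i,n)\in I\times\mathbb Z_{2h}\mid p(i)+n\equiv0\bmod 2\}$. Let $Q=\mathbb Z^{\widehat I}/J$, where $J$ is the subgroup of the free abelian group $\mathbb Z^{\widehat I}$ generated by the elements $(i,n)-\sum_j(j,n+1)+(i,n+2)$ for all $(i,n)\in\widehat I$, the sum being over all $j\in I$ connected to $i$. The Euler form $\langle\cdot,\cdot\rangle_{\widehat I}\colon\widehat I\times\widehat I\to\mathbb Z$ is the unique function such that: (a) $\langle(i,n),(j,n)\rangle_{\widehat I}=\delta_{ij}$ for all $(i,n),(j,n)\in\widehat I$, and $\langle(i,n),(j,n+1)\rangle_{\widehat I}=n_{ij}$ for all $(i,n),(j,n+1)\in\widehat I$; (b) for all $q\in\widehat I$ and $(i,n)\in\widehat I$, $\langle q,(i,n)\rangle_{\widehat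 I}-\sum_{j}\langle q,(j,n+1)\rangle_{\widehat I}+\langle q,(i,n+2)\rangle_{\widehat I}=0$, the sum being over all $j$ connected to $i$ in $I$. (Such a function exists and is unique.) *)

theory Defs
  imports "HOL-Algebra.Algebra" "HOL-Algebra.Free_Abelian_Groups" "HOL-Library.Z2"
begin

section \<open>Simply-laced Dynkin diagrams\<close>

text \<open>
  A diagram is a vertex set \<open>I\<close> with an edge relation \<open>adj\<close>; only the values of \<open>adj\<close> on \<open>I\<close> matter.
  The standard diagrams have vertices \<open>1, \<dots>, n\<close>, numbered as in Bourbaki.
\<close>

definition A_edges :: "nat \<Rightarrow> nat set set" where
  "A_edges n = {{k, k + 1} | k. 1 \<le> k \<and> k < n}"

definition D_edges :: "nat \<Rightarrow> nat set set" where
  "D_edges n = {{k, k + 1} | k. 1 \<le> k \<and> k + 1 < n} \<union> {{n - 2, n}}"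

definition E_edges :: "nat \<Rightarrow> nat set set" where
  "E_edges n = {{1, 3}, {2, 4}} \<union> {{k, k + 1} | k. 3 \<le> k \<and> k < n}"

definition diagram_iso :: "'i set \<Rightarrow> ('i \<Rightarrow> 'i \<Rightarrow> bool) \<Rightarrow> nat \<Rightarrow> nat set set \<Rightarrow> bool" where
  "diagram_iso I adj n Es \<longleftrightarrow>
     (\<exists>f. bij_betw f I {1..n} \<and> (\<forall>i\<in>I. \<forall>j\<in>I. adj i j \<longleftrightarrow> {f i, f j} \<in> Es))"

definition ADE_diagram :: "'i set \<Rightarrow> ('i \<Rightarrow> 'i \<Rightarrow> bool) \<Rightarrow> bool" where
  "ADE_diagram I adj \<longleftrightarrow>
     (\<exists>n\<ge>1. diagram_iso I adj n (A_edges n)) \<or>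
     (\<exists>n\<ge>4. diagram_iso I adj n (D_edges n)) \<or>
     (\<exists>n\<in>{6, 7, 8}. diagram_iso I adj n (E_edges n))"

definition nbrs :: "'i set \<Rightarrow> ('i \<Rightarrow> 'i \<Rightarrow> bool) \<Rightarrow> 'i \<Rightarrow> 'i set" where
  "nbrs I adj i = {j \<in> I. adj i j}"

definition edge_mult :: "('i \<Rightarrow> 'i \<Rightarrow> bool) \<Rightarrow> 'i \<Rightarrow> 'i \<Rightarrow> int" where
  "edge_mult adj i j = of_bool (adj i j)"

section \<open>The Coxeter number\<close>

text \<open>
  The simple reflection \<open>s\<^sub>i v = v - (v, \<alpha>\<^sub>i) \<alpha>\<^sub>i\<close> on coordinate vectors with respect to the simple
  roots, where \<open>(\<alpha>\<^sub>i, \<alpha>\<^sub>i) = 2\<close> and \<open>(\<alpha>\<^sub>i, \<alpha>\<^sub>j) = - n\<^sub>i\<^sub>j\<close> for \<open>i \<noteq> j\<close>. Coordinates outside \<open>I\<close> are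
  neither read nor changed by the reflections \<open>s\<^sub>i\<close> with \<open>i \<in> I\<close>.
\<close>

definition simple_refl :: "'i set \<Rightarrow> ('i \<Rightarrow> 'i \<Rightarrow> bool) \<Rightarrow> 'i \<Rightarrow> ('i \<Rightarrow> int) \<Rightarrow> ('i \<Rightarrow> int)" where
  "simple_refl I adj i v = v(i := v i - (2 * v i - (\<Sum>j\<in>nbrs I adj i. v j)))"

definition coxeter_element :: "'i set \<Rightarrow> ('i \<Rightarrow> 'i \<Rightarrow> bool) \<Rightarrow> (('i \<Rightarrow> int) \<Rightarrow> ('i \<Rightarrow> int)) \<Rightarrow> bool" where
  "coxeter_element I adj c \<longleftrightarrow>
     (\<exists>l. distinct l \<and> set l = I \<and> c = foldr (\<lambda>i g. simple_refl I adj i \<circ> g) l id)"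

definition coxeter_number :: "'i set \<Rightarrow> ('i \<Rightarrow> 'i \<Rightarrow> bool) \<Rightarrow> nat \<Rightarrow> bool" where
  "coxeter_number I adj h \<longleftrightarrow>
     (\<exists>c. coxeter_element I adj c \<and> 0 < h \<and> c ^^ h = id \<and> (\<forall>m. 0 < m \<and> m < h \<longrightarrow> c ^^ m \<noteq> id))"

section \<open>The periodic quiver, its lattice and its Euler form\<close>

text \<open>\<open>\<int>/2h\<close> is represented by the residues \<open>0, \<dots>, 2h - 1\<close>, and \<open>\<int>/2\<close> by the type \<^typ>\<open>bit\<close>.\<close>

definition Ihat :: "'i set \<Rightarrow> ('i \<Rightarrow> bit) \<Rightarrow> nat \<Rightarrow> ('i \<times> nat) set" where
  "Ihat I p h = {(i, n). i \<in> I \<and> n < 2 * h \<and> p i + of_nat n = 0}"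

definition shift :: "nat \<Rightarrow> nat \<Rightarrow> nat \<Rightarrow> nat" where
  "shift h n k = (n + k) mod (2 * h)"

definition mesh_rel :: "'i set \<Rightarrow> ('i \<Rightarrow> 'i \<Rightarrow> bool) \<Rightarrow> nat \<Rightarrow> 'i \<times> nat \<Rightarrow> ('i \<times> nat) \<Rightarrow>\<^sub>0 int" where
  "mesh_rel I adj h = (\<lambda>(i, n).
     frag_of (i, n) - (\<Sum>j\<in>nbrs I adj i. frag_of (j, shift h n 1)) + frag_of (i, shift h n 2))"

definition mesh_subgroup ::
  "'i set \<Rightarrow> ('i \<Rightarrow> 'i \<Rightarrow> bool) \<Rightarrow> ('i \<Rightarrow> bit) \<Rightarrow> nat \<Rightarrow> (('i \<times> nat) \<Rightarrow>\<^sub>0 int) set" where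
  "mesh_subgroup I adj p h =
     generate (free_Abelian_group (Ihat I p h)) (mesh_rel I adj h ` Ihat I p h)"

definition lattice_Q ::
  "'i set \<Rightarrow> ('i \<Rightarrow> 'i \<Rightarrow> bool) \<Rightarrow> ('i \<Rightarrow> bit) \<Rightarrow> nat \<Rightarrow> (('i \<times> nat) \<Rightarrow>\<^sub>0 int) set monoid" where
  "lattice_Q I adj p h = free_Abelian_group (Ihat I p h) Mod mesh_subgroup I adj p h"

definition vertex_class ::
  "'i set \<Rightarrow> ('i \<Rightarrow> 'i \<Rightarrow> bool) \<Rightarrow> ('i \<Rightarrow> bit) \<Rightarrow> nat \<Rightarrow> 'i \<times> nat \<Rightarrow> (('i \<times> nat) \<Rightarrow>\<^sub>0 int) set" where
  "vertex_class I adj p h q = mesh_subgroup I adj p h #>\<^bsub>free_Abelian_group (Ihat I p h)\<^esub> frag_of q"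

definition is_euler_form ::
  "'i set \<Rightarrow> ('i \<Rightarrow> 'i \<Rightarrow> bool) \<Rightarrow> ('i \<Rightarrow> bit) \<Rightarrow> nat \<Rightarrow> ('i \<times> nat \<Rightarrow> 'i \<times> nat \<Rightarrow> int) \<Rightarrow> bool" where
  "is_euler_form I adj p h E \<longleftrightarrow>
     (\<forall>i j n. (i, n) \<in> Ihat I p h \<and> (j, n) \<in> Ihat I p h \<longrightarrow> E (i, n) (j, n) = of_bool (i = j)) \<and>
     (\<forall>i j n. (i, n) \<in> Ihat I p h \<and> (j, shift h n 1) \<in> Ihat I p h \<longrightarrow>
        E (i, n) (j, shift h n 1) = edge_mult adj i j) \<and>
     (\<forall>q\<in>Ihat I p h. \<forall>(i, n)\<in>Ihat I p h.
        E q (i, n) - (\<Sum>j\<in>nbrs I adj i. E q (j, shift h n 1)) + E q (i, shift h n 2) = 0)"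

text \<open>The value \<open>0\<close> off \<open>Ihat\<close> is a convention that makes the total function unique.\<close>

definition euler_form ::
  "'i set \<Rightarrow> ('i \<Rightarrow> 'i \<Rightarrow> bool) \<Rightarrow> ('i \<Rightarrow> bit) \<Rightarrow> nat \<Rightarrow> 'i \<times> nat \<Rightarrow> 'i \<times> nat \<Rightarrow> int" where
  "euler_form I adj p h =
     (THE E. is_euler_form I adj p h E \<and>
             (\<forall>q r. q \<notin> Ihat I p h \<or> r \<notin> Ihat I p h \<longrightarrow> E q r = 0))"

definition sym_euler_form ::
  "'i set \<Rightarrow> ('i \<Rightarrow> 'i \<Rightarrow> bool) \<Rightarrow> ('i \<Rightarrow> bit) \<Rightarrow> nat \<Rightarrow> 'i \<times> nat \<Rightarrow> 'i \<times> nat \<Rightarrow> int" where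
  "sym_euler_form I adj p h x y = euler_form I adj p h x y + euler_form I adj p h y x"

section \<open>Forms and root systems in abelian groups\<close>

text \<open>\<open>G\<close> is an abelian group written multiplicatively, so \<open>x [^] k\<close> is the integer multiple \<open>k x\<close>.\<close>

definition biadditive :: "('a, 'b) monoid_scheme \<Rightarrow> ('a \<Rightarrow> 'a \<Rightarrow> int) \<Rightarrow> bool" where
  "biadditive G B \<longleftrightarrow>
     (\<forall>x\<in>carrier G. \<forall>y\<in>carrier G. \<forall>z\<in>carrier G.
        B (x \<otimes>\<^bsub>G\<^esub> y) z = B x z + B y z \<and> B z (x \<otimes>\<^bsub>G\<^esub> y) = B z x + B z y)"

definition symmetric_form :: "('a, 'b) monoid_scheme \<Rightarrow> ('a \<Rightarrow> 'a \<Rightarrow> int) \<Rightarrow> bool" where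
  "symmetric_form G B \<longleftrightarrow> (\<forall>x\<in>carrier G. \<forall>y\<in>carrier G. B x y = B y x)"

definition positive_definite :: "('a, 'b) monoid_scheme \<Rightarrow> ('a \<Rightarrow> 'a \<Rightarrow> int) \<Rightarrow> bool" where
  "positive_definite G B \<longleftrightarrow> (\<forall>x\<in>carrier G. x \<noteq> \<one>\<^bsub>G\<^esub> \<longrightarrow> 0 < B x x)"

text \<open>
  The Cartan integer \<open>2 (\<beta>, \<alpha>) / (\<alpha>, \<alpha>)\<close>; integrality, under which the division below is exact, is
  an axiom of root systems.
\<close>

definition cartan :: "('a \<Rightarrow> 'a \<Rightarrow> int) \<Rightarrow> 'a \<Rightarrow> 'a \<Rightarrow> int" where
  "cartan B \<beta> \<alpha> = 2 * B \<beta> \<alpha> div B \<alpha> \<alpha>"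

text \<open>
  The axioms of a reduced root system in the Euclidean space \<open>\<real> \<otimes> G\<close>, for \<open>B\<close> positive definite
  (hence \<open>G\<close> torsion-free), stated inside the lattice \<open>G\<close>: \<open>R\<close> spans \<open>\<real> \<otimes> G\<close> iff every element of \<open>G\<close>
  has a nonzero multiple in the subgroup generated by \<open>R\<close>, and \<open>\<beta>\<close> is proportional to \<open>\<alpha>\<close> iff
  \<open>k \<beta> = m \<alpha>\<close> for some integers \<open>k \<noteq> 0\<close> and \<open>m\<close>.
\<close>

definition root_system :: "('a, 'b) monoid_scheme \<Rightarrow> ('a \<Rightarrow> 'a \<Rightarrow> int) \<Rightarrow> 'a set \<Rightarrow> bool" where
  "root_system G B R \<longleftrightarrow>
     finite R \<and> R \<subseteq> carrier G \<and> \<one>\<^bsub>G\<^esub> \<notin> R \<and>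
     (\<forall>x\<in>carrier G. \<exists>k::nat. 0 < k \<and> x [^]\<^bsub>G\<^esub> k \<in> generate G R) \<and>
     (\<forall>\<alpha>\<in>R. \<forall>\<beta>\<in>R. B \<alpha> \<alpha> dvd 2 * B \<beta> \<alpha>) \<and>
     (\<forall>\<alpha>\<in>R. \<forall>\<beta>\<in>R. \<beta> \<otimes>\<^bsub>G\<^esub> inv\<^bsub>G\<^esub> (\<alpha> [^]\<^bsub>G\<^esub> cartan B \<beta> \<alpha>) \<in> R) \<and>
     (\<forall>\<alpha>\<in>R. \<forall>\<beta>\<in>R. \<forall>(k::int) (m::int). k \<noteq> 0 \<and> \<beta> [^]\<^bsub>G\<^esub> k = \<alpha> [^]\<^bsub>G\<^esub> m \<longrightarrow> \<beta> = \<alpha> \<or> \<beta> = inv\<^bsub>G\<^esub> \<alpha>)"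

definition lin_comb :: "('a, 'b) monoid_scheme \<Rightarrow> 'a set \<Rightarrow> ('a \<Rightarrow> int) \<Rightarrow> 'a" where
  "lin_comb G \<Delta> c = finprod G (\<lambda>\<alpha>. \<alpha> [^]\<^bsub>G\<^esub> c \<alpha>) \<Delta>"

definition root_base :: "('a, 'b) monoid_scheme \<Rightarrow> 'a set \<Rightarrow> 'a set \<Rightarrow> bool" where
  "root_base G R \<Delta> \<longleftrightarrow>
     \<Delta> \<subseteq> R \<and>
     (\<forall>c. lin_comb G \<Delta> c = \<one>\<^bsub>G\<^esub> \<longrightarrow> (\<forall>\<alpha>\<in>\<Delta>. c \<alpha> = 0)) \<and>
     (\<forall>\<beta>\<in>R. \<exists>c. \<beta> = lin_comb G \<Delta> c \<and> ((\<forall>\<alpha>\<in>\<Delta>. 0 \<le> c \<alpha>) \<or> (\<forall>\<alpha>\<in>\<Delta>. c \<alpha> \<le> 0)))"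

text \<open>
  The Dynkin diagram has the elements of a base as vertices, with \<open>cartan \<alpha> \<beta> * cartan \<beta> \<alpha>\<close> edges
  between \<open>\<alpha> \<noteq> \<beta>\<close>. Arrows occur only on multiple edges, so there are none when the multiplicities
  \<open>n i j\<close> are at most \<open>1\<close>. By conjugacy of bases the diagram does not depend on the base.
\<close>

definition has_simply_laced_dynkin_diagram ::
  "('a, 'b) monoid_scheme \<Rightarrow> ('a \<Rightarrow> 'a \<Rightarrow> int) \<Rightarrow> 'a set \<Rightarrow> 'i set \<Rightarrow> ('i \<Rightarrow> 'i \<Rightarrow> bool) \<Rightarrow> bool" where
  "has_simply_laced_dynkin_diagram G B R I adj \<longleftrightarrow>
     (\<exists>\<Delta> \<alpha>. root_base G R \<Delta> \<and> bij_betw \<alpha> I \<Delta> \<and>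
        (\<forall>i\<in>I. \<forall>j\<in>I. i \<noteq> j \<longrightarrow>
           cartan B (\<alpha> i) (\<alpha> j) * cartan B (\<alpha> j) (\<alpha> i) = edge_mult adj i j))"

end

theory Submission
  imports Defs
begin

text \<open>
  Colour the vertices of \<open>I\<close> by \<open>p\<close> and let \<open>c\<close> be the product of the simple reflections of one colour with
  those of the other, acting on \<open>\<int>\<^sup>I\<close>. Sending \<open>(i, n)\<close> to a power of \<open>c\<close> applied to \<open>\<plusminus>\<alpha>\<^sub>i\<close> respects the mesh
  relations, and a slice of two adjacent columns maps to a basis; so \<open>Q\<close> is the root lattice, and the Euler
  form of the bipartite quiver pulls back to the Euler form on \<open>Ihat\<close>. The values are vectors with
  \<open>(v, v) = 2\<close>.

  All such vectors occur: the sum of a \<open>c\<close>-orbit is fixed by \<open>c\<close>, hence zero, so the orbit contains a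
  positive root that \<open>c\<close> makes negative, and these are known explicitly. They also show that the column
  shift by some \<open>H\<close> maps \<open>(i, n)\<close> to \<open>- (i*, n)\<close> for a diagram automorphism \<open>*\<close>. The pairings of the
  vertices are Chebyshev polynomials in the adjacency matrix, hence symmetric matrices; this forces
  \<open>*\<close> to be an involution. So \<open>c\<close> has order \<open>H\<close>, \<open>H = h\<close>, and the vertices are pairwise distinct.
\<close>

section \<open>Bipartite reflections and the repetition quiver\<close>

text \<open>Behind the construction is the derived category of the bipartite quiver:
  \<open>rt k n\<close> plays the class of the indecomposable object at \<open>(k, n)\<close>,
  \<open>cox\<close> the inverse Auslander-Reiten translate, the first two columns the projectives,
  and the shift by \<open>H\<close> columns together with \<open>*\<close> the suspension, which is
  negation on classes. Only classes occur; a root being nonnegative or nonpositive replaces the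
  distinction between modules and shifted modules. The obstacle is that \<open>h\<close> is known
  only as the order of some Coxeter element, while the quiver closes up after \<open>2 h\<close>
  columns. First, the order must not depend on the Coxeter element: each one advances some slice of
  the quiver by two columns, so its powers measure the period of all mesh functions. Second, nothing
  may repeat within \<open>2 h\<close> columns: leaving the first slice along a row and meeting it
  again takes at least \<open>H\<close> steps of \<open>cox\<close>, so \<open>h \<le> H\<close>
  suffices. That inequality needs \<open>cox\<close> to have trivial \<open>H\<close>-th power,
  hence \<open>*\<close> to be an involution, and the symmetry of the Chebyshev matrices yields this
  without inspecting the diagrams.\<close>

definition unit_vec :: "'i \<Rightarrow> 'i \<Rightarrow> int" where
  "unit_vec k = (\<lambda>i. of_bool (i = k))"

definition nonneg_vec :: "('i \<Rightarrow> int) \<Rightarrow> bool" where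
  "nonneg_vec v \<longleftrightarrow> (\<forall>i. 0 \<le> v i)"

locale bipartite_diagram =
  fixes I :: "'i set" and adj :: "'i \<Rightarrow> 'i \<Rightarrow> bool" and col :: "'i \<Rightarrow> bool"
  assumes finite_I: "finite I"
    and adj_sym: "\<And>i j. i \<in> I \<Longrightarrow> j \<in> I \<Longrightarrow> adj i j \<Longrightarrow> adj j i"
    and col_adj: "\<And>i j. i \<in> I \<Longrightarrow> j \<in> I \<Longrightarrow> adj i j \<Longrightarrow> col j = (\<not> col i)"
begin

abbreviation nb :: "'i \<Rightarrow> 'i set" where
  "nb \<equiv> nbrs I adj"

text \<open>No two vertices of one colour are adjacent, so their simple reflections commute and the
  product is one simultaneous update.\<close>

definition flip :: "bool \<Rightarrow> ('i \<Rightarrow> int) \<Rightarrow> 'i \<Rightarrow> int" where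
  "flip b v = (\<lambda>i. if i \<in> I \<and> col i = b then (\<Sum>j\<in>nb i. v j) - v i else v i)"

definition cox :: "('i \<Rightarrow> int) \<Rightarrow> 'i \<Rightarrow> int" where
  "cox v = flip True (flip False v)"

text \<open>The Euler form of the bipartite quiver whose arrows start in the colour \<open>b\<close>; \<open>flip b\<close> reverses
  all arrows.\<close>

definition eform :: "bool \<Rightarrow> ('i \<Rightarrow> int) \<Rightarrow> ('i \<Rightarrow> int) \<Rightarrow> int" where
  "eform b v w = (\<Sum>k\<in>I. v k * w k) - (\<Sum>k\<in>{k\<in>I. col k = b}. \<Sum>l\<in>nb k. v k * w l)"

definition supported :: "('i \<Rightarrow> int) \<Rightarrow> bool" where
  "supported v \<longleftrightarrow> (\<forall>i. i \<notin> I \<longrightarrow> v i = 0)"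

lemma adj_commute: "i \<in> I \<Longrightarrow> j \<in> I \<Longrightarrow> adj i j \<longleftrightarrow> adj j i"
  using adj_sym by blast

lemma nb_iff: "j \<in> nb i \<longleftrightarrow> j \<in> I \<and> adj i j"
  by (simp add: nbrs_def)

lemma finite_nb [simp]: "finite (nb i)"
  using finite_I by (simp add: nbrs_def)

lemma nb_sym: "i \<in> I \<Longrightarrow> j \<in> nb i \<Longrightarrow> i \<in> nb j"
  using adj_sym by (simp add: nb_iff)

lemma nb_col: "i \<in> I \<Longrightarrow> j \<in> nb i \<Longrightarrow> col j = (\<not> col i)"
  using col_adj by (simp add: nb_iff)

lemma nb_in: "j \<in> nb i \<Longrightarrow> j \<in> I"
  by (simp add: nb_iff)

text \<open>Every edge has one end of each colour, so both sides run once over all edges.\<close>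

lemma sum_nb_swap:
  "(\<Sum>k\<in>{k\<in>I. col k = b}. \<Sum>l\<in>nb k. f k l) = (\<Sum>l\<in>{l\<in>I. col l = (\<not> b)}. \<Sum>k\<in>nb l. (f k l::int))"
proof -
  have "(\<Sum>k\<in>{k\<in>I. col k = b}. \<Sum>l\<in>nb k. f k l) =
    (\<Sum>k\<in>{k\<in>I. col k = b}. \<Sum>l\<in>{l \<in> {l\<in>I. col l = (\<not> b)}. adj k l}. f k l)"
    by (intro sum.cong refl) (use nb_col in \<open>auto simp: nbrs_def\<close>)
  also have "\<dots> = (\<Sum>l\<in>{l\<in>I. col l = (\<not> b)}. \<Sum>k\<in>{k \<in> {k\<in>I. col k = b}. adj k l}. f k l)"
    using finite_I by (intro sum.swap_restrict) auto
  also have "\<dots> = (\<Sum>l\<in>{l\<in>I. col l = (\<not> b)}. \<Sum>k\<in>nb l. f k l)"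
    by (intro sum.cong refl) (use col_adj adj_sym in \<open>auto simp: nbrs_def\<close>)
  finally show ?thesis .
qed

lemma sum_nb_swap_all:
  "(\<Sum>k\<in>I. \<Sum>l\<in>nb k. f k l) = (\<Sum>l\<in>I. \<Sum>k\<in>nb l. (f k l::'b::comm_monoid_add))"
proof -
  have "(\<Sum>k\<in>I. \<Sum>l\<in>nb k. f k l) = (\<Sum>l\<in>I. \<Sum>k\<in>{k \<in> I. adj k l}. f k l)"
    unfolding nbrs_def using finite_I by (intro sum.swap_restrict) auto
  also have "\<dots> = (\<Sum>l\<in>I. \<Sum>k\<in>nb l. f k l)"
    by (intro sum.cong refl) (use adj_sym in \<open>auto simp: nbrs_def\<close>)
  finally show ?thesis .
qed

lemma sum_col_split:
  "(\<Sum>k\<in>I. f k) = (\<Sum>k\<in>{k\<in>I. col k = b}. f k) + (\<Sum>k\<in>{k\<in>I. col k = (\<not> b)}. (f k :: int))"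
proof -
  have "I = {k\<in>I. col k = b} \<union> {k\<in>I. col k = (\<not> b)}" by auto
  then show ?thesis
    using finite_I sum.union_disjoint[of "{k\<in>I. col k = b}" "{k\<in>I. col k = (\<not> b)}" f] by auto
qed

lemma flip_at: "k \<in> I \<Longrightarrow> col k = b \<Longrightarrow> flip b v k = (\<Sum>j\<in>nb k. v j) - v k"
  by (simp add: flip_def)

lemma flip_off: "k \<notin> I \<or> col k \<noteq> b \<Longrightarrow> flip b v k = v k"
  by (auto simp: flip_def)

lemma sum_flip_nb:
  assumes "k \<in> I" "col k = b"
  shows "(\<Sum>j\<in>nb k. flip b v j * c j) = (\<Sum>j\<in>nb k. v j * c j)"
  using assms nb_col by (intro sum.cong) (auto simp: flip_off)

lemma flip_flip [simp]: "flip b (flip b v) = v"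
proof
  fix i
  show "flip b (flip b v) i = v i"
    using sum_flip_nb[of i b v "\<lambda>_. 1"] by (cases "i \<in> I \<and> col i = b") (auto simp: flip_at flip_off)
qed



lemma flip_add: "flip b (\<lambda>i. v i + w i) = (\<lambda>i. flip b v i + flip b w i)"
  by (auto simp: flip_def sum.distrib)

lemma flip_scale: "flip b (\<lambda>i. c * v i) = (\<lambda>i. c * flip b v i)"
  by (auto simp: flip_def sum_distrib_left right_diff_distrib)

lemma flip_zero: "flip b (\<lambda>i. 0) = (\<lambda>i. 0)"
  by (auto simp: flip_def)

lemma flip_lin:
  "flip b (\<lambda>i. \<Sum>k\<in>K. c k * f k i) = (\<lambda>i. \<Sum>k\<in>K. c k * flip b (f k) i)"
  by (induction K rule: infinite_finite_induct) (simp_all add: flip_add flip_scale flip_zero)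

lemma flip_uminus: "flip b (\<lambda>i. - v i) = (\<lambda>i. - flip b v i)"
  by (auto simp: flip_def sum_negf)

lemma flip_supported [simp]: "supported (flip b v) \<longleftrightarrow> supported v"
  by (simp add: supported_def flip_def)

text \<open>The numerical form of reflection functors. With \<open>P\<close> for the sum over the
  neighbours, everything reduces to sums over the colour \<open>b\<close> and to the identity
  \<open>(P v - v) * (P w - w) - P v * (P w - w) = v * w - v * P w\<close>.\<close>

lemma eform_flip: "eform (\<not> b) (flip b v) (flip b w) = eform b v w"
proof -
  let ?A = "{k\<in>I. col k = b}" and ?C = "{k\<in>I. col k = (\<not> b)}"
  define P where "P u k = (\<Sum>j\<in>nb k. u j)" for u :: "'i \<Rightarrow> int" and k
  have A: "(\<Sum>k\<in>?A. flip b v k * flip b w k) = (\<Sum>k\<in>?A. (P v k - v k) * (P w k - w k))"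
    by (intro sum.cong) (auto simp: flip_at P_def)
  have C: "(\<Sum>k\<in>?C. flip b v k * flip b w k) = (\<Sum>k\<in>?C. v k * w k)"
    by (intro sum.cong) (auto simp: flip_off)
  have "(\<Sum>k\<in>?C. \<Sum>l\<in>nb k. flip b v k * flip b w l) =
        (\<Sum>l\<in>?A. \<Sum>k\<in>nb l. flip b v k * flip b w l)"
    using sum_nb_swap[where b = "\<not> b"] by simp
  also have "\<dots> = (\<Sum>l\<in>?A. P v l * (P w l - w l))"
  proof (intro sum.cong refl)
    fix l assume l: "l \<in> ?A"
    then have "(\<Sum>k\<in>nb l. flip b v k * flip b w l) = (\<Sum>k\<in>nb l. v k * flip b w l)"
      using sum_flip_nb[of l b v "\<lambda>_. flip b w l"] by auto
    with l show "(\<Sum>k\<in>nb l. flip b v k * flip b w l) = P v l * (P w l - w l)"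
      by (simp add: P_def flip_at sum_distrib_right)
  qed
  finally have D: "(\<Sum>k\<in>?C. \<Sum>l\<in>nb k. flip b v k * flip b w l) = (\<Sum>l\<in>?A. P v l * (P w l - w l))" .
  have F: "(\<Sum>k\<in>?A. \<Sum>l\<in>nb k. v k * w l) = (\<Sum>k\<in>?A. v k * P w k)"
    by (simp add: P_def sum_distrib_left)
  have "(\<Sum>k\<in>?A. (P v k - v k) * (P w k - w k)) - (\<Sum>l\<in>?A. P v l * (P w l - w l)) =
        (\<Sum>k\<in>?A. v k * w k) - (\<Sum>k\<in>?A. v k * P w k)"
    unfolding sum_subtractf[symmetric] by (intro sum.cong) (auto simp: algebra_simps)
  then show ?thesis
    unfolding eform_def sum_col_split[where b = b] A C D F by simp
qed

section \<open>The bipartite Coxeter element and bilinearity of the Euler form\<close>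

lemma cox_lin: "cox (\<lambda>i. \<Sum>k\<in>K. c k * f k i) = (\<lambda>i. \<Sum>k\<in>K. c k * cox (f k) i)"
  by (simp add: cox_def flip_lin)

lemma cox_pow_lin:
  "(cox ^^ m) (\<lambda>i. \<Sum>k\<in>K. c k * f k i) = (\<lambda>i. \<Sum>k\<in>K. c k * (cox ^^ m) (f k) i)"
  by (induction m) (simp_all add: cox_lin)

lemma cox_add: "cox (\<lambda>i. v i + w i) = (\<lambda>i. cox v i + cox w i)"
  by (simp add: cox_def flip_add)

lemma cox_uminus: "cox (\<lambda>i. - v i) = (\<lambda>i. - cox v i)"
  by (simp add: cox_def flip_uminus)

lemma cox_pow_uminus: "(cox ^^ m) (\<lambda>i. - v i) = (\<lambda>i. - (cox ^^ m) v i)"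
  by (induction m) (simp_all add: cox_uminus)

lemma inj_cox: "inj cox"
  by (rule inj_on_inverseI[where g = "\<lambda>v. flip False (flip True v)"]) (simp add: cox_def)

lemma cox_pow_inj: "(cox ^^ m) v = (cox ^^ m) w \<longleftrightarrow> v = w"
  by (induction m) (use inj_cox in \<open>auto simp: inj_def\<close>)

lemma supported_cox [simp]: "supported (cox v) \<longleftrightarrow> supported v"
  by (simp add: cox_def)

lemma supported_cox_pow [simp]: "supported ((cox ^^ m) v) \<longleftrightarrow> supported v"
  by (induction m) simp_all

abbreviation E :: "('i \<Rightarrow> int) \<Rightarrow> ('i \<Rightarrow> int) \<Rightarrow> int" where
  "E \<equiv> eform False"

lemma E_cox: "E (cox v) (cox w) = E v w"
  using eform_flip[of True] eform_flip[of False] by (simp add: cox_def)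

lemma E_cox_pow: "E ((cox ^^ m) v) ((cox ^^ m) w) = E v w"
  by (induction m) (simp_all add: E_cox)

text \<open>The quadratic form forgets the orientation of the quiver.\<close>

lemma eform_not_diag: "eform (\<not> b) w w = eform b w w"
  using sum_nb_swap[where b = "\<not> b" and f = "\<lambda>k l. w k * w l"]
  by (simp add: eform_def mult.commute)

lemma eform_flip_same: "eform b (flip b' v) (flip b' v) = eform b v v"
  using eform_flip[of b' v v] eform_not_diag[of b v] eform_not_diag[of b "flip b' v"]
  by (cases b; cases b') auto



lemma eform_add_left: "eform b (\<lambda>i. v i + v' i) w = eform b v w + eform b v' w"
  by (simp add: eform_def distrib_right sum.distrib)

lemma eform_add_right: "eform b v (\<lambda>i. w i + w' i) = eform b v w + eform b v w'"
  by (simp add: eform_def distrib_left sum.distrib)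

lemma eform_scale_left: "eform b (\<lambda>i. c * v i) w = c * eform b v w"
  by (simp add: eform_def sum_distrib_left right_diff_distrib mult.assoc)

lemma eform_scale_right: "eform b v (\<lambda>i. c * w i) = c * eform b v w"
  by (simp add: eform_def sum_distrib_left right_diff_distrib mult.left_commute)

lemma eform_zero_left: "eform b (\<lambda>i. 0) w = 0"
  by (simp add: eform_def)

lemma eform_zero_right: "eform b v (\<lambda>i. 0) = 0"
  by (simp add: eform_def)

lemma eform_sum_left: "eform b (\<lambda>i. \<Sum>k\<in>K. c k * f k i) w = (\<Sum>k\<in>K. c k * eform b (f k) w)"
  by (induction K rule: infinite_finite_induct)
    (simp_all add: eform_add_left eform_scale_left eform_zero_left)

lemma eform_sum_right: "eform b v (\<lambda>i. \<Sum>k\<in>K. c k * f k i) = (\<Sum>k\<in>K. c k * eform b v (f k))"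
  by (induction K rule: infinite_finite_induct)
    (simp_all add: eform_add_right eform_scale_right eform_zero_right)

lemma eform_uminus_left [simp]: "eform b (\<lambda>i. - v i) w = - eform b v w"
  by (simp add: eform_def sum_negf)

lemma eform_uminus_right [simp]: "eform b v (\<lambda>i. - w i) = - eform b v w"
  by (simp add: eform_def sum_negf)

lemma sum_unit [simp]: "finite A \<Longrightarrow> (\<Sum>k\<in>A. unit_vec i k * f k) = (if i \<in> A then f i else 0)"
proof -
  assume A: "finite A"
  have "(\<Sum>k\<in>A. unit_vec i k * f k) = (\<Sum>k\<in>A. if k = i then f k else 0)"
    by (intro sum.cong) (auto simp: unit_vec_def)
  then show ?thesis using A by simp
qed

lemma sum_unit' [simp]: "finite A \<Longrightarrow> (\<Sum>k\<in>A. unit_vec i k) = (if i \<in> A then 1 else 0)"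
  using sum_unit[of A i "\<lambda>_. 1"] by simp

lemma sum_unit_at: "finite A \<Longrightarrow> (\<Sum>l\<in>A. unit_vec l i) = of_bool (i \<in> A)"
proof -
  assume "finite A"
  moreover have "(\<Sum>l\<in>A. unit_vec l i) = (\<Sum>l\<in>A. unit_vec i l)"
    by (intro sum.cong) (auto simp: unit_vec_def)
  ultimately show ?thesis by simp
qed

lemma eform_unit_left:
  assumes "i \<in> I"
  shows "eform b (unit_vec i) w = w i - (if col i = b then \<Sum>l\<in>nb i. w l else 0)"
proof -
  have "(\<Sum>k\<in>{k\<in>I. col k = b}. \<Sum>l\<in>nb k. unit_vec i k * w l) =
      (\<Sum>k\<in>{k\<in>I. col k = b}. unit_vec i k * (\<Sum>l\<in>nb k. w l))"
    by (simp only: sum_distrib_left)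
  then show ?thesis
    unfolding eform_def using assms finite_I by simp
qed

lemma unit_supported [simp]: "k \<in> I \<Longrightarrow> supported (unit_vec k)"
  by (auto simp: supported_def unit_vec_def)

lemma unit_expand: "(\<Sum>k\<in>I. v k * unit_vec k i) = (if i \<in> I then v i else 0)"
proof -
  have "(\<Sum>k\<in>I. v k * unit_vec k i) = (\<Sum>k\<in>I. unit_vec i k * v k)"
    by (intro sum.cong) (auto simp: unit_vec_def)
  then show ?thesis using finite_I by simp
qed



section \<open>Roots at the vertices of the unrolled quiver\<close>

definition off :: "'i \<Rightarrow> nat" where
  "off k = (if col k then 0 else 1)"

text \<open>The root at the vertex \<open>(k, n)\<close>, meaningful if \<open>adm k n\<close>: it is \<open>\<alpha>\<^sub>k\<close> in column \<open>0\<close> for colour \<open>True\<close>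
  and \<open>- \<alpha>\<^sub>k\<close> in column \<open>-1\<close> for colour \<open>False\<close>, and \<open>cox\<close> moves it by two columns.\<close>

definition rt :: "'i \<Rightarrow> nat \<Rightarrow> 'i \<Rightarrow> int" where
  "rt k n = (if col k then (cox ^^ (n div 2)) (unit_vec k)
             else (\<lambda>i. - (cox ^^ (Suc n div 2)) (unit_vec k) i))"

text \<open>The parity condition of \<open>Ihat\<close> with unbounded columns. Working on the
  unrolled quiver postpones all reduction modulo \<open>2 * h\<close>.\<close>

definition adm :: "'i \<Rightarrow> nat \<Rightarrow> bool" where
  "adm k n \<longleftrightarrow> k \<in> I \<and> (even n \<longleftrightarrow> col k)"

lemma adm_in: "adm k n \<Longrightarrow> k \<in> I"
  by (simp add: adm_def)

lemma adm_nb: "adm k n \<Longrightarrow> l \<in> nb k \<Longrightarrow> adm l (Suc n)"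
  using nb_col nb_in by (auto simp: adm_def)

lemma adm_off [simp]: "adm k (off k) \<longleftrightarrow> k \<in> I"
  by (simp add: adm_def off_def)

lemma adm_off_add [simp]: "adm k (off k + 2 * m) \<longleftrightarrow> k \<in> I"
  by (simp add: adm_def off_def)

lemma adm_ex: assumes "adm k n" obtains m where "n = off k + 2 * m"
proof
  show "n = off k + 2 * (n div 2)"
    using assms by (auto simp: adm_def off_def; presburger)
qed

lemma adm_add: "adm k n \<Longrightarrow> adm k (n + m) \<longleftrightarrow> even m"
  by (auto simp: adm_def)

lemma rt_add: "rt k (n + 2 * m) = (cox ^^ m) (rt k n)"
proof -
  have "(n + 2 * m) div 2 = m + n div 2" "Suc (n + 2 * m) div 2 = m + Suc n div 2"
    by simp_all
  then show ?thesis
    by (simp add: rt_def funpow_add cox_pow_uminus)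
qed

lemma rt_Suc_Suc: "rt k (Suc (Suc n)) = cox (rt k n)"
  using rt_add[of k n 1] by simp

lemma rt_off_col: "col k \<Longrightarrow> rt k (off k) = unit_vec k"
  by (simp add: rt_def off_def)

lemma flip_unit_off: "k \<in> I \<Longrightarrow> col k \<noteq> b \<Longrightarrow>
  flip b (unit_vec k) = (\<lambda>i. unit_vec k i + (\<Sum>l\<in>nb k. unit_vec l i))"
proof
  fix i assume k: "k \<in> I" "col k \<noteq> b"
  have "(\<Sum>l\<in>nb k. unit_vec l i) = of_bool (i \<in> nb k)"
    by (rule sum_unit_at) simp
  moreover have "flip b (unit_vec k) i = unit_vec k i + of_bool (i \<in> nb k)"
  proof (cases "i \<in> I \<and> col i = b")
    case True
    then have "unit_vec k i = 0" using k by (auto simp: unit_vec_def)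
    then show ?thesis using True nb_sym[of k i] nb_sym[of i k] k by (auto simp: flip_at)
  next
    case False
    then have "i \<notin> nb k" using nb_col[of k i] nb_in[of i k] k by auto
    then show ?thesis using False by (auto simp: flip_off)
  qed
  ultimately show "flip b (unit_vec k) i = unit_vec k i + (\<Sum>l\<in>nb k. unit_vec l i)"
    by simp
qed

lemma flip_unit_same: "k \<in> I \<Longrightarrow> flip (col k) (unit_vec k) = (\<lambda>i. - unit_vec k i)"
proof
  fix i assume k: "k \<in> I"
  show "flip (col k) (unit_vec k) i = - unit_vec k i"
  proof (cases "i \<in> I \<and> col i = col k")
    case True
    then have "k \<notin> nb i" using nb_col[of i k] by auto
    then show ?thesis using True by (simp add: flip_at)
  next
    case False
    then have "i \<noteq> k" using k by auto
    then show ?thesis using False by (simp add: flip_off unit_vec_def)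
  qed
qed

lemma cox_unit_odd:
  assumes "k \<in> I" "\<not> col k"
  shows "cox (unit_vec k) = (\<lambda>i. - (unit_vec k i + (\<Sum>l\<in>nb k. unit_vec l i)))"
  using assms flip_unit_same[of k] flip_unit_off[of k True]
  by (simp add: cox_def flip_uminus)

lemma cox_unit_even:
  assumes "k \<in> I" "col k"
  shows "cox (\<lambda>i. unit_vec k i + (\<Sum>l\<in>nb k. unit_vec l i)) = (\<lambda>i. - unit_vec k i)"
proof -
  have "cox (flip False (unit_vec k)) = (\<lambda>i. - unit_vec k i)"
    using flip_unit_same[of k] assms by (simp add: cox_def)
  with flip_unit_off[of k False] assms show ?thesis by simp
qed

lemma rt_off_odd:
  assumes "k \<in> I" "\<not> col k"
  shows "rt k (off k) = (\<lambda>i. unit_vec k i + (\<Sum>l\<in>nb k. unit_vec l i))"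
  using assms by (simp add: rt_def off_def cox_unit_odd add.commute)

lemma rt_supported: "k \<in> I \<Longrightarrow> supported (rt k n)"
proof -
  assume "k \<in> I"
  then have "supported ((cox ^^ m) (unit_vec k))" for m by simp
  then show ?thesis unfolding rt_def by (auto simp: supported_def)
qed

text \<open>Only the first mesh of each row has to be computed, since \<open>cox\<close> carries it
  to all later ones. Up to the signs in \<open>rt\<close> it is \<open>cox_unit_even\<close> for the
  colour \<open>True\<close> and \<open>cox_unit_odd\<close> for the colour
  \<open>False\<close>.\<close>

lemma rt_mesh0:
  assumes "k \<in> I"
  shows "(\<lambda>i. rt k (off k) i + cox (rt k (off k)) i) = (\<lambda>i. \<Sum>l\<in>nb k. rt l (Suc (off k)) i)"
proof (cases "col k")
  case True
  have "rt l (Suc (off k)) i = - cox (unit_vec l) i" if "l \<in> nb k" for l i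
    using nb_col[OF assms that] True by (simp add: rt_def off_def)
  then have 1: "(\<Sum>l\<in>nb k. rt l (Suc (off k)) i) = - cox (\<lambda>i. \<Sum>l\<in>nb k. unit_vec l i) i" for i
    using cox_lin[of "\<lambda>_. 1" unit_vec "nb k"] by (simp add: sum_negf)
  have 2: "cox (unit_vec k) i + cox (\<lambda>i. \<Sum>l\<in>nb k. unit_vec l i) i = - unit_vec k i" for i
    using fun_cong[OF cox_unit_even[OF assms True], of i]
      fun_cong[OF cox_add[of "unit_vec k" "\<lambda>i. \<Sum>l\<in>nb k. unit_vec l i"], of i] by simp
  have "unit_vec k i + cox (unit_vec k) i = (\<Sum>l\<in>nb k. rt l (Suc (off k)) i)" for i
    using 1[of i] 2[of i] by linarith
  then show ?thesis using rt_off_col[OF True] by simp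
next
  case False
  let ?S = "\<lambda>i. \<Sum>l\<in>nb k. unit_vec l i"
  have "rt l (Suc (off k)) i = cox (unit_vec l) i" if "l \<in> nb k" for l i
    using nb_col[OF assms that] False by (simp add: rt_def off_def)
  then have 1: "(\<Sum>l\<in>nb k. rt l (Suc (off k)) i) = cox ?S i" for i
    using cox_lin[of "\<lambda>_. 1" unit_vec "nb k"] by (simp)
  have "cox (rt k (off k)) i = cox (unit_vec k) i + cox ?S i" for i
    using cox_add[of "unit_vec k" ?S] rt_off_odd[OF assms False] by simp
  moreover have "rt k (off k) i = - cox (unit_vec k) i" for i
    using cox_unit_odd[OF assms False] rt_off_odd[OF assms False] by simp
  ultimately show ?thesis by (simp add: 1)
qed

lemma rt_mesh:
  assumes "adm k n"
  shows "rt k n i + rt k (Suc (Suc n)) i = (\<Sum>l\<in>nb k. rt l (Suc n) i)"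
proof -
  obtain m where n: "n = off k + 2 * m" using assms by (rule adm_ex)
  let ?c = "cox ^^ m"
  have *: "?c (\<lambda>i. v i + w i) = (\<lambda>i. ?c v i + ?c w i)" for v w
    by (induction m) (simp_all add: cox_add)
  have "rt k n i + rt k (Suc (Suc n)) i = ?c (\<lambda>i. rt k (off k) i + cox (rt k (off k)) i) i"
    by (simp add: n rt_add * rt_Suc_Suc funpow_swap1)
  also have "\<dots> = ?c (\<lambda>i. \<Sum>l\<in>nb k. 1 * rt l (Suc (off k)) i) i"
    using rt_mesh0[of k] adm_in[OF assms] by simp
  also have "\<dots> = (\<Sum>l\<in>nb k. rt l (Suc n) i)"
    unfolding cox_pow_lin using rt_add[of _ "Suc (off k)" m] by (simp add: n)
  finally show ?thesis .
qed

text \<open>The characteristic property of the indecomposable projectives: pairing with them reads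
  off coordinates. It turns known pairings into statements about signs.\<close>

lemma E_off:
  assumes "i \<in> I"
  shows "E (rt i (off i)) v = v i"
proof (cases "col i")
  case True
  then show ?thesis using assms by (simp add: rt_off_col eform_unit_left)
next
  case False
  have "E (\<lambda>j. \<Sum>l\<in>nb i. unit_vec l j) v = (\<Sum>l\<in>nb i. v l)"
    using eform_sum_left[of False "\<lambda>_. 1" unit_vec "nb i" v] nb_col[OF assms] False nb_in
    by (simp add: eform_unit_left)
  then show ?thesis
    using assms False by (simp add: rt_off_odd eform_add_left eform_unit_left)
qed

lemma E_shift: "E (rt i (a + 2 * m)) (rt j (b + 2 * m)) = E (rt i a) (rt j b)"
  by (simp add: rt_add E_cox_pow)

lemma rt_off_at:
  assumes "i \<in> I" "k \<in> I"
  shows "rt k (off k) i = of_bool (i = k) + of_bool (\<not> col k \<and> adj k i)"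
proof (cases "col k")
  case True
  then show ?thesis by (simp add: rt_off_col unit_vec_def)
next
  case False
  have "(\<Sum>l\<in>nb k. unit_vec l i) = of_bool (i \<in> nb k)"
    by (rule sum_unit_at) simp
  with False assms show ?thesis by (simp add: rt_off_odd nb_iff unit_vec_def)
qed

lemma E_same:
  assumes "adm i n" "adm j n"
  shows "E (rt i n) (rt j n) = of_bool (i = j)"
proof -
  obtain m where n: "n = off i + 2 * m" using assms(1) by (rule adm_ex)
  have "col i = col j" using assms by (auto simp: adm_def)
  then have "off j = off i" by (simp add: off_def)
  then show ?thesis
    using assms col_adj[of j i] rt_off_at[of i j] \<open>col i = col j\<close>
    by (auto simp: n E_shift E_off adm_def)
qed

lemma E_next:
  assumes "adm i n" "adm j (Suc n)"
  shows "E (rt i n) (rt j (Suc n)) = of_bool (adj i j)"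
proof -
  obtain m where n: "n = off i + 2 * m" using assms(1) by (rule adm_ex)
  have col: "col j = (\<not> col i)" and ij: "i \<in> I" "j \<in> I" using assms by (auto simp: adm_def)
  have "E (rt i n) (rt j (Suc n)) = rt j (Suc (off i)) i"
    using E_shift[of i "off i" m j "Suc (off i)"] by (simp add: n E_off ij)
  also have "\<dots> = of_bool (adj i j)"
  proof (cases "col i")
    case True
    then have "Suc (off i) = off j" using col by (simp add: off_def)
    then show ?thesis using rt_off_at[OF ij] col True adj_commute[OF ij] by (auto simp: of_bool_def)
  next
    case False
    then have off: "off i = 1" "adm j 0" "off j = 0" using col ij by (auto simp: off_def adm_def)
    \<comment> \<open>Here \<open>Suc (off i)\<close> is column 2, outside the starting slice; the
      mesh of row \<open>j\<close> starting in column 0 leads back to columns 0 and 1.\<close>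
    have "rt j 0 i + rt j (Suc (off i)) i = (\<Sum>l\<in>nb j. rt l 1 i)"
      using rt_mesh[OF off(2), of i] off by simp
    also have "\<dots> = (\<Sum>l\<in>nb j. unit_vec l i)"
    proof (intro sum.cong refl)
      fix l assume l: "l \<in> nb j"
      then have "col l = col i" "off l = 1"
        using nb_col[OF ij(2) l] col False by (auto simp: off_def)
      moreover have "\<not> adj l i" using col_adj[of l i] nb_in[OF l] ij \<open>col l = col i\<close> by auto
      ultimately show "rt l 1 i = unit_vec l i"
        using rt_off_at[OF ij(1) nb_in[OF l]] by (simp add: unit_vec_def)
    qed
    also have "\<dots> = of_bool (adj i j)"
      using ij adj_commute[OF ij] by (simp add: sum_unit_at nb_iff)
    also have "rt j 0 i = 0"
      using rt_off_at[OF ij] off col False by auto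
    finally show ?thesis by simp
  qed
  finally show ?thesis .
qed

text \<open>The Chebyshev polynomial \<open>U\<^sub>n (N / 2)\<close> of the adjacency matrix \<open>N\<close>.\<close>

fun cheb :: "nat \<Rightarrow> 'i \<Rightarrow> 'i \<Rightarrow> int" where
  "cheb 0 i k = of_bool (i = k)"
| "cheb (Suc 0) i k = of_bool (adj i k)"
| "cheb (Suc (Suc n)) i k = (\<Sum>l\<in>nb k. cheb (Suc n) i l) - cheb n i k"

lemma E_mesh:
  assumes "adm k n"
  shows "E v (rt k n) + E v (rt k (Suc (Suc n))) = (\<Sum>l\<in>nb k. E v (rt l (Suc n)))"
proof -
  have "E v (\<lambda>i. rt k n i + rt k (Suc (Suc n)) i) = E v (\<lambda>i. \<Sum>l\<in>nb k. 1 * rt l (Suc n) i)"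
    using rt_mesh[OF assms] by simp
  then show ?thesis unfolding eform_add_right eform_sum_right by simp
qed

text \<open>Both sides obey the same three-term recursion in the column distance;
  \<open>E_same\<close> and \<open>E_next\<close> supply the initial values.\<close>

lemma E_cheb:
  assumes "adm i a" "adm k (a + n)"
  shows "E (rt i a) (rt k (a + n)) = cheb n i k"
  using assms(2)
proof (induction n arbitrary: k rule: induct_nat_012)
  case 0
  then show ?case using E_same assms by simp
next
  case 1
  then show ?case using E_next assms by simp
next
  case (ge2 n)
  have 1: "adm k (a + n)" using ge2.prems by (simp add: adm_def)
  have 2: "E (rt i a) (rt l (Suc (a + n))) = cheb (Suc n) i l" if "l \<in> nb k" for l
    using ge2.IH(2)[of l] adm_nb[OF 1 that] by simp
  show ?case using E_mesh[OF 1, of "rt i a"] 2 ge2.IH(1)[OF 1] by simp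
qed

text \<open>The recursion multiplies by the adjacency matrix on the right only, so symmetry of the
  next matrix needs commutation with the adjacency matrix; the two are proved in one
  induction.\<close>

lemma cheb_sum_comm:
  assumes "i \<in> I" "k \<in> I"
  shows "cheb n i k = cheb n k i \<and> (\<Sum>l\<in>nb k. cheb n i l) = (\<Sum>l\<in>nb i. cheb n l k)"
  using assms
proof (induction n arbitrary: i k rule: induct_nat_012)
  case 0
  have "(\<Sum>l\<in>nb k. of_bool (i = l)) = (of_bool (i \<in> nb k) :: int)"
    "(\<Sum>l\<in>nb i. of_bool (l = k)) = (of_bool (k \<in> nb i) :: int)"
    using sum_unit_at[of "nb k" i] sum_unit'[of "nb i" k] by (simp_all add: unit_vec_def)
  moreover have "i \<in> nb k \<longleftrightarrow> k \<in> nb i" using 0 nb_sym by blast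
  ultimately show ?case by auto
next
  case 1
  have "(\<Sum>l\<in>nb k. of_bool (adj i l)) = (\<Sum>l\<in>nb i. of_bool (adj l k) :: int)"
  proof -
    have "(\<Sum>l\<in>nb k. of_bool (adj i l)) = (\<Sum>l\<in>nb i \<inter> nb k. 1 :: int)"
      by (intro sum.mono_neutral_cong_right) (auto simp: nb_iff)
    moreover have "(\<Sum>l\<in>nb i. of_bool (adj l k)) = (\<Sum>l\<in>nb i \<inter> nb k. 1 :: int)"
      by (intro sum.mono_neutral_cong_right) (use 1 adj_commute in \<open>auto simp: nb_iff\<close>)
    ultimately show ?thesis by simp
  qed
  then show ?case using adj_commute[OF 1] by simp
next
  case (ge2 n)
  have comm: "(\<Sum>l\<in>nb k. cheb (Suc n) i l) = (\<Sum>l\<in>nb i. cheb (Suc n) l k)" if "i \<in> I" "k \<in> I" for i k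
    using ge2.IH(2) that by blast
  have "(\<Sum>l\<in>nb k. cheb (Suc n) i l) = (\<Sum>l\<in>nb i. cheb (Suc n) k l)"
    unfolding comm[OF ge2.prems] using ge2.IH(2) nb_in ge2.prems by (intro sum.cong) auto
  moreover have "(\<Sum>l\<in>nb k. \<Sum>m\<in>nb l. cheb (Suc n) i m) = (\<Sum>m\<in>nb i. \<Sum>l\<in>nb k. cheb (Suc n) m l)"
  proof -
    have "(\<Sum>l\<in>nb k. \<Sum>m\<in>nb l. cheb (Suc n) i m) = (\<Sum>l\<in>nb k. \<Sum>m\<in>nb i. cheb (Suc n) m l)"
      by (intro sum.cong refl comm nb_in ge2.prems)
    then show ?thesis by (simp only: sum.swap[of _ "nb i"])
  qed
  moreover have "(\<Sum>l\<in>nb k. cheb n i l) = (\<Sum>l\<in>nb i. cheb n l k)" "cheb n i k = cheb n k i"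
    using ge2.IH(1) ge2.prems by blast+
  ultimately show ?case by (simp add: sum_subtractf)
qed

lemma cheb_sym: "i \<in> I \<Longrightarrow> k \<in> I \<Longrightarrow> cheb n i k = cheb n k i"
  using cheb_sum_comm by blast

end

section \<open>Roots and the Nakayama automorphism\<close>

lemma sum_squares_eq_1:
  fixes w :: "'i \<Rightarrow> int"
  assumes "finite A" "(\<Sum>i\<in>A. w i * w i) = 1" "\<And>i. i \<notin> A \<Longrightarrow> w i = 0" "nonneg_vec w"
  obtains k where "k \<in> A" "w = unit_vec k"
proof -
  have "\<not> (\<forall>k\<in>A. w k = 0)"
  proof
    assume "\<forall>k\<in>A. w k = 0"
    then have "(\<Sum>i\<in>A. w i * w i) = 0" by (intro sum.neutral) auto
    with assms(2) show False by simp
  qed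
  then obtain k where k: "k \<in> A" "w k \<noteq> 0" by blast
  have split: "(\<Sum>i\<in>A. w i * w i) = w k * w k + (\<Sum>i\<in>A - {k}. w i * w i)"
    using assms(1) k(1) by (rule sum.remove)
  have "0 < w k" using k assms(4) by (simp add: nonneg_vec_def order_less_le)
  then have sq: "1 \<le> w k" "w k \<le> w k * w k"
    using mult_left_mono[of 1 "w k" "w k"] by simp_all
  have "0 \<le> (\<Sum>i\<in>A - {k}. w i * w i)" by (intro sum_nonneg) simp
  with sq split assms(2) have "w k = 1" "(\<Sum>i\<in>A - {k}. w i * w i) = 0" by linarith+
  then have "\<forall>i\<in>A - {k}. w i = 0"
    using assms(1) sum_nonneg_eq_0_iff[of "A - {k}" "\<lambda>i. w i * w i"] by simp
  then have "w = unit_vec k"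
    using \<open>w k = 1\<close> assms(3) by (auto simp: unit_vec_def fun_eq_iff)
  with k(1) show thesis by (rule that)
qed

text \<open>\<open>h\<close> is here the order of the bipartite element \<open>cox\<close>;
  arbitrary Coxeter elements are compared with it separately.\<close>

locale periodic_diagram = bipartite_diagram I adj col
  for I :: "'i set" and adj :: "'i \<Rightarrow> 'i \<Rightarrow> bool" and col :: "'i \<Rightarrow> bool" +
  fixes h :: nat
  assumes connected: "\<And>S. S \<subseteq> I \<Longrightarrow> S \<noteq> {} \<Longrightarrow> (\<And>i j. i \<in> S \<Longrightarrow> j \<in> nb i \<Longrightarrow> j \<in> S) \<Longrightarrow> S = I"
    and posdef: "\<And>v. supported v \<Longrightarrow> v \<noteq> (\<lambda>i. 0) \<Longrightarrow> 0 < E v v"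
    and h_pos: "0 < h"
    and cox_pow_h: "cox ^^ h = id"
    and h_minimal: "\<And>m. 0 < m \<Longrightarrow> m < h \<Longrightarrow> cox ^^ m \<noteq> id"
begin

section \<open>Signs of roots under the Coxeter element\<close>

definition is_root :: "('i \<Rightarrow> int) \<Rightarrow> bool" where
  "is_root v \<longleftrightarrow> supported v \<and> E v v = 1"

abbreviation nonpos_vec :: "('i \<Rightarrow> int) \<Rightarrow> bool" where
  "nonpos_vec v \<equiv> nonneg_vec (\<lambda>i. - v i)"

lemma root_uminus [simp]: "is_root (\<lambda>i. - v i) \<longleftrightarrow> is_root v"
  by (simp add: is_root_def supported_def)

lemma root_flip [simp]: "is_root (flip b v) \<longleftrightarrow> is_root v"
  by (simp add: is_root_def eform_flip_same)

lemma root_cox [simp]: "is_root (cox v) \<longleftrightarrow> is_root v"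
  by (simp add: cox_def)

lemma root_cox_pow [simp]: "is_root ((cox ^^ m) v) \<longleftrightarrow> is_root v"
  by (induction m) simp_all

lemma root_rt: "adm k n \<Longrightarrow> is_root (rt k n)"
  using E_same[of k n k] by (simp add: is_root_def rt_supported adm_in)

lemma root_signs: "is_root v \<Longrightarrow> nonneg_vec v \<Longrightarrow> \<not> nonpos_vec v"
proof
  assume "is_root v" "nonneg_vec v" "nonpos_vec v"
  then have "v = (\<lambda>i. 0)" by (auto simp: nonneg_vec_def fun_eq_iff intro: antisym)
  then show False using \<open>is_root v\<close> by (simp add: is_root_def eform_zero_left)
qed



text \<open>The positive and the negative part of \<open>v\<close> have disjoint supports, so their mixed terms
  contribute nonnegatively to \<open>E v v = 1\<close>, and only one of the parts can be nonzero.\<close>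

lemma root_sign: "is_root v \<Longrightarrow> nonneg_vec v \<or> nonpos_vec v"
proof (rule ccontr)
  assume v: "is_root v" and not: "\<not> (nonneg_vec v \<or> nonpos_vec v)"
  define p where "p = (\<lambda>i. max (v i) 0)"
  define q where "q = (\<lambda>i. max (- v i) 0)"
  have supp: "supported p" "supported q"
    using v by (auto simp: p_def q_def is_root_def supported_def)
  have mixed: "E p q \<le> 0" "E q p \<le> 0"
  proof -
    have "(\<Sum>k\<in>I. p k * q k) = 0" "(\<Sum>k\<in>I. q k * p k) = 0"
      by (intro sum.neutral ballI; auto simp: p_def q_def max_def)+
    moreover have "0 \<le> (\<Sum>k\<in>{k\<in>I. col k = False}. \<Sum>l\<in>nb k. p k * q l)"
      "0 \<le> (\<Sum>k\<in>{k\<in>I. col k = False}. \<Sum>l\<in>nb k. q k * p l)"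
      by (intro sum_nonneg; simp add: p_def q_def)+
    ultimately show "E p q \<le> 0" "E q p \<le> 0" by (simp_all add: eform_def)
  qed
  have "v = (\<lambda>i. p i + - q i)" by (auto simp: p_def q_def max_def)
  then have "E v v = E p p + E q q - E p q - E q p"
    using eform_add_left[of False p "\<lambda>i. - q i"] eform_add_right[of False _ p "\<lambda>i. - q i"] by simp
  moreover have "p \<noteq> (\<lambda>i. 0)" "q \<noteq> (\<lambda>i. 0)"
    using not by (auto simp: p_def q_def nonneg_vec_def fun_eq_iff max_def not_le)
  ultimately show False
    using posdef[OF supp(1)] posdef[OF supp(2)] mixed v by (simp add: is_root_def)
qed

text \<open>If \<open>cox\<close> fixes \<open>v\<close>, the two flips of \<open>v\<close> agree;
  as they change different colours, neither changes anything. Hence \<open>v\<close> lies in the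
  radical of the symmetrized form, and \<open>E v v = 0\<close>.\<close>

lemma cox_fixed:
  assumes "supported v" "cox v = v"
  shows "v = (\<lambda>i. 0)"
proof (rule ccontr)
  assume "v \<noteq> (\<lambda>i. 0)"
  have eq: "flip False v = flip True v"
    using assms(2) flip_flip[of True "flip False v"] by (simp add: cox_def)
  have bal: "(\<Sum>l\<in>nb i. v l) = 2 * v i" if "i \<in> I" for i
    using fun_cong[OF eq, of i] that by (cases "col i") (auto simp: flip_def)
  have sums: "(\<Sum>k\<in>{k\<in>I. col k = b}. \<Sum>l\<in>nb k. v k * v l) = 2 * (\<Sum>k\<in>{k\<in>I. col k = b}. v k * v k)" for b
    unfolding sum_distrib_left[of 2]
    by (intro sum.cong refl) (use bal in \<open>simp add: sum_distrib_left[symmetric]\<close>)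
  have "eform False v v + eform True v v = 0"
    using sums[of True] sums[of False] sum_col_split[of "\<lambda>k. v k * v k" False] unfolding eform_def by simp
  then have "E v v = 0" using eform_not_diag[of False v] by simp
  then show False using posdef[OF assms(1) \<open>v \<noteq> (\<lambda>i. 0)\<close>] by simp
qed

lemma orbit_nonpos:
  assumes "is_root v"
  shows "\<exists>m. nonpos_vec ((cox ^^ m) v)"
proof (rule ccontr)
  assume "\<nexists>m. nonpos_vec ((cox ^^ m) v)"
  then have pos: "nonneg_vec ((cox ^^ m) v)" for m
    using root_sign[of "(cox ^^ m) v"] assms by auto
  define s where "s = (\<lambda>i. \<Sum>m<h. 1 * (cox ^^ m) v i)"
  have "cox s = (\<lambda>i. \<Sum>m<h. (cox ^^ Suc m) v i)"
    unfolding s_def cox_lin by simp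
  also have "\<dots> = s"
  proof
    fix i
    have "(\<Sum>m<h. (cox ^^ Suc m) v i) + (cox ^^ 0) v i = (\<Sum>m<Suc h. (cox ^^ m) v i)"
      by (simp only: sum.lessThan_Suc_shift add.commute)
    then show "(\<Sum>m<h. (cox ^^ Suc m) v i) = s i"
      by (simp add: s_def cox_pow_h)
  qed
  finally have "cox s = s" .
  moreover have "supported s"
    using assms supported_cox_pow[of _ v] by (simp add: s_def is_root_def supported_def)
  ultimately have "s = (\<lambda>i. 0)" by (intro cox_fixed)
  then have "(\<Sum>m<h. (cox ^^ m) v i) = 0" for i by (simp add: s_def fun_eq_iff)
  then have "\<forall>m\<in>{..<h}. (cox ^^ m) v i = 0" for i
    using pos sum_nonneg_eq_0_iff[of "{..<h}" "\<lambda>m. (cox ^^ m) v i"]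
    by (simp add: nonneg_vec_def)
  then have "(cox ^^ 0) v i = 0" for i
    using h_pos by blast
  then have "v = (\<lambda>i. 0)" by (simp add: fun_eq_iff)
  then show False using assms by (simp add: is_root_def eform_zero_left)
qed

lemma rt_off_nonneg: "k \<in> I \<Longrightarrow> nonneg_vec (rt k (off k))"
  unfolding nonneg_vec_def
proof
  fix i assume "k \<in> I"
  then show "0 \<le> rt k (off k) i"
    using rt_off_at[of i k] rt_supported[of k "off k"]
    by (cases "i \<in> I") (auto simp: supported_def)
qed

text \<open>No edge joins two vertices of the support, so the quadratic form becomes a sum of
  integer squares with value 1.\<close>

lemma root_monochrome:
  assumes "is_root v" "nonneg_vec v" "\<And>i. i \<in> I \<Longrightarrow> col i = b \<Longrightarrow> v i = 0"
  obtains k where "k \<in> I" "col k = (\<not> b)" "v = unit_vec k"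
proof -
  have "eform b v v = E v v"
    using eform_not_diag[of b v] by (cases b) auto
  moreover have "(\<Sum>k\<in>{k\<in>I. col k = b}. \<Sum>l\<in>nb k. v k * v l) = 0"
    using assms(3) by (intro sum.neutral) auto
  ultimately have "(\<Sum>i\<in>I. v i * v i) = 1"
    using assms(1) unfolding eform_def is_root_def by auto
  then obtain k where k: "k \<in> I" "v = unit_vec k"
    using sum_squares_eq_1[OF finite_I _ _ assms(2)] assms(1) by (auto simp: is_root_def supported_def)
  moreover have "col k = (\<not> b)" using assms(3)[of k] k by (auto simp: unit_vec_def)
  ultimately show thesis using that by blast
qed

text \<open>Writing \<open>cox v = flip True (flip False v)\<close>, a flip keeps a positive root positive unless that
  root is supported on the flipped colour, where roots are unit vectors.\<close>

lemma sign_change: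
  assumes "is_root v" "nonneg_vec v" "nonpos_vec (cox v)"
  shows "\<exists>k\<in>I. cox v = (\<lambda>i. - rt k (off k) i)"
proof (cases "\<exists>i\<in>I. col i \<and> v i \<noteq> 0")
  case True
  then obtain i where i: "i \<in> I" "col i" "v i \<noteq> 0" by blast
  define w where "w = flip False v"
  have "is_root w" using assms(1) by (simp add: w_def)
  moreover have "0 < w i"
    using i assms(2) by (simp add: w_def flip_off nonneg_vec_def order_less_le)
  ultimately have w: "nonneg_vec w"
    using root_sign[of w] by (auto simp: nonneg_vec_def dest: spec[of _ i])
  \<comment> \<open>At the vertices of colour \<open>False\<close> the second flip changes nothing,
    so there \<open>w j\<close> is both nonnegative and nonpositive.\<close>
  have "w j = 0" if "j \<in> I" "col j = False" for j
  proof -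
    have "cox v j = w j" using that by (simp add: cox_def w_def flip_off)
    moreover have "0 \<le> w j" "cox v j \<le> 0" using w assms(3) by (simp_all add: nonneg_vec_def)
    ultimately show ?thesis by simp
  qed
  then obtain k where k: "k \<in> I" "col k" "w = unit_vec k"
    using root_monochrome[OF \<open>is_root w\<close> w, of False] by auto
  have "cox v = (\<lambda>i. - rt k (off k) i)"
    using flip_unit_same[of k] k rt_off_col[of k] by (simp add: cox_def w_def[symmetric])
  with k(1) show ?thesis by blast
next
  case False
  then obtain k where k: "k \<in> I" "\<not> col k" "v = unit_vec k"
    using root_monochrome[OF assms(1,2), of True] by auto
  then have "cox v = (\<lambda>i. - rt k (off k) i)" by (simp only: cox_unit_odd[OF k(1,2)] rt_off_odd[OF k(1,2)])
  with k(1) show ?thesis by blast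
qed

section \<open>Lengths of the rows and the Nakayama permutation\<close>

definition ht :: "'i \<Rightarrow> nat" where
  "ht k = (LEAST t. nonpos_vec (rt k (off k + 2 * t)))"

text \<open>Before this column, row \<open>k\<close> consists of positive roots, the classes of the
  inverse translates of the projective at \<open>k\<close>; at this column it enters the next
  suspension.\<close>

definition stop :: "'i \<Rightarrow> nat" where
  "stop k = off k + 2 * ht k"

lemma rt_nonpos: "k \<in> I \<Longrightarrow> nonpos_vec (rt k (stop k))"
proof -
  assume "k \<in> I"
  then have "\<exists>t. nonpos_vec (rt k (off k + 2 * t))"
    using orbit_nonpos[of "rt k (off k)"] root_rt[of k "off k"] by (simp add: rt_add)
  then show ?thesis unfolding stop_def ht_def by (rule LeastI_ex)
qed

lemma rt_nonneg:
  assumes "k \<in> I" "t < ht k"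
  shows "nonneg_vec (rt k (off k + 2 * t))"
  using not_less_Least[OF assms(2)[unfolded ht_def]] root_sign[of "rt k (off k + 2 * t)"] assms(1)
    root_rt[of k "off k + 2 * t"] by auto

lemma ht_le: "nonpos_vec (rt k (off k + 2 * t)) \<Longrightarrow> ht k \<le> t"
  unfolding ht_def by (rule Least_le)

lemma ht_pos: "k \<in> I \<Longrightarrow> 0 < ht k"
  using rt_nonpos[of k] rt_off_nonneg[of k] root_signs[of "rt k (off k)"] root_rt[of k "off k"]
  by (cases "ht k") (auto simp: stop_def)

lemma adm_stop [simp]: "adm k (stop k) \<longleftrightarrow> k \<in> I"
  by (simp add: stop_def)

lemma star_ex:
  assumes "k \<in> I"
  shows "\<exists>k'\<in>I. rt k (stop k) = (\<lambda>i. - rt k' (off k') i)"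
proof -
  obtain t where t: "ht k = Suc t" using ht_pos[OF assms] gr0_implies_Suc by blast
  let ?v = "rt k (off k + 2 * t)"
  have "rt k (stop k) = cox ?v" by (simp add: stop_def t rt_Suc_Suc)
  moreover have "is_root ?v" using assms by (simp add: root_rt)
  ultimately show ?thesis
    using sign_change[of ?v] rt_nonneg[of k t] rt_nonpos[of k] assms t by simp
qed

text \<open>The Nakayama permutation. The choice is unique by \<open>rt_off_inj\<close>.\<close>

definition star :: "'i \<Rightarrow> 'i" where
  "star k = (SOME k'. k' \<in> I \<and> rt k (stop k) = (\<lambda>i. - rt k' (off k') i))"

lemma star_in: "k \<in> I \<Longrightarrow> star k \<in> I"
  and rt_stop: "k \<in> I \<Longrightarrow> rt k (stop k) = (\<lambda>i. - rt (star k) (off (star k)) i)"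
  using someI_ex[of "\<lambda>k'. k' \<in> I \<and> rt k (stop k) = (\<lambda>i. - rt k' (off k') i)"] star_ex[of k]
  unfolding star_def by blast+

text \<open>The adjacent vertex in the next column has pairing 1 with \<open>rt k (stop k)\<close>,
  the negative of a projective class. By \<open>E_off\<close> it therefore has a coordinate -1, and
  a root with a negative coordinate is nonpositive.\<close>

lemma stop_nb_le:
  assumes "k \<in> I" "l \<in> nb k"
  shows "stop l \<le> Suc (stop k)"
proof -
  have l: "adm l (Suc (stop k))" using adm_nb[of k "stop k" l] assms by simp
  have "E (rt k (stop k)) (rt l (Suc (stop k))) = 1"
    using E_next[of k "stop k" l] l assms by (simp add: nb_iff)
  then have "rt l (Suc (stop k)) (star k) = -1"
    using rt_stop[OF assms(1)] E_off[OF star_in[OF assms(1)]] by simp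
  then have "nonpos_vec (rt l (Suc (stop k)))"
    using root_sign[OF root_rt[OF l]] by (auto simp: nonneg_vec_def dest: spec[of _ "star k"])
  moreover obtain t where "Suc (stop k) = off l + 2 * t" using l by (rule adm_ex)
  ultimately show ?thesis using ht_le[of l t] by (simp add: stop_def)
qed

lemma stop_nb:
  assumes "k \<in> I" "l \<in> nb k"
  shows "stop l = Suc (stop k) \<or> stop k = Suc (stop l)"
proof -
  have "stop k \<noteq> stop l"
    using adm_stop[of k] adm_stop[of l] nb_col[OF assms] assms nb_in[OF assms(2)]
    by (auto simp: adm_def)
  then show ?thesis
    using stop_nb_le[OF assms] stop_nb_le[OF nb_in[OF assms(2)] nb_sym[OF assms]] by linarith
qed

lemma rt_off_inj:
  assumes "k \<in> I" "l \<in> I" "rt k (off k) = rt l (off l)"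
  shows "k = l"
proof (rule ccontr)
  assume "k \<noteq> l"
  then have "\<not> col k" "\<not> col l" "adj k l"
    using rt_off_at[of k k] rt_off_at[of l l] rt_off_at[of k l] rt_off_at[of l k] assms
    by (auto simp: of_bool_def split: if_splits)
  then show False using col_adj[of k l] assms by simp
qed

text \<open>The starting slice is the left boundary of the positive roots: the translate of a
  projective is the negative of an injective class.\<close>

lemma before_off_nonpos:
  assumes "k \<in> I" "cox w = rt k (off k)"
  shows "nonpos_vec w"
proof -
  have "\<exists>u. nonneg_vec u \<and> cox (\<lambda>i. - u i) = rt k (off k)"
  proof (cases "col k")
    case True
    let ?u = "\<lambda>i. unit_vec k i + (\<Sum>l\<in>nb k. unit_vec l i)"
    have "cox (\<lambda>i. - ?u i) = rt k (off k)"
      unfolding cox_uminus cox_unit_even[OF assms(1) True] by (simp add: rt_off_col True)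
    moreover have "nonneg_vec ?u"
      by (auto simp: nonneg_vec_def unit_vec_def intro!: add_nonneg_nonneg sum_nonneg)
    ultimately show ?thesis by blast
  next
    case False
    then have "cox (\<lambda>i. - unit_vec k i) = rt k (off k)"
      by (simp add: rt_def off_def cox_uminus)
    moreover have "nonneg_vec (unit_vec k)" by (simp add: nonneg_vec_def unit_vec_def)
    ultimately show ?thesis by blast
  qed
  then obtain u where "nonneg_vec u" "w = (\<lambda>i. - u i)"
    using assms(2) inj_cox by (metis injD)
  then show ?thesis by simp
qed

text \<open>Cancelling \<open>cox ^^ a\<close> moves the coincidence to the starting slice. One step
  before it, row \<open>l\<close> is nonpositive by \<open>before_off_nonpos\<close>, so it has
  already passed its first negative root.\<close>

lemma rt_collision:
  assumes "k \<in> I" "l \<in> I" "a \<le> b" "rt k (off k + 2 * a) = rt l (off l + 2 * b)"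
  shows "rt k (off k) = rt l (off l + 2 * (b - a))" (is ?eq)
    and "a < b \<Longrightarrow> ht l < b - a"
proof -
  have "off l + 2 * b = off l + 2 * (b - a) + 2 * a" using assms(3) by simp
  then have "(cox ^^ a) (rt k (off k)) = (cox ^^ a) (rt l (off l + 2 * (b - a)))"
    using assms(4) by (metis rt_add)
  then show eq: ?eq by (simp add: cox_pow_inj)
  assume "a < b"
  then obtain c where c: "b - a = Suc c" by (metis Suc_diff_Suc)
  let ?w = "rt l (off l + 2 * c)"
  have w: "cox ?w = rt k (off k)" using eq by (simp add: c rt_Suc_Suc)
  have "nonpos_vec ?w" using assms(1) w by (rule before_off_nonpos)
  then show "ht l < b - a" using ht_le[of l c] c by simp
qed

text \<open>Equal images make the two rows meet at their stops. If the heights differed,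
  \<open>rt_collision\<close> would demand \<open>ht l < ht l - ht k\<close>.\<close>

lemma star_inj:
  assumes "k \<in> I" "l \<in> I" "star k = star l"
  shows "k = l"
proof -
  have wlog: "k = l" if "k \<in> I" "l \<in> I" "star k = star l" "ht k \<le> ht l" for k l
  proof -
    have "rt k (off k + 2 * ht k) = rt l (off l + 2 * ht l)"
      using rt_stop[OF that(1)] rt_stop[OF that(2)] that(3) by (simp add: stop_def)
    note coll = rt_collision[OF that(1,2,4) this]
    have "ht k = ht l"
    proof (rule ccontr)
      assume "ht k \<noteq> ht l"
      then have "ht l < ht l - ht k" using coll(2) that(4) by simp
      then show False by simp
    qed
    then show ?thesis using coll(1) that rt_off_inj by simp
  qed
  show ?thesis
    using wlog[OF assms] wlog[OF assms(2,1) assms(3)[symmetric]] by (cases "ht k \<le> ht l") auto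
qed

text \<open>The pairing of \<open>rt k (stop k)\<close> with \<open>rt l (stop l)\<close> is \<open>1\<close>, and so is the one of their
  negatives; a coordinate of a slice vertex is \<open>1\<close> only towards an odd neighbour.\<close>

lemma star_nb:
  assumes "k \<in> I" "l \<in> nb k" "stop l = Suc (stop k)"
  shows "col (star k)" "\<not> col (star l)"
proof -
  have l: "l \<in> I" using assms(2) by (rule nb_in)
  have "k \<noteq> l" using nb_col[OF assms(1,2)] by auto
  then have ne: "star k \<noteq> star l" using star_inj assms(1) l by blast
  have "E (rt k (stop k)) (rt l (stop l)) = 1"
    using E_next[of k "stop k" l] adm_nb[of k "stop k" l] assms by (simp add: nb_iff)
  then have "rt (star l) (off (star l)) (star k) = 1"
    unfolding rt_stop[OF assms(1)] rt_stop[OF l] using E_off[OF star_in[OF assms(1)]] by simp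
  then have *: "\<not> col (star l)" "adj (star l) (star k)"
    using rt_off_at[of "star k" "star l"] star_in assms(1) l ne by (auto simp: of_bool_def split: if_splits)
  then show "\<not> col (star l)" "col (star k)"
    using col_adj[of "star l" "star k"] star_in assms(1) l by auto
qed

text \<open>Along an edge, \<open>stop\<close> and \<open>off\<close> of the image under
  \<open>star\<close> change by the same amount, by \<open>stop_nb\<close> and
  \<open>star_nb\<close>; connectedness makes the difference constant.\<close>

lemma stop_const: "\<exists>H. \<forall>k\<in>I. stop k = off (star k) + H"
proof (cases "I = {}")
  case True
  then show ?thesis by simp
next
  case False
  then obtain r where r: "r \<in> I" by blast
  have step: "stop l + off (star k) = stop k + off (star l)" if "k \<in> I" "l \<in> nb k" for k l
    using stop_nb[OF that] star_nb[OF that] star_nb[OF nb_in[OF that(2)] nb_sym[OF that]]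
    by (auto simp: off_def)
  define S where "S = {k \<in> I. stop k + off (star r) = stop r + off (star k)}"
  have "S = I"
  proof (rule connected)
    show "S \<subseteq> I" "S \<noteq> {}" using r by (auto simp: S_def)
  next
    fix i j assume "i \<in> S" "j \<in> nb i"
    then show "j \<in> S" using step[of i j] nb_in[of j i] by (auto simp: S_def)
  qed
  \<comment> \<open>\<open>off\<close> is at most 1, so the subtraction of natural numbers below is
    exact.\<close>
  have "1 \<le> stop r" using ht_pos[OF r] by (simp add: stop_def)
  then have "off (star r) \<le> stop r" by (simp add: off_def)
  then have "stop k = off (star k) + (stop r - off (star r))" if "k \<in> I" for k
  proof -
    have "k \<in> S" using that \<open>S = I\<close> by simp
    then have "stop k + off (star r) = stop r + off (star k)" by (simp add: S_def)
    then show ?thesis using \<open>off (star r) \<le> stop r\<close> by linarith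
  qed
  then show ?thesis by blast
qed

text \<open>The \<open>H\<close> of the overview. For empty \<open>I\<close> its value is arbitrary,
  which is why \<open>h_le_nak\<close> excludes that case.\<close>

definition nak :: nat where
  "nak = (SOME H. \<forall>k\<in>I. stop k = off (star k) + H)"

lemma stop_eq: "k \<in> I \<Longrightarrow> stop k = off (star k) + nak"
  using someI_ex[OF stop_const] unfolding nak_def by blast

lemma rt_nak:
  assumes "k \<in> I" "adm (star k) n"
  shows "rt k (n + nak) = (\<lambda>i. - rt (star k) n i)"
proof -
  obtain m where n: "n = off (star k) + 2 * m" using assms(2) by (rule adm_ex)
  have "rt k (n + nak) = rt k (stop k + 2 * m)"
    by (simp add: n stop_eq[OF assms(1)] algebra_simps)
  then show ?thesis
    by (simp add: n rt_add rt_stop[OF assms(1)] cox_pow_uminus)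
qed

lemma adm_nak: "k \<in> I \<Longrightarrow> adm k (n + nak) \<longleftrightarrow> adm (star k) n"
  using adm_stop[of k] star_in[of k] stop_eq[of k] by (auto simp: adm_def off_def split: if_splits)

text \<open>The entry of \<open>cheb nak\<close> at \<open>(star k, k)\<close> is \<open>-1\<close>; its symmetry puts \<open>-1\<close> at \<open>(k, star k)\<close>, where
  \<open>star (star k)\<close> is the only vertex that can produce it.\<close>

lemma star_star:
  assumes "k \<in> I"
  shows "star (star k) = k"
proof -
  let ?a = "off (star k)" and ?b = "off k"
  have s: "star k \<in> I" "star (star k) \<in> I" using assms star_in by auto
  have k: "adm k (?a + nak)" using adm_nak[OF assms] s by simp
  have sk: "adm (star k) (?b + nak)" "adm (star (star k)) ?b"
    using adm_nak[OF s(1), of ?b] k assms s(1) adm_nak[OF assms, of "?b + nak"]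
    by (auto simp: adm_def off_def split: if_splits)
  have "E (rt (star k) ?a) (rt k (?a + nak)) = -1"
    using rt_nak[OF assms, of ?a] E_same[of "star k" ?a "star k"] s by simp
  then have "cheb nak (star k) k = -1" using E_cheb[of "star k" ?a k nak] k s by simp
  then have "cheb nak k (star k) = -1" using cheb_sym[OF assms s(1)] by simp
  then have "E (rt k ?b) (rt (star k) (?b + nak)) = -1"
    using E_cheb[of k ?b "star k" nak] sk assms by simp
  then have "E (rt k ?b) (rt (star (star k)) ?b) = 1"
    using rt_nak[OF s(1) sk(2)] by simp
  then show ?thesis using E_same[of k ?b "star (star k)"] sk assms by (auto simp: of_bool_def split: if_splits)
qed

section \<open>Periodicity, distinctness and completeness of the vertices\<close>

lemma rt_period: "adm k n \<Longrightarrow> rt k (n + 2 * nak) = rt k n"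
proof -
  assume k: "adm k n"
  then have kI: "k \<in> I" by (rule adm_in)
  have "adm (star k) (n + nak)"
    using adm_nak[OF star_in[OF kI], of n] k by (simp add: star_star[OF kI])
  then have "rt k (n + nak + nak) = (\<lambda>i. - rt (star k) (n + nak) i)" by (rule rt_nak[OF kI])
  also have "rt (star k) (n + nak) = (\<lambda>i. - rt k n i)"
    using rt_nak[OF star_in[OF kI], of n] k by (simp add: star_star[OF kI])
  finally show ?thesis by (simp add: algebra_simps mult_2)
qed

text \<open>The order of \<open>cox\<close> refers to the identity on all functions, including those
  not supported on \<open>I\<close>; coordinates outside \<open>I\<close> are neither read nor
  changed.\<close>

lemma cox_off: "cox (\<lambda>i. if i \<in> I then v i else w i) = (\<lambda>i. if i \<in> I then cox v i else w i)"
proof -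
  have flip: "flip b (\<lambda>i. if i \<in> I then v i else w i) = (\<lambda>i. if i \<in> I then flip b v i else w i)" for b v
    using nb_in by (auto simp: flip_def fun_eq_iff intro: sum.cong)
  show ?thesis unfolding cox_def flip ..
qed

lemma cox_pow_nak: "cox ^^ nak = id"
proof -
  have unit: "(cox ^^ nak) (unit_vec k) = unit_vec k" if "k \<in> I" for k
  proof (cases "col k")
    case True
    then show ?thesis using rt_period[of k "off k"] that by (simp add: rt_add rt_off_col)
  next
    case False
    \<comment> \<open>For the colour \<open>False\<close>, \<open>rt k (off k)\<close> is
      \<open>- cox (unit_vec k)\<close>, so periodicity is first obtained for the image and then
      pulled back by injectivity.\<close>
    have "(cox ^^ nak) (cox (unit_vec k)) = cox (unit_vec k)"
      using rt_period[of k "off k"] that False by (simp add: rt_add cox_pow_uminus)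
        (simp add: rt_def off_def cox_pow_uminus fun_eq_iff)
    then have "cox ((cox ^^ nak) (unit_vec k)) = cox (unit_vec k)" by (simp add: funpow_swap1)
    then show ?thesis using inj_cox by (simp add: inj_def)
  qed
  show ?thesis
  proof
    fix v
    define u where "u = (\<lambda>i. \<Sum>k\<in>I. v k * unit_vec k i)"
    have agree: "(cox ^^ m) v = (\<lambda>i. if i \<in> I then (cox ^^ m) u i else v i)" for m
    proof (induction m)
      case 0
      then show ?case by (auto simp: u_def unit_expand)
    next
      case (Suc m)
      have "(cox ^^ Suc m) v = cox (\<lambda>i. if i \<in> I then (cox ^^ m) u i else v i)"
        unfolding funpow.simps o_apply by (subst Suc) (rule refl)
      then show ?case unfolding cox_off funpow.simps o_apply .
    qed
    have "(cox ^^ nak) u = u"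
      unfolding u_def cox_pow_lin using unit by simp
    then have "(cox ^^ nak) v = (\<lambda>i. if i \<in> I then u i else v i)"
      using agree[of nak] by (simp only:)
    also have "\<dots> = id v" by (auto simp: u_def unit_expand)
    finally show "(cox ^^ nak) v = id v" .
  qed
qed

lemma h_le_nak:
  assumes "I \<noteq> {}"
  shows "h \<le> nak"
proof -
  obtain k where k: "k \<in> I" using assms by blast
  then have "0 < nak" using ht_pos[OF k] stop_eq[OF k] by (auto simp: stop_def off_def split: if_splits)
  then show ?thesis using h_minimal[of nak] cox_pow_nak not_less by blast
qed

text \<open>After shifting a coincidence to the starting slice, row \<open>l\<close> returns to a
  positive root after \<open>c\<close> steps. It must run through its own positive part and then
  through the negatives of the row of \<open>star l\<close>, so \<open>c\<close> is at least
  \<open>ht l + ht (star l)\<close>. Adding the two equations for \<open>stop\<close> shows that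
  this sum is \<open>nak\<close>, whereas \<open>c < h\<close>.\<close>

lemma rt_adm_inj:
  assumes "adm k m" "adm l n" "m < 2 * h" "n < 2 * h" "rt k m = rt l n"
  shows "k = l \<and> m = n"
proof -
  have wlog: "k = l \<and> a = b"
    if k: "k \<in> I" and l: "l \<in> I" and "a \<le> b" and b: "off l + 2 * b < 2 * h"
      and eq: "rt k (off k + 2 * a) = rt l (off l + 2 * b)" for k l a b
  proof -
    note coll = rt_collision[OF k l \<open>a \<le> b\<close> eq]
    have "a = b"
    proof (rule ccontr)
      assume "a \<noteq> b"
      define c where "c = b - a"
      have c: "rt k (off k) = rt l (off l + 2 * c)" "ht l < c"
        using coll \<open>a \<noteq> b\<close> \<open>a \<le> b\<close> by (auto simp: c_def)
      have s: "star l \<in> I" using l by (rule star_in)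
      obtain d where d: "c = ht l + d" using c(2) less_imp_add_positive by blast
      have "off l + 2 * c = off (star l) + 2 * d + nak"
        using stop_eq[OF l] by (simp add: d stop_def)
      then have "rt l (off l + 2 * c) = rt l (off (star l) + 2 * d + nak)" by simp
      also have "\<dots> = (\<lambda>i. - rt (star l) (off (star l) + 2 * d) i)"
        using l s by (intro rt_nak) auto
      finally have "nonpos_vec (rt (star l) (off (star l) + 2 * d))"
        using rt_off_nonneg[OF k] c(1) by simp
      then have "ht (star l) \<le> d" by (rule ht_le)
      moreover have "off l + 2 * ht l = off (star l) + nak" "off (star l) + 2 * ht (star l) = off l + nak"
        using stop_eq[OF l] stop_eq[OF s] star_star[OF l] by (simp_all add: stop_def)
      ultimately have "nak \<le> c" using d by linarith
      moreover have "c < h" using b by (simp add: c_def)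
      ultimately show False using h_le_nak k by fastforce
    qed
    then show ?thesis using coll(1) rt_off_inj[OF k l] by simp
  qed
  obtain a where a: "m = off k + 2 * a" using assms(1) by (rule adm_ex)
  obtain b where b: "n = off l + 2 * b" using assms(2) by (rule adm_ex)
  have I: "k \<in> I" "l \<in> I" using assms adm_in by auto
  show ?thesis
    using wlog[OF I, of a b] wlog[OF I(2,1), of b a] assms(3-5) unfolding a b
    by (cases "a \<le> b") auto
qed

lemma rt_mod:
  assumes "adm k n"
  shows "rt k (n mod (2 * h)) = rt k n" "adm k (n mod (2 * h))"
proof -
  have n: "n = n mod (2 * h) + 2 * (h * (n div (2 * h)))"
    using mod_mult_div_eq[of n "2 * h"] by (simp add: mult.assoc)
  have "cox ^^ (h * q) = id" for q
    by (simp add: funpow_mult[symmetric] cox_pow_h)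
  then have "rt k (n mod (2 * h) + 2 * (h * (n div (2 * h)))) = rt k (n mod (2 * h))"
    by (simp add: rt_add)
  with n show "rt k (n mod (2 * h)) = rt k n" by simp
  show "adm k (n mod (2 * h))"
    using assms n unfolding adm_def by (metis even_add even_mult_iff even_numeral)
qed

lemma root_is_rt:
  assumes "is_root v"
  obtains k n where "adm k n" "n < 2 * h" "rt k n = v"
proof -
  let ?c = "\<lambda>m. (cox ^^ m) v"
  \<comment> \<open>Applied to \<open>- v\<close>, the orbit argument yields a positive member of
    the orbit; from there the first change of sign is located.\<close>
  obtain m0 where "nonpos_vec ((cox ^^ m0) (\<lambda>i. - v i))"
    using orbit_nonpos[of "\<lambda>i. - v i"] assms by auto
  then have m0: "nonneg_vec (?c m0)" by (simp add: cox_pow_uminus)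
  define P where "P = (\<lambda>t. nonpos_vec ((cox ^^ t) (?c m0)))"
  define t where "t = (LEAST t. P t)"
  have ex: "\<exists>t. P t" using orbit_nonpos[of "?c m0"] assms by (simp add: P_def)
  then have Pt: "P t" unfolding t_def by (rule LeastI_ex)
  have "\<not> P 0"
    using m0 root_signs[of "?c m0"] assms by (auto simp: P_def)
  then have "t \<noteq> 0" using Pt by metis
  then obtain s where s: "t = Suc s" using not0_implies_Suc by blast
  define u where "u = (cox ^^ s) (?c m0)"
  have u: "is_root u" using assms by (simp add: u_def)
  have "\<not> P s" unfolding s[symmetric] using not_less_Least[of s P] s t_def by simp
  then have "nonneg_vec u" using root_sign[OF u] by (auto simp: P_def u_def)
  moreover have "nonpos_vec (cox u)" using Pt by (simp add: P_def s u_def)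
  ultimately obtain k where k: "k \<in> I" "cox u = (\<lambda>i. - rt k (off k) i)"
    using sign_change[OF u] by blast
  \<comment> \<open>The row to which \<open>- rt k (off k)\<close> belongs: since
    \<open>star\<close> is an involution, row \<open>star k\<close> reaches this root at its
    stop.\<close>
  define l where "l = star k"
  have l: "l \<in> I" "star l = k" using star_in[OF k(1)] star_star[OF k(1)] by (simp_all add: l_def)
  define r where "r = Suc s + m0"
  have "cox u = ?c r" by (simp add: u_def r_def funpow_add)
  then have "?c r = rt l (stop l)" using k(2) rt_stop[OF l(1)] l(2) by simp
  \<comment> \<open>The \<open>r\<close> steps taken so far are undone by going forward to the
    multiple \<open>h * r\<close> of the order; \<open>0 < h\<close> makes the subtraction
    exact.\<close>
  define q where "q = h * r - r"
  have qr: "q + r = h * r" using h_pos by (simp add: q_def)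
  have "rt l (stop l + 2 * q) = (cox ^^ q) (?c r)"
    using \<open>?c r = rt l (stop l)\<close> by (simp add: rt_add)
  also have "\<dots> = (cox ^^ (h * r)) v" using qr by (metis funpow_add o_apply)
  also have "\<dots> = v" by (simp add: funpow_mult[symmetric] cox_pow_h)
  finally have "rt l (stop l + 2 * q) = v" .
  moreover have "adm l (stop l + 2 * q)" using l(1) by (simp add: stop_def adm_add)
  ultimately show thesis
    using that[of l "(stop l + 2 * q) mod (2 * h)"] rt_mod[of l "stop l + 2 * q"] h_pos by simp
qed

end

section \<open>The order of a Coxeter element\<close>

text \<open>A rooted tree, given by parents and a rank that drops towards the root. Inductions on
  the rank replace arguments with paths.\<close>

definition tree_diagram :: "'i set \<Rightarrow> ('i \<Rightarrow> 'i \<Rightarrow> bool) \<Rightarrow> 'i \<Rightarrow> ('i \<Rightarrow> 'i) \<Rightarrow> ('i \<Rightarrow> nat) \<Rightarrow> bool" where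
  "tree_diagram I adj r par g \<longleftrightarrow> finite I \<and> r \<in> I \<and>
     (\<forall>i\<in>I. i \<noteq> r \<longrightarrow> par i \<in> I \<and> g (par i) < g i) \<and>
     (\<forall>i\<in>I. \<forall>j\<in>I. adj i j \<longleftrightarrow> (i \<noteq> r \<and> j = par i) \<or> (j \<noteq> r \<and> i = par j))"

lemma tree_parent: "tree_diagram I adj r par g \<Longrightarrow> i \<in> I \<Longrightarrow> i \<noteq> r \<Longrightarrow> par i \<in> I \<and> g (par i) < g i \<and> adj i (par i)"
  unfolding tree_diagram_def by blast

lemma tree_finite: "tree_diagram I adj r par g \<Longrightarrow> finite I"
  and tree_root: "tree_diagram I adj r par g \<Longrightarrow> r \<in> I"
  unfolding tree_diagram_def by blast+

lemma tree_adj: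
  "tree_diagram I adj r par g \<Longrightarrow> i \<in> I \<Longrightarrow> j \<in> I \<Longrightarrow>
    adj i j \<longleftrightarrow> (i \<noteq> r \<and> j = par i) \<or> (j \<noteq> r \<and> i = par j)"
  unfolding tree_diagram_def by blast

lemma tree_sym: "tree_diagram I adj r par g \<Longrightarrow> i \<in> I \<Longrightarrow> j \<in> I \<Longrightarrow> adj i j \<Longrightarrow> adj j i"
  unfolding tree_diagram_def by blast

lemma tree_connected:
  assumes "tree_diagram I adj r par g" "S \<subseteq> I" "S \<noteq> {}"
    and closed: "\<And>i j. i \<in> S \<Longrightarrow> j \<in> nbrs I adj i \<Longrightarrow> j \<in> S"
  shows "S = I"
proof -
  have up: "r \<in> S" if "i \<in> S" for i
    using that
  proof (induction "g i" arbitrary: i rule: less_induct)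
    case less
    show ?case
    proof (cases "i = r")
      case False
      have "i \<in> I" using less(2) assms(2) by blast
      with False have "par i \<in> I \<and> g (par i) < g i \<and> adj i (par i)"
        using tree_parent[OF assms(1)] by blast
      then show ?thesis using less(1)[of "par i"] less(2) closed[of i "par i"] by (simp add: nbrs_def)
    qed (use less in simp)
  qed
  have down: "i \<in> S" if "i \<in> I" "r \<in> S" for i
    using that
  proof (induction "g i" arbitrary: i rule: less_induct)
    case less
    show ?case
    proof (cases "i = r")
      case False
      then have *: "par i \<in> I \<and> g (par i) < g i \<and> adj i (par i)"
        using tree_parent[OF assms(1)] less by blast
      then have "i \<in> nbrs I adj (par i)"
        using tree_sym[OF assms(1), of i "par i"] less by (simp add: nbrs_def)
      then show ?thesis using less(1)[of "par i"] less(3) * closed[of "par i" i] by blast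
    qed (use less in simp)
  qed
  show ?thesis using up down assms(2,3) by blast
qed



text \<open>On a tree every antisymmetric function on the edges is a difference of vertex values.
  Thus any ordering of the reflections can be turned into a choice of columns.\<close>

lemma tree_height:
  assumes T: "tree_diagram I adj r par g"
    and anti: "\<And>i j. i \<in> I \<Longrightarrow> j \<in> I \<Longrightarrow> adj i j \<Longrightarrow> s j i = - s i j"
  shows "\<exists>x. x r = c \<and> (\<forall>i\<in>I. \<forall>j\<in>I. adj i j \<longrightarrow> x j = x i + (s i j :: int))"
proof -
  have "\<exists>x. x r = c \<and> (\<forall>i\<in>I. i \<noteq> r \<longrightarrow> g i \<le> K \<longrightarrow> x i = x (par i) + s (par i) i)" for K
  proof (induction K)
    case 0
    have "\<not> g i \<le> 0" if "i \<in> I" "i \<noteq> r" for i using tree_parent[OF T that] by auto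
    then show ?case by (intro exI[of _ "\<lambda>_. c"]) blast
  next
    case (Suc K)
    then obtain x where x: "x r = c"
      "\<And>i. i \<in> I \<Longrightarrow> i \<noteq> r \<Longrightarrow> g i \<le> K \<Longrightarrow> x i = x (par i) + s (par i) i" by blast
    \<comment> \<open>Only the rank \<open>Suc K\<close> is redefined, so the parents, having
      smaller rank, keep their values.\<close>
    define y where "y i = (if i \<noteq> r \<and> g i = Suc K then x (par i) + s (par i) i else x i)" for i
    have "y i = y (par i) + s (par i) i" if "i \<in> I" "i \<noteq> r" "g i \<le> Suc K" for i
    proof -
      have "g (par i) < g i" using tree_parent[OF T that(1,2)] by blast
      then have "y (par i) = x (par i)" using that(3) by (simp add: y_def)
      moreover have "y i = x (par i) + s (par i) i"
        using that x(2)[OF that(1,2)] by (cases "g i = Suc K") (simp_all add: y_def)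
      ultimately show ?thesis by simp
    qed
    moreover have "y r = c" using x(1) by (simp add: y_def)
    ultimately show ?case by blast
  qed
  from this[of "Max (g ` I)"] obtain x where x: "x r = c"
    "\<forall>i\<in>I. i \<noteq> r \<longrightarrow> g i \<le> Max (g ` I) \<longrightarrow> x i = x (par i) + s (par i) i" by blast
  have "g i \<le> Max (g ` I)" if "i \<in> I" for i using tree_finite[OF T] that by simp
  with x(2) have step: "x i = x (par i) + s (par i) i" if "i \<in> I" "i \<noteq> r" for i
    using that by blast
  have "x j = x i + s i j" if ij: "i \<in> I" "j \<in> I" "adj i j" for i j
  proof -
    consider "i \<noteq> r" "j = par i" | "j \<noteq> r" "i = par j"
      using tree_adj[OF T ij(1,2)] ij(3) by blast
    then show ?thesis
    proof cases
      case 1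
      then show ?thesis using step[of i] anti[of i j] ij by simp
    next
      case 2
      then show ?thesis using step[of j] ij by simp
    qed
  qed
  with x(1) show ?thesis by blast
qed

section \<open>Mesh functions and slices\<close>

definition mesh_fun :: "'i set \<Rightarrow> ('i \<Rightarrow> 'i \<Rightarrow> bool) \<Rightarrow> ('i \<Rightarrow> bool) \<Rightarrow> ('i \<Rightarrow> int \<Rightarrow> int) \<Rightarrow> bool" where
  "mesh_fun I adj col x \<longleftrightarrow> (\<forall>i\<in>I. \<forall>n. (even n \<longleftrightarrow> col i) \<longrightarrow>
     x i n + x i (n + 2) = (\<Sum>j\<in>nbrs I adj i. x j (n + 1)))"

text \<open>The map \<open>c\<close> moves the restriction of any mesh function from the slice \<open>\<xi>\<close> to the slice \<open>\<xi> + 2\<close>,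
  a vertex being processed after its lower neighbours.\<close>

definition slice_map :: "'i set \<Rightarrow> ('i \<Rightarrow> 'i \<Rightarrow> bool) \<Rightarrow> ('i \<Rightarrow> bool) \<Rightarrow> ('i \<Rightarrow> int) \<Rightarrow> (('i \<Rightarrow> int) \<Rightarrow> 'i \<Rightarrow> int) \<Rightarrow> bool" where
  "slice_map I adj col \<xi> c \<longleftrightarrow> bij c \<and>
     (\<forall>i\<in>I. even (\<xi> i) \<longleftrightarrow> col i) \<and>
     (\<forall>i\<in>I. \<forall>j\<in>I. adj i j \<longrightarrow> \<xi> j = \<xi> i + 1 \<or> \<xi> j = \<xi> i - 1) \<and>
     (\<forall>v. \<forall>i. i \<notin> I \<longrightarrow> c v i = v i) \<and>
     (\<forall>v. \<forall>i\<in>I. c v i + v i = (\<Sum>j\<in>nbrs I adj i. if \<xi> j < \<xi> i then c v j else v j))"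

text \<open>Outside \<open>I\<close> the values of \<open>v\<close> are kept, as slice maps keep
  them; this allows equations between total functions.\<close>

definition on_slice :: "'i set \<Rightarrow> ('i \<Rightarrow> int) \<Rightarrow> ('i \<Rightarrow> int) \<Rightarrow> ('i \<Rightarrow> int \<Rightarrow> int) \<Rightarrow> int \<Rightarrow> 'i \<Rightarrow> int" where
  "on_slice I \<xi> v x n = (\<lambda>i. if i \<in> I then x i (\<xi> i + n) else v i)"

lemma slice_map_step:
  assumes c: "slice_map I adj col \<xi> c" and x: "mesh_fun I adj col x" and "even n" and fin: "finite I"
  shows "c (on_slice I \<xi> v x n) = on_slice I \<xi> v x (n + 2)"
proof
  fix i
  let ?w = "on_slice I \<xi> v x n"
  have off: "c w j = w j" if "j \<notin> I" for w j
    using c that unfolding slice_map_def by blast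
  have rec: "c w j + w j = (\<Sum>l\<in>nbrs I adj j. if \<xi> l < \<xi> j then c w l else w l)" if "j \<in> I" for w j
    using c that unfolding slice_map_def by blast
  have par: "even (\<xi> j) \<longleftrightarrow> col j" if "j \<in> I" for j
    using c that unfolding slice_map_def by blast
  have edge: "\<xi> l = \<xi> j + 1 \<or> \<xi> l = \<xi> j - 1" if "j \<in> I" "l \<in> nbrs I adj j" for j l
    using c that unfolding slice_map_def nbrs_def by blast
  \<comment> \<open>Measuring the integer heights from their minimum makes the induction over lower
    neighbours well-founded.\<close>
  define b where "b = Min (\<xi> ` I)"
  have b: "b \<le> \<xi> j" if "j \<in> I" for j using that fin by (simp add: b_def)
  have claim: "c ?w i = x i (\<xi> i + n + 2)" if "i \<in> I" for i
    using that
  proof (induction "nat (\<xi> i - b)" arbitrary: i rule: less_induct)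
    case less
    have w: "?w j = x j (\<xi> j + n)" if "j \<in> I" for j using that by (simp add: on_slice_def)
    have "(\<Sum>l\<in>nbrs I adj i. if \<xi> l < \<xi> i then c ?w l else ?w l) = (\<Sum>l\<in>nbrs I adj i. x l (\<xi> i + n + 1))"
    proof (intro sum.cong refl)
      fix l assume l: "l \<in> nbrs I adj i"
      then have lI: "l \<in> I" by (simp add: nbrs_def)
      show "(if \<xi> l < \<xi> i then c ?w l else ?w l) = x l (\<xi> i + n + 1)"
      proof (cases "\<xi> l < \<xi> i")
        case True
        then have "\<xi> l = \<xi> i - 1" using edge[OF less(2) l] by auto
        moreover have "c ?w l = x l (\<xi> l + n + 2)"
          using less(1)[of l] lI True b[OF lI] by simp
        moreover have "\<xi> l + n + 2 = \<xi> i + n + 1" using \<open>\<xi> l = \<xi> i - 1\<close> by simp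
        ultimately show ?thesis using True by metis
      next
        case False
        then have "\<xi> l = \<xi> i + 1" using edge[OF less(2) l] by auto
        then show ?thesis using False w[OF lI] by (simp add: algebra_simps)
      qed
    qed
    moreover have "x i (\<xi> i + n) + x i (\<xi> i + n + 2) = (\<Sum>l\<in>nbrs I adj i. x l (\<xi> i + n + 1))"
      using x less(2) par[OF less(2)] \<open>even n\<close> unfolding mesh_fun_def by auto
    ultimately show ?case using rec[OF less(2), of ?w] w[OF less(2)] by simp
  qed
  show "c ?w i = on_slice I \<xi> v x (n + 2) i"
    using claim[of i] off[of i ?w] by (auto simp: on_slice_def algebra_simps)
qed

lemma slice_map_pow:
  assumes "slice_map I adj col \<xi> c" "mesh_fun I adj col x" "even n" "finite I"
  shows "(c ^^ m) (on_slice I \<xi> v x n) = on_slice I \<xi> v x (n + 2 * int m)"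
proof (induction m)
  case (Suc m)
  then show ?case using slice_map_step[OF assms(1,2) _ assms(4), of "n + 2 * int m" v] assms(3)
    by (simp add: algebra_simps)
qed simp

lemma int_power_exists:
  assumes "bij (c :: 'a \<Rightarrow> 'a)"
  shows "\<exists>P :: int \<Rightarrow> 'a \<Rightarrow> 'a. P 0 = id \<and> (\<forall>n v. P (n + 1) v = c (P n v))"
proof -
  let ?d = "inv_into UNIV c"
  let ?P = "\<lambda>n::int. if 0 \<le> n then c ^^ nat n else ?d ^^ nat (- n)"
  have "?P (n + 1) v = c (?P n v)" for n v
  proof (cases "0 \<le> n")
    case True
    then show ?thesis by (simp add: nat_add_distrib)
  next
    case False
    then have "nat (- n) = Suc (nat (- n - 1))" by simp
    then have "c (?P n v) = (?d ^^ nat (- n - 1)) v"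
      using False assms by (simp add: bij_is_surj surj_f_inv_f)
    moreover have "?P (n + 1) v = (?d ^^ nat (- n - 1)) v"
      using False by (cases "n = -1") auto
    ultimately show ?thesis by simp
  qed
  then show ?thesis by (intro exI[of _ ?P]) auto
qed

text \<open>A vector on the slice determines a mesh function by integer powers of \<open>c\<close>;
  bijectivity is what gives the columns to the left.\<close>

lemma mesh_extension:
  assumes c: "slice_map I adj col \<xi> c"
  obtains x where "mesh_fun I adj col x" "on_slice I \<xi> v x 0 = v"
proof -
  have "bij c" using c unfolding slice_map_def by blast
  from int_power_exists[OF this] obtain P :: "int \<Rightarrow> ('a \<Rightarrow> int) \<Rightarrow> 'a \<Rightarrow> int"
    where P: "P 0 = id" "\<And>n v. P (n + 1) v = c (P n v)" by metis
  \<comment> \<open>The division is exact in the columns whose parity belongs to row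
    \<open>i\<close>; \<open>mesh_fun\<close> does not constrain the other columns.\<close>
  define x where "x i n = P ((n - \<xi> i) div 2) v i" for i n
  have "mesh_fun I adj col x"
    unfolding mesh_fun_def
  proof (intro ballI allI impI)
    fix i and n :: int assume i: "i \<in> I" and "even n \<longleftrightarrow> col i"
    then have "even (n - \<xi> i)" using c unfolding slice_map_def by auto
    then obtain t where "n - \<xi> i = 2 * t" by (rule evenE)
    then have t: "n = \<xi> i + 2 * t" by simp
    let ?w = "P t v"
    have "x i n = ?w i" by (simp add: x_def t)
    moreover have "x i (n + 2) = c ?w i"
      using P(2)[of t v] by (simp add: x_def t)
    moreover have "(\<Sum>j\<in>nbrs I adj i. if \<xi> j < \<xi> i then c ?w j else ?w j) = (\<Sum>j\<in>nbrs I adj i. x j (n + 1))"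
    proof (intro sum.cong refl)
      fix j assume "j \<in> nbrs I adj i"
      then consider "\<xi> j = \<xi> i + 1" | "\<xi> j = \<xi> i - 1"
        using c i unfolding slice_map_def nbrs_def by blast
      then show "(if \<xi> j < \<xi> i then c ?w j else ?w j) = x j (n + 1)"
      proof cases
        case 2
        then have "(n + 1 - \<xi> j) div 2 = t + 1" by (simp add: t)
        then show ?thesis using 2 P(2)[of t v] by (simp add: x_def)
      qed (simp add: x_def t)
    qed
    moreover have "c ?w i + ?w i = (\<Sum>j\<in>nbrs I adj i. if \<xi> j < \<xi> i then c ?w j else ?w j)"
      using c i unfolding slice_map_def by blast
    ultimately show "x i n + x i (n + 2) = (\<Sum>j\<in>nbrs I adj i. x j (n + 1))" by simp
  qed
  moreover have "on_slice I \<xi> v x 0 = v"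
    by (auto simp: on_slice_def x_def P(1))
  ultimately show thesis by (rule that)
qed

text \<open>Both conditions say that every mesh function is \<open>2m\<close>-periodic.\<close>

lemma slice_map_pow_id:
  assumes "finite I" "slice_map I adj col \<xi> c" "slice_map I adj col \<xi>' c'" "c ^^ m = id"
  shows "c' ^^ m = id"
proof
  fix v
  obtain x where x: "mesh_fun I adj col x" "on_slice I \<xi>' v x 0 = v"
    using mesh_extension[OF assms(3)] by blast
  have "x i (\<xi>' i + 2 * int m) = x i (\<xi>' i)" if i: "i \<in> I" for i
  proof -
    \<comment> \<open>This shift puts the slice of \<open>c\<close> on the column
      \<open>\<xi>' i\<close> of row \<open>i\<close>. It is even since both slices respect the
      colouring.\<close>
    define n where "n = \<xi>' i - \<xi> i"
    have "even n" using assms(2,3) i unfolding n_def slice_map_def by auto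
    then have "on_slice I \<xi> v x (n + 2 * int m) = on_slice I \<xi> v x n"
      using slice_map_pow[OF assms(2) x(1) _ assms(1), of n m v] assms(4) by simp
    from fun_cong[OF this, of i] show ?thesis using i by (simp add: on_slice_def n_def algebra_simps)
  qed
  then have "on_slice I \<xi>' v x (0 + 2 * int m) = on_slice I \<xi>' v x 0"
    by (auto simp: on_slice_def)
  then show "(c' ^^ m) v = id v"
    using slice_map_pow[OF assms(3) x(1) _ assms(1), of 0 m v] x(2) by simp
qed

section \<open>Products of simple reflections as slice maps\<close>

fun follows :: "'a list \<Rightarrow> 'a \<Rightarrow> 'a \<Rightarrow> bool" where
  "follows [] i j \<longleftrightarrow> False"
| "follows (a # l) i j \<longleftrightarrow> (if i = a then j \<in> set l else follows l i j)"

lemma follows_in: "follows l i j \<Longrightarrow> j \<in> set l"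
  by (induction l) (auto split: if_splits)

lemma follows_total:
  "distinct l \<Longrightarrow> i \<in> set l \<Longrightarrow> j \<in> set l \<Longrightarrow> i \<noteq> j \<Longrightarrow> follows l i j \<longleftrightarrow> \<not> follows l j i"
  by (induction l) (auto dest: follows_in)

lemma simple_refl_involution: "i \<notin> nbrs I adj i \<Longrightarrow> simple_refl I adj i (simple_refl I adj i v) = v"
proof -
  assume i: "i \<notin> nbrs I adj i"
  then have "(\<Sum>j\<in>nbrs I adj i. (v(i := a)) j) = (\<Sum>j\<in>nbrs I adj i. v j)" for a
    by (intro sum.cong) auto
  then show ?thesis by (simp add: simple_refl_def)
qed

text \<open>The last reflection in the list acts first, and each coordinate changes once. When
  \<open>i\<close> is reflected, the neighbours that follow it in \<open>l\<close> have their final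
  values and the others still their initial ones.\<close>

lemma refl_product_props:
  assumes "\<And>i. i \<notin> nbrs I adj i" "distinct l"
    and c: "c = foldr (\<lambda>i g. simple_refl I adj i \<circ> g) l id"
  shows "bij c \<and> (\<forall>v. \<forall>i. i \<notin> set l \<longrightarrow> c v i = v i) \<and>
    (\<forall>v. \<forall>i\<in>set l. c v i + v i = (\<Sum>j\<in>nbrs I adj i. if follows l i j then c v j else v j))"
  using assms(2) c
proof (induction l arbitrary: c)
  case Nil
  then show ?case by (auto simp: bij_def surj_def)
next
  case (Cons a l)
  define c' where "c' = foldr (\<lambda>i g. simple_refl I adj i \<circ> g) l id"
  have c: "c v = simple_refl I adj a (c' v)" for v
    unfolding Cons.prems(2) c'_def by (simp only: foldr.simps o_apply)
  have IH: "bij c'" "\<And>v i. i \<notin> set l \<Longrightarrow> c' v i = v i"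
    "\<And>v i. i \<in> set l \<Longrightarrow> c' v i + v i = (\<Sum>j\<in>nbrs I adj i. if follows l i j then c' v j else v j)"
    using Cons.IH[OF _ c'_def] Cons.prems(1) by auto
  have a: "a \<notin> set l" using Cons.prems(1) by simp
  have ne: "c v j = c' v j" if "j \<noteq> a" for v j using that by (simp add: c simple_refl_def)
  have at: "c v a + v a = (\<Sum>j\<in>nbrs I adj a. c' v j)" for v
    using IH(2)[OF a, of v] by (simp add: c simple_refl_def)
  have "bij (simple_refl I adj a)"
    using simple_refl_involution[OF assms(1)] by (intro o_bij[of "simple_refl I adj a"]) auto
  moreover have "c = simple_refl I adj a \<circ> c'" by (simp add: c fun_eq_iff)
  ultimately have "bij c"
    using IH(1) by (simp only: bij_comp)
  moreover have "c v i = v i" if "i \<notin> set (a # l)" for v i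
    using that ne[of i v] IH(2)[of i v] by simp
  moreover have "c v i + v i = (\<Sum>j\<in>nbrs I adj i. if follows (a # l) i j then c v j else v j)"
    if "i \<in> set (a # l)" for v i
  proof (cases "i = a")
    case True
    have "(\<Sum>j\<in>nbrs I adj a. c' v j) = (\<Sum>j\<in>nbrs I adj a. if j \<in> set l then c v j else v j)"
    proof (intro sum.cong refl)
      fix j
      show "c' v j = (if j \<in> set l then c v j else v j)"
        using a IH(2)[of j v] ne[of j v] by (cases "j = a"; cases "j \<in> set l") auto
    qed
    then show ?thesis using True at by simp
  next
    case False
    have "(\<Sum>j\<in>nbrs I adj i. if follows l i j then c' v j else v j) =
        (\<Sum>j\<in>nbrs I adj i. if follows l i j then c v j else v j)"
    proof (intro sum.cong refl)
      fix j
      show "(if follows l i j then c' v j else v j) = (if follows l i j then c v j else v j)"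
        using a follows_in[of l i j] ne[of j v] by (cases "j = a") auto
    qed
    then show ?thesis using False that IH(3)[of i v] ne[of i v] by simp
  qed
  ultimately show ?case by blast
qed

text \<open>A neighbour that is reflected earlier is placed one column lower. The tree makes these
  steps consistent, and the value at the root is chosen so that parities match the colouring
  everywhere.\<close>

lemma coxeter_slice_map:
  assumes T: "tree_diagram I adj r par g"
    and col: "\<And>i j. i \<in> I \<Longrightarrow> j \<in> I \<Longrightarrow> adj i j \<Longrightarrow> col j = (\<not> col i)"
    and "coxeter_element I adj c"
  obtains \<xi> where "slice_map I adj col \<xi> c"
proof -
  obtain l where l: "distinct l" "set l = I" "c = foldr (\<lambda>i g. simple_refl I adj i \<circ> g) l id"
    using assms(3) unfolding coxeter_element_def by blast
  have irrefl: "i \<notin> nbrs I adj i" for i using col[of i i] by (auto simp: nbrs_def)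
  note props = refl_product_props[OF irrefl l(1,3)]
  define s :: "'a \<Rightarrow> 'a \<Rightarrow> int" where "s i j = (if follows l i j then -1 else 1)" for i j
  have fol: "follows l i j \<longleftrightarrow> \<not> follows l j i" if "i \<in> I" "j \<in> I" "adj i j" for i j
    using follows_total[OF l(1)] l(2) that col[of i j] by auto
  have "\<exists>x. x r = (if col r then 0 else 1) \<and> (\<forall>i\<in>I. \<forall>j\<in>I. adj i j \<longrightarrow> x j = x i + s i j)"
    using fol by (intro tree_height[OF T]) (auto simp: s_def)
  then obtain \<xi> where \<xi>: "\<xi> r = (if col r then 0 else 1)"
    "\<And>i j. i \<in> I \<Longrightarrow> j \<in> I \<Longrightarrow> adj i j \<Longrightarrow> \<xi> j = \<xi> i + s i j"
    by blast
  have "{i \<in> I. even (\<xi> i) \<longleftrightarrow> col i} = I"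
  proof (rule tree_connected[OF T])
    show "{i \<in> I. even (\<xi> i) \<longleftrightarrow> col i} \<noteq> {}"
      using tree_root[OF T] \<xi>(1) by (cases "col r") auto
  next
    fix i j assume "i \<in> {i \<in> I. even (\<xi> i) \<longleftrightarrow> col i}" "j \<in> nbrs I adj i"
    then show "j \<in> {i \<in> I. even (\<xi> i) \<longleftrightarrow> col i}"
      using \<xi>(2)[of i j] col[of i j] by (auto simp: nbrs_def s_def)
  qed auto
  then have par: "even (\<xi> i) \<longleftrightarrow> col i" if "i \<in> I" for i using that by blast
  have "follows l i j \<longleftrightarrow> \<xi> j < \<xi> i" if "i \<in> I" "j \<in> nbrs I adj i" for i j
    using \<xi>(2)[of i j] that by (auto simp: nbrs_def s_def)
  then have "(\<Sum>j\<in>nbrs I adj i. if follows l i j then c v j else v j) =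
      (\<Sum>j\<in>nbrs I adj i. if \<xi> j < \<xi> i then c v j else v j)" if "i \<in> I" for i v
    using that by (intro sum.cong) auto
  then have "slice_map I adj col \<xi> c"
    using props par \<xi>(2) l(2) unfolding slice_map_def by (auto simp: s_def)
  then show thesis by (rule that)
qed

text \<open>The colour \<open>False\<close> is flipped first, hence lies in the lower column
  -1.\<close>

lemma (in bipartite_diagram) cox_slice_map:
  "slice_map I adj col (\<lambda>i. if col i then 0 else -1) cox"
  unfolding slice_map_def
proof (intro conjI allI ballI impI)
  show "bij cox"
    by (rule o_bij[of "\<lambda>v. flip False (flip True v)"]) (auto simp: cox_def)
  show "cox v i = v i" if "i \<notin> I" for v i using that by (simp add: cox_def flip_off)
next
  fix v i assume i: "i \<in> I"
  let ?\<xi> = "\<lambda>i. if col i then 0 else - 1 :: int"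
  show "cox v i + v i = (\<Sum>j\<in>nb i. if ?\<xi> j < ?\<xi> i then cox v j else v j)"
  proof (cases "col i")
    case True
    have "(\<Sum>j\<in>nb i. if ?\<xi> j < ?\<xi> i then cox v j else v j) = (\<Sum>j\<in>nb i. flip False v j)"
      using nb_col[OF i] True by (intro sum.cong) (auto simp: cox_def flip_off)
    then show ?thesis using True i by (simp add: cox_def flip_at flip_off)
  next
    case False
    have "(\<Sum>j\<in>nb i. if ?\<xi> j < ?\<xi> i then cox v j else v j) = (\<Sum>j\<in>nb i. v j)"
      using nb_col[OF i] False by (intro sum.cong) auto
    then show ?thesis using False i by (simp add: cox_def flip_at flip_off)
  qed
qed (use col_adj in \<open>auto split: if_splits\<close>)

section \<open>Positive definiteness\<close>

text \<open>The criterion of Vinberg for finite type: a positive vector on which the Cartan matrix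
  is nonnegative and not zero.\<close>

definition subadditive_on :: "'i set \<Rightarrow> ('i \<Rightarrow> 'i \<Rightarrow> bool) \<Rightarrow> ('i \<Rightarrow> nat) \<Rightarrow> bool" where
  "subadditive_on I adj d \<longleftrightarrow> (\<forall>i\<in>I. 0 < d i \<and> (\<Sum>j\<in>nbrs I adj i. d j) \<le> 2 * d i) \<and>
     (\<exists>i\<in>I. (\<Sum>j\<in>nbrs I adj i. d j) < 2 * d i)"

text \<open>Twice the quadratic form is
  \<open>\<Sum>\<^sub>i\<^sub>j d\<^sub>i d\<^sub>j (v\<^sub>i / d\<^sub>i - v\<^sub>j / d\<^sub>j)\<^sup>2 / 2 + \<Sum>\<^sub>i (2 d\<^sub>i - \<Sum>\<^sub>j d\<^sub>j) v\<^sub>i\<^sup>2 / d\<^sub>i\<close>, with \<open>j\<close> adjacent to \<open>i\<close>.\<close>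

lemma (in bipartite_diagram) E_posdef:
  assumes d: "subadditive_on I adj d"
    and connected: "\<And>S. S \<subseteq> I \<Longrightarrow> S \<noteq> {} \<Longrightarrow> (\<And>i j. i \<in> S \<Longrightarrow> j \<in> nb i \<Longrightarrow> j \<in> S) \<Longrightarrow> S = I"
    and v: "supported v" "v \<noteq> (\<lambda>i. 0)"
  shows "0 < E v v"
proof -
  define D where "D i = real (d i)" for i
  define y where "y i = real_of_int (v i) / D i" for i
  have D: "0 < D i" if "i \<in> I" for i using d that by (simp add: subadditive_on_def D_def)
  have yD: "real_of_int (v i) = y i * D i" if "i \<in> I" for i using D[OF that] by (simp add: y_def)
  define A where "A = (\<Sum>i\<in>I. \<Sum>j\<in>nb i. D i * D j * (y i - y j)\<^sup>2)"
  define B where "B = (\<Sum>i\<in>I. (2 * D i - (\<Sum>j\<in>nb i. D j)) * D i * (y i)\<^sup>2)"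
  have gap: "0 \<le> 2 * D i - (\<Sum>j\<in>nb i. D j)" if "i \<in> I" for i
  proof -
    have "real (\<Sum>j\<in>nb i. d j) \<le> real (2 * d i)"
      using d that unfolding subadditive_on_def by (intro of_nat_mono) blast
    then show ?thesis by (simp add: D_def)
  qed
  have Apos: "0 \<le> D i * D j * (y i - y j)\<^sup>2" if "i \<in> I" "j \<in> nb i" for i j
    using D[OF that(1)] D[OF nb_in[OF that(2)]] by simp
  have Bpos: "0 \<le> (2 * D i - (\<Sum>j\<in>nb i. D j)) * D i * (y i)\<^sup>2" if "i \<in> I" for i
    using gap[OF that] D[OF that] by simp
  have AB: "0 \<le> A" "0 \<le> B"
    unfolding A_def B_def using Apos Bpos by (auto intro!: sum_nonneg)
  have "real_of_int (2 * E v v) = A / 2 + B"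
  proof -
    have sq: "(\<Sum>i\<in>I. \<Sum>j\<in>nb i. D i * D j * (y j)\<^sup>2) = (\<Sum>i\<in>I. \<Sum>j\<in>nb i. D i * D j * (y i)\<^sup>2)"
      by (subst sum_nb_swap_all) (simp add: mult.commute)
    have "A = (\<Sum>i\<in>I. \<Sum>j\<in>nb i. D i * D j * (y i)\<^sup>2 + D i * D j * (y j)\<^sup>2 - 2 * (y i * D i * (y j * D j)))"
      unfolding A_def by (intro sum.cong refl) (simp add: power2_eq_square algebra_simps)
    also have "\<dots> = 2 * (\<Sum>i\<in>I. \<Sum>j\<in>nb i. D i * D j * (y i)\<^sup>2) - 2 * (\<Sum>i\<in>I. \<Sum>j\<in>nb i. (y i * D i * (y j * D j)))"
      by (simp only: sum.distrib sum_subtractf sq sum_distrib_left)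
        (simp add: sum_distrib_left[symmetric])
    also have "(\<Sum>i\<in>I. \<Sum>j\<in>nb i. (y i * D i * (y j * D j))) = real_of_int (\<Sum>i\<in>I. \<Sum>j\<in>nb i. v i * v j)"
      by (simp add: yD nb_in cong: sum.cong)
    finally have A: "A / 2 = (\<Sum>i\<in>I. \<Sum>j\<in>nb i. D i * D j * (y i)\<^sup>2) - real_of_int (\<Sum>i\<in>I. \<Sum>j\<in>nb i. v i * v j)"
      by simp
    have "B = (\<Sum>i\<in>I. 2 * (y i * D i)\<^sup>2 - (\<Sum>j\<in>nb i. D i * D j * (y i)\<^sup>2))"
      unfolding B_def
      by (intro sum.cong refl) (simp add: sum_distrib_left sum_distrib_right power2_eq_square algebra_simps)
    also have "\<dots> = 2 * real_of_int (\<Sum>i\<in>I. v i * v i) - (\<Sum>i\<in>I. \<Sum>j\<in>nb i. D i * D j * (y i)\<^sup>2)"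
      by (simp add: sum_subtractf sum_distrib_left yD power2_eq_square cong: sum.cong)
    finally have "A / 2 + B = 2 * real_of_int (\<Sum>i\<in>I. v i * v i) - real_of_int (\<Sum>i\<in>I. \<Sum>j\<in>nb i. v i * v j)"
      using A by linarith
    moreover have "2 * E v v = 2 * (\<Sum>i\<in>I. v i * v i) - (\<Sum>i\<in>I. \<Sum>j\<in>nb i. v i * v j)"
    proof -
      have "2 * E v v = eform True v v + eform False v v"
        using eform_not_diag[of False v] by simp
      then show ?thesis
        unfolding eform_def sum_col_split[of "\<lambda>i. \<Sum>j\<in>nb i. v i * v j" True] by simp
    qed
    ultimately show ?thesis by (simp only: of_int_diff of_int_mult of_int_numeral)
  qed
  \<comment> \<open>If both sums vanish, the ratios \<open>y\<close> agree along edges and are 0 at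
    a vertex where subadditivity is strict; connectedness then gives \<open>v = 0\<close>.\<close>
  moreover have "A + B \<noteq> 0"
  proof
    assume "A + B = 0"
    then have "A = 0" "B = 0" using AB by linarith+
    have "\<forall>i\<in>I. (\<Sum>j\<in>nb i. D i * D j * (y i - y j)\<^sup>2) = 0"
      using \<open>A = 0\<close> Apos unfolding A_def
      by (subst (asm) sum_nonneg_eq_0_iff[OF finite_I]) (auto intro!: sum_nonneg)
    then have "\<forall>j\<in>nb i. D i * D j * (y i - y j)\<^sup>2 = 0" if "i \<in> I" for i
      using Apos[OF that] that sum_nonneg_eq_0_iff[OF finite_nb, of i "\<lambda>j. D i * D j * (y i - y j)\<^sup>2"] by simp
    then have edge: "y j = y i" if "i \<in> I" "j \<in> nb i" for i j
    proof -
      have "D i * D j * (y i - y j)\<^sup>2 = 0"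
        using \<open>\<And>i. i \<in> I \<Longrightarrow> \<forall>j\<in>nb i. D i * D j * (y i - y j)\<^sup>2 = 0\<close> that by blast
      then show ?thesis using D[OF that(1)] D[OF nb_in[OF that(2)]] by simp
    qed
    obtain r where r: "r \<in> I" "(\<Sum>j\<in>nb r. d j) < 2 * d r"
      using d unfolding subadditive_on_def by blast
    have "real (\<Sum>j\<in>nb r. d j) < real (2 * d r)" using r(2) by (rule of_nat_less_iff[THEN iffD2])
    then have "0 < 2 * D r - (\<Sum>j\<in>nb r. D j)" by (simp add: D_def)
    moreover have "(2 * D r - (\<Sum>j\<in>nb r. D j)) * D r * (y r)\<^sup>2 = 0"
      using \<open>B = 0\<close> Bpos r(1) finite_I unfolding B_def by (subst (asm) sum_nonneg_eq_0_iff) auto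
    ultimately have "y r = 0" using D[OF r(1)] by simp
    have "{i \<in> I. y i = 0} = I"
    proof (rule connected)
      show "{i \<in> I. y i = 0} \<noteq> {}" using r(1) \<open>y r = 0\<close> by blast
      show "j \<in> {i \<in> I. y i = 0}" if "i \<in> {i \<in> I. y i = 0}" "j \<in> nb i" for i j
        using edge[of i j] nb_in[of j i] that by simp
    qed blast
    then have "y i = 0" if "i \<in> I" for i using that by blast
    then have "v i = 0" if "i \<in> I" for i using yD[OF that] that by simp
    then show False using v by (auto simp: supported_def fun_eq_iff)
  qed
  ultimately have "0 < real_of_int (2 * E v v)" using AB by linarith
  then show ?thesis by simp
qed

section \<open>Trees and subadditive functions for the ADE diagrams\<close>

definition good_diagram :: "'i set \<Rightarrow> ('i \<Rightarrow> 'i \<Rightarrow> bool) \<Rightarrow> bool" where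
  "good_diagram I adj \<longleftrightarrow> (\<exists>r par g. tree_diagram I adj r par g) \<and> (\<exists>d. subadditive_on I adj d)"

lemma good_diagram_iso:
  assumes bij: "bij_betw f I J" and adj: "\<And>i j. i \<in> I \<Longrightarrow> j \<in> I \<Longrightarrow> adj i j \<longleftrightarrow> adj' (f i) (f j)"
    and good: "good_diagram J adj'"
  shows "good_diagram I adj"
proof -
  obtain r par g d where T: "tree_diagram J adj' r par g" and d: "subadditive_on J adj' d"
    using good unfolding good_diagram_def by blast
  define f' where "f' = inv_into I f"
  have f: "f i \<in> J" "f' (f i) = i" if "i \<in> I" for i
    using that bij by (auto simp: f'_def bij_betw_def)
  have f': "f' j \<in> I" "f (f' j) = j" if "j \<in> J" for j
    using that bij by (auto simp: f'_def bij_betw_def inv_into_into f_inv_into_f)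
  have "tree_diagram I adj (f' r) (\<lambda>i. f' (par (f i))) (g \<circ> f)"
    unfolding tree_diagram_def
  proof (intro conjI ballI impI)
    show "finite I" using bij tree_finite[OF T] bij_betw_finite by blast
    show "f' r \<in> I" using f'(1) tree_root[OF T] by blast
  next
    fix i assume i: "i \<in> I" "i \<noteq> f' r"
    then have "f i \<noteq> r" using f(2)[of i] by auto
    then have "par (f i) \<in> J \<and> g (par (f i)) < g (f i)"
      using tree_parent[OF T, of "f i"] f[of i] i by auto
    then show "f' (par (f i)) \<in> I" "(g \<circ> f) (f' (par (f i))) < (g \<circ> f) i"
      using f' by auto
  next
    fix i j assume i: "i \<in> I" and j: "j \<in> I"
    have *: "k \<noteq> f' r \<and> l = f' (par (f k)) \<longleftrightarrow> f k \<noteq> r \<and> f l = par (f k)" if "k \<in> I" "l \<in> I" for k l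
    proof -
      have 1: "k = f' r \<longleftrightarrow> f k = r" using that f f' tree_root[OF T] by metis
      show ?thesis
      proof (cases "f k = r")
        case False
        then have "par (f k) \<in> J" using tree_parent[OF T, of "f k"] f(1)[OF that(1)] by blast
        then show ?thesis using 1 that f f' by metis
      qed (use 1 in simp)
    qed
    show "adj i j \<longleftrightarrow> i \<noteq> f' r \<and> j = f' (par (f i)) \<or> j \<noteq> f' r \<and> i = f' (par (f j))"
      unfolding *[OF i j] *[OF j i] using adj[OF i j] tree_adj[OF T f(1)[OF i] f(1)[OF j]] by blast
  qed
  moreover have "subadditive_on I adj (d \<circ> f)"
  proof -
    have sums: "(\<Sum>j\<in>nbrs I adj i. (d \<circ> f) j) = (\<Sum>j\<in>nbrs J adj' (f i). d j)" if "i \<in> I" for i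
    proof (rule sum.reindex_bij_betw[symmetric, of f, unfolded o_def[symmetric], THEN sym])
      show "bij_betw f (nbrs I adj i) (nbrs J adj' (f i))"
      proof (rule bij_betw_byWitness[where f' = f'])
        show "\<forall>a\<in>nbrs I adj i. f' (f a) = a" using f by (simp add: nbrs_def)
        show "\<forall>a\<in>nbrs J adj' (f i). f (f' a) = a" using f' by (simp add: nbrs_def)
        show "f ` nbrs I adj i \<subseteq> nbrs J adj' (f i)" using f adj that by (auto simp: nbrs_def)
        show "f' ` nbrs J adj' (f i) \<subseteq> nbrs I adj i" using f f' adj that by (auto simp: nbrs_def)
      qed
    qed
    obtain j where "j \<in> J" "(\<Sum>l\<in>nbrs J adj' j. d l) < 2 * d j"
      using d unfolding subadditive_on_def by blast
    then have "\<exists>i\<in>I. (\<Sum>j\<in>nbrs J adj' (f i). d j) < 2 * d (f i)" using f'[of j] by (intro bexI[of _ "f' j"]) auto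
    then show ?thesis
      using d f(1) unfolding subadditive_on_def by (auto simp: sums simp del: o_apply) (auto simp: o_def)
  qed
  ultimately show ?thesis unfolding good_diagram_def by blast
qed

lemma A_good:
  assumes "1 \<le> n"
  shows "good_diagram {1..n} (\<lambda>i j. {i, j} \<in> A_edges n)"
proof -
  let ?adj = "\<lambda>i j. {i, j} \<in> A_edges n"
  have adj: "?adj i j \<longleftrightarrow> 1 \<le> i \<and> 1 \<le> j \<and> i \<le> n \<and> j \<le> n \<and> (j = i + 1 \<or> i = j + 1)" for i j
    by (auto simp: A_edges_def doubleton_eq_iff)
  have "tree_diagram {1..n} ?adj 1 (\<lambda>k. k - 1) id"
    unfolding tree_diagram_def adj using assms by auto
  \<comment> \<open>The marks of the affine diagram of type A are all 1; strictness is checked at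
    the end \<open>n\<close>.\<close>
  moreover have "subadditive_on {1..n} ?adj (\<lambda>_. 1)"
  proof -
    have "card (nbrs {1..n} ?adj i) \<le> 2" for i
    proof -
      have "nbrs {1..n} ?adj i \<subseteq> {i + 1, i - 1}" unfolding nbrs_def adj by auto
      then have "card (nbrs {1..n} ?adj i) \<le> card {i + 1, i - 1}" by (intro card_mono) auto
      also have "\<dots> \<le> 2" by (simp add: card_insert_if)
      finally show ?thesis .
    qed
    moreover have "card (nbrs {1..n} ?adj n) < 2"
    proof -
      have "nbrs {1..n} ?adj n \<subseteq> {n - 1}" unfolding nbrs_def adj by auto
      then have "card (nbrs {1..n} ?adj n) \<le> card {n - 1}" by (intro card_mono) auto
      then show ?thesis by simp
    qed
    ultimately show ?thesis using assms unfolding subadditive_on_def by auto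
  qed
  ultimately show ?thesis unfolding good_diagram_def by blast
qed

lemma D_good:
  assumes "4 \<le> n"
  shows "good_diagram {1..n} (\<lambda>i j. {i, j} \<in> D_edges n)"
proof -
  let ?adj = "\<lambda>i j. {i, j} \<in> D_edges n"
  \<comment> \<open>These are the marks of the affine D diagram with \<open>n + 2\<close> vertices.
    The two leaves missing at the vertex 1 make the inequality strict there.\<close>
  let ?d = "\<lambda>k. if k + 1 < n then 2 else 1 :: nat"
  have adj: "?adj i j \<longleftrightarrow> 1 \<le> i \<and> 1 \<le> j \<and> i \<le> n \<and> j \<le> n \<and>
      (i < n \<and> j < n \<and> (j = i + 1 \<or> i = j + 1) \<or> (i = n \<and> j + 2 = n) \<or> (j = n \<and> i + 2 = n))" for i j
    using assms by (auto simp: D_edges_def doubleton_eq_iff)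
  have "tree_diagram {1..n} ?adj 1 (\<lambda>k. if k = n then n - 2 else k - 1) id"
    unfolding tree_diagram_def adj using assms by auto
  moreover have "subadditive_on {1..n} ?adj ?d"
  proof -
    have "(\<Sum>j\<in>nbrs {1..n} ?adj i. ?d j) \<le> 2 * ?d i" if i: "i \<in> {1..n}" for i
    proof -
      consider "i + 2 < n" | "i + 2 = n" | "i + 1 = n" | "i = n" using i by force
      then show ?thesis
      proof cases
        case 1
        then have "nbrs {1..n} ?adj i \<subseteq> {i + 1, i - 1}" unfolding nbrs_def adj by auto
        then have "(\<Sum>j\<in>nbrs {1..n} ?adj i. ?d j) \<le> (\<Sum>j\<in>{i + 1, i - 1}. ?d j)" by (intro sum_mono2) auto
        also have "\<dots> \<le> 4" using 1 by (simp)
        finally show ?thesis using 1 by simp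
      next
        case 2
        then have "nbrs {1..n} ?adj i = {i + 1, i - 1, n}" unfolding nbrs_def adj using assms by auto
        then show ?thesis using 2 assms by simp
      next
        case 3
        then have "nbrs {1..n} ?adj i = {i - 1}" unfolding nbrs_def adj using assms by auto
        then show ?thesis using 3 assms by simp
      next
        case 4
        then have "nbrs {1..n} ?adj i = {n - 2}" unfolding nbrs_def adj using assms by auto
        then show ?thesis using 4 assms by simp
      qed
    qed
    moreover have "(\<Sum>j\<in>nbrs {1..n} ?adj 1. ?d j) < 2 * ?d 1"
    proof -
      have "nbrs {1..n} ?adj 1 = {2}" unfolding nbrs_def adj using assms by auto
      then show ?thesis using assms by simp
    qed
    ultimately show ?thesis using assms unfolding subadditive_on_def
      by (intro conjI ballI bexI[of _ 1]) auto
  qed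
  ultimately show ?thesis unfolding good_diagram_def by blast
qed

text \<open>The subadditive function consists of the marks of the affine diagram \<open>E\<^sub>8\<close>.\<close>

lemma E_good:
  assumes "n \<in> {6, 7, 8}"
  shows "good_diagram {1..n} (\<lambda>i j. {i, j} \<in> E_edges n)"
proof -
  let ?adj = "\<lambda>i j. {i, j} \<in> E_edges n"
  let ?d = "\<lambda>k::nat. if k = 1 then 2 else if k = 2 then 3 else if k = 3 then 4 else 10 - k"
  let ?par = "\<lambda>k::nat. if k = 3 then 1 else if k = 2 then 4 else k - 1"
  \<comment> \<open>Vertex 2 hangs off vertex 4, so its rank has to exceed the rank 8 of that
    vertex.\<close>
  let ?g = "\<lambda>k::nat. if k = 2 then 9 else 2 * k"
  have adj: "?adj i j \<longleftrightarrow> i = 1 \<and> j = 3 \<or> i = 3 \<and> j = 1 \<or> i = 2 \<and> j = 4 \<or> i = 4 \<and> j = 2 \<or>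
      3 \<le> i \<and> i < n \<and> j = i + 1 \<or> 3 \<le> j \<and> j < n \<and> i = j + 1" for i j
    by (auto simp: E_edges_def doubleton_eq_iff)
  have n: "6 \<le> n" using assms by auto
  have "tree_diagram {1..n} ?adj 1 ?par ?g"
    unfolding tree_diagram_def adj
  proof (intro conjI ballI impI)
    fix i assume "i \<in> {1..n}" "i \<noteq> 1"
    then show "?par i \<in> {1..n}" "?g (?par i) < ?g i" using n by (auto split: if_splits)
  next
    fix i j assume "i \<in> {1..n}" "j \<in> {1..n}"
    then have ij: "1 \<le> i" "i \<le> n" "1 \<le> j" "j \<le> n" by auto
    have half: "(j = k + 1 \<and> 3 \<le> k \<and> k < n \<or> k = 1 \<and> j = 3 \<or> k = 4 \<and> j = 2) \<longleftrightarrow> j \<noteq> 1 \<and> k = ?par j"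
      if "1 \<le> j" "j \<le> n" for j k
      using that n by (cases "j = 2"; cases "j = 3"; cases j) auto
    show "(i = 1 \<and> j = 3 \<or> i = 3 \<and> j = 1 \<or> i = 2 \<and> j = 4 \<or> i = 4 \<and> j = 2 \<or>
        3 \<le> i \<and> i < n \<and> j = i + 1 \<or> 3 \<le> j \<and> j < n \<and> i = j + 1) =
        (i \<noteq> 1 \<and> j = ?par i \<or> j \<noteq> 1 \<and> i = ?par j)"
      unfolding half[OF ij(1,2), symmetric] half[OF ij(3,4), symmetric] by blast
  qed (use n in auto)
  moreover have "subadditive_on {1..n} ?adj ?d"
  proof -
    define N where "N = nbrs {1..n} ?adj"
    have nb: "N 1 = {3}" "N 2 = {4}" "N 3 = {1, 4}" "N 4 = {2, 3, 5}" "N n = {n - 1}"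
      unfolding N_def nbrs_def adj using n by auto
    have nb': "N i = {i - 1, i + 1}" if "5 \<le> i" "i < n" for i
      unfolding N_def nbrs_def adj using that by auto
    have "(\<Sum>j\<in>N i. ?d j) \<le> 2 * ?d i" if i: "i \<in> {1..n}" for i
    proof -
      consider "i = 1" | "i = 2" | "i = 3" | "i = 4" | "5 \<le> i" "i < n" | "i = n" using i by force
      then show ?thesis by cases (use assms nb nb'[of i] in auto)
    qed
    \<comment> \<open>The long arm is cut off at \<open>n\<close>, short of the end of the affine
      diagram: \<open>11 - n < 2 * (10 - n)\<close> for \<open>n \<le> 8\<close>.\<close>
    moreover have "(\<Sum>j\<in>N n. ?d j) < 2 * ?d n" using assms nb(5) by auto
    moreover have "0 < ?d i" if "i \<in> {1..n}" for i using that assms by auto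
    ultimately show ?thesis using assms unfolding subadditive_on_def N_def
      by (intro conjI ballI bexI[of _ n]) auto
  qed
  ultimately show ?thesis unfolding good_diagram_def by blast
qed

lemma ADE_good: "ADE_diagram I adj \<Longrightarrow> good_diagram I adj"
proof -
  assume "ADE_diagram I adj"
  then consider n where "1 \<le> n" "diagram_iso I adj n (A_edges n)"
    | n where "4 \<le> n" "diagram_iso I adj n (D_edges n)"
    | n where "n \<in> {6, 7, 8}" "diagram_iso I adj n (E_edges n)"
    unfolding ADE_diagram_def by blast
  then obtain n Es where "diagram_iso I adj n Es" and good: "good_diagram {1..n} (\<lambda>i j. {i, j} \<in> Es)"
    by cases (use A_good D_good E_good in blast)+
  then obtain f where "bij_betw f I {1..n}" "\<And>i j. i \<in> I \<Longrightarrow> j \<in> I \<Longrightarrow> adj i j \<longleftrightarrow> {f i, f j} \<in> Es"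
    unfolding diagram_iso_def by blast
  then show ?thesis using good_diagram_iso[OF _ _ good] by blast
qed

section \<open>Root systems from lattice embeddings\<close>

text \<open>This separates the root system from the quotient construction: \<open>\<psi>\<close>
  gives coordinates in the simple roots, and \<open>R\<close> has to consist of all roots.\<close>

locale lattice_embedding = periodic_diagram I adj col h + comm_group G
  for I :: "'i set" and adj :: "'i \<Rightarrow> 'i \<Rightarrow> bool" and col :: "'i \<Rightarrow> bool" and h :: nat
    and G :: "('g, 'm) monoid_scheme" (structure) +
  fixes \<psi> :: "'g \<Rightarrow> 'i \<Rightarrow> int" and R :: "'g set"
  assumes psi_inj: "inj_on \<psi> (carrier G)"
    and psi_mult: "\<And>x y. x \<in> carrier G \<Longrightarrow> y \<in> carrier G \<Longrightarrow> \<psi> (x \<otimes> y) = (\<lambda>i. \<psi> x i + \<psi> y i)"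
    and psi_image: "\<psi> ` carrier G = {v. supported v}"
    and R_roots: "R = {x \<in> carrier G. is_root (\<psi> x)}"
    and R_finite: "finite R"
    and R_generates: "generate G R = carrier G"
begin

definition B :: "'g \<Rightarrow> 'g \<Rightarrow> int" where
  "B x y = E (\<psi> x) (\<psi> y) + E (\<psi> y) (\<psi> x)"

lemma psi_eqI: "x \<in> carrier G \<Longrightarrow> y \<in> carrier G \<Longrightarrow> (\<And>i. \<psi> x i = \<psi> y i) \<Longrightarrow> x = y"
  using psi_inj by (auto simp: inj_on_def fun_eq_iff)

lemma psi_supported: "x \<in> carrier G \<Longrightarrow> supported (\<psi> x)"
  using psi_image by blast

lemma psi_one: "\<psi> \<one> i = 0"
  using fun_cong[OF psi_mult[of \<one> \<one>], of i] by simp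

lemma psi_inv: "x \<in> carrier G \<Longrightarrow> \<psi> (inv x) i = - \<psi> x i"
  using fun_cong[OF psi_mult[of x "inv x"], of i] psi_one[of i] by simp

lemma psi_nat_pow: "x \<in> carrier G \<Longrightarrow> \<psi> (x [^] (k::nat)) i = int k * \<psi> x i"
  by (induction k) (simp_all add: psi_one psi_mult algebra_simps)

lemma psi_int_pow: "x \<in> carrier G \<Longrightarrow> \<psi> (x [^] (k::int)) i = k * \<psi> x i"
  by (cases k rule: int_cases2) (simp_all add: int_pow_int int_pow_neg psi_inv psi_nat_pow)

lemma psi_finprod:
  assumes "f \<in> A \<rightarrow> carrier G"
  shows "\<psi> (finprod G f A) i = (\<Sum>a\<in>A. \<psi> (f a) i)"
  using assms
proof (induction A rule: infinite_finite_induct)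
  case (insert a A)
  then show ?case by (simp add: psi_mult Pi_iff)
qed (simp_all add: psi_one)

lemma B_biadditive: "biadditive G B"
  unfolding biadditive_def B_def by (simp add: psi_mult eform_add_left eform_add_right)

lemma B_symmetric: "symmetric_form G B"
  by (simp add: symmetric_form_def B_def)

lemma B_posdef: "positive_definite G B"
  unfolding positive_definite_def
proof (intro ballI impI)
  fix x assume x: "x \<in> carrier G" "x \<noteq> \<one>"
  have "\<psi> x \<noteq> (\<lambda>i. 0)"
    using psi_eqI[OF x(1) one_closed] x(2) psi_one by (auto simp: fun_eq_iff)
  then show "0 < B x x" using posdef[OF psi_supported[OF x(1)]] by (simp add: B_def)
qed

lemma R_carrier: "R \<subseteq> carrier G"
  using R_roots by blast

lemma B_root: "\<alpha> \<in> R \<Longrightarrow> B \<alpha> \<alpha> = 2"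
  by (simp add: R_roots B_def is_root_def)

lemma cartan_root: "\<alpha> \<in> R \<Longrightarrow> cartan B \<beta> \<alpha> = B \<beta> \<alpha>"
  by (simp add: cartan_def B_root)

text \<open>Reflections preserve the quadratic form, and \<open>R\<close> is the set on which it
  takes the root value; the combinatorics of the quiver does not enter.\<close>

lemma B_reflection:
  assumes "\<alpha> \<in> R" "\<beta> \<in> R"
  shows "\<beta> \<otimes> inv (\<alpha> [^] cartan B \<beta> \<alpha>) \<in> R"
proof -
  define c where "c = B \<beta> \<alpha>"
  have in_G: "\<alpha> \<in> carrier G" "\<beta> \<in> carrier G" using assms R_carrier by auto
  let ?x = "\<beta> \<otimes> inv (\<alpha> [^] c)"
  have psi: "\<psi> ?x = (\<lambda>i. \<psi> \<beta> i + (- c) * \<psi> \<alpha> i)"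
    using in_G by (simp add: psi_mult psi_inv psi_int_pow)
  have "E (\<psi> ?x) (\<psi> ?x) = E (\<psi> \<beta>) (\<psi> \<beta>) - c * (E (\<psi> \<beta>) (\<psi> \<alpha>) + E (\<psi> \<alpha>) (\<psi> \<beta>)) + c * c * E (\<psi> \<alpha>) (\<psi> \<alpha>)"
    unfolding psi eform_add_left eform_add_right eform_scale_left eform_scale_right
    by (simp add: algebra_simps)
  also have "\<dots> = 1"
    using assms by (simp add: R_roots is_root_def c_def B_def)
  finally have "is_root (\<psi> ?x)"
    using psi_supported[of ?x] in_G by (simp add: is_root_def)
  then show ?thesis using in_G cartan_root[OF assms(1)] by (simp add: R_roots c_def)
qed

text \<open>Both roots have \<open>E\<close>-value 1, so comparing quadratic forms gives
  \<open>k * k = m * m\<close>.\<close>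

lemma root_proportional:
  assumes "\<alpha> \<in> R" "\<beta> \<in> R" "k \<noteq> 0" "\<beta> [^] (k::int) = \<alpha> [^] (m::int)"
  shows "\<beta> = \<alpha> \<or> \<beta> = inv \<alpha>"
proof -
  have in_G: "\<alpha> \<in> carrier G" "\<beta> \<in> carrier G" using assms R_carrier by auto
  have eq: "k * \<psi> \<beta> i = m * \<psi> \<alpha> i" for i
    using psi_int_pow[OF in_G(2), of k i] psi_int_pow[OF in_G(1), of m i] assms(4) by simp
  have "k * k * E (\<psi> \<beta>) (\<psi> \<beta>) = E (\<lambda>i. k * \<psi> \<beta> i) (\<lambda>i. k * \<psi> \<beta> i)"
    unfolding eform_scale_left eform_scale_right by simp
  also have "\<dots> = m * m * E (\<psi> \<alpha>) (\<psi> \<alpha>)"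
    unfolding eq eform_scale_left eform_scale_right by simp
  finally have "k * k = m * m" using assms(1,2) by (simp add: R_roots is_root_def)
  then consider "m = k" | "m = - k" by (metis square_eq_iff)
  then show ?thesis
  proof cases
    case 1
    then have "\<beta> = \<alpha>" using eq assms(3) in_G by (intro psi_eqI) auto
    then show ?thesis ..
  next
    case 2
    then have "\<psi> \<beta> i = \<psi> (inv \<alpha>) i" for i
      using eq[of i] assms(3) in_G by (simp add: psi_inv) (metis mult_cancel_left mult_minus_right)
    then have "\<beta> = inv \<alpha>" using in_G by (intro psi_eqI) auto
    then show ?thesis ..
  qed
qed

lemma R_root_system: "root_system G B R"
  unfolding root_system_def
proof (intro conjI ballI allI impI)
  show "\<one> \<notin> R"
  proof
    assume "\<one> \<in> R"
    moreover have "\<psi> \<one> = (\<lambda>i. 0)" using psi_one by auto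
    ultimately show False by (simp add: R_roots is_root_def eform_zero_left)
  qed
  show "\<exists>k::nat. 0 < k \<and> x [^] k \<in> generate G R" if "x \<in> carrier G" for x
    using that by (intro exI[of _ 1]) (simp add: R_generates)
  show "B \<alpha> \<alpha> dvd 2 * B \<beta> \<alpha>" if "\<alpha> \<in> R" for \<alpha> \<beta> using that by (simp add: B_root)
  show "\<beta> = \<alpha> \<or> \<beta> = inv \<alpha>"
    if "\<alpha> \<in> R" "\<beta> \<in> R" "k \<noteq> 0 \<and> \<beta> [^] (k::int) = \<alpha> [^] (m::int)" for \<alpha> \<beta> k m
    using that root_proportional by blast
qed (use R_finite R_carrier B_reflection in auto)

section \<open>The base of simple roots\<close>

definition simple :: "'i \<Rightarrow> 'g" where
  "simple k = inv_into (carrier G) \<psi> (unit_vec k)"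

lemma simple:
  assumes "k \<in> I"
  shows "simple k \<in> carrier G" "\<psi> (simple k) = unit_vec k"
proof -
  have "unit_vec k \<in> \<psi> ` carrier G" using assms by (simp add: psi_image)
  then show "simple k \<in> carrier G" "\<psi> (simple k) = unit_vec k"
    unfolding simple_def by (rule inv_into_into, rule f_inv_into_f)
qed

lemma unit_vec_inj: "unit_vec i = unit_vec j \<Longrightarrow> i = j"
proof -
  assume "unit_vec i = unit_vec j"
  from fun_cong[OF this, of i] show ?thesis by (simp add: unit_vec_def split: if_splits)
qed

lemma simple_inj: "inj_on simple I"
  using simple(2) unit_vec_inj by (metis inj_onI)

lemma E_unit:
  assumes "i \<in> I" "j \<in> I"
  shows "E (unit_vec i) (unit_vec j) = of_bool (i = j) - of_bool (\<not> col i \<and> adj i j)"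
proof -
  have "(\<Sum>l\<in>nb i. unit_vec j l) = of_bool (j \<in> nb i)" by simp
  then show ?thesis using assms by (simp add: eform_unit_left nb_iff) (simp add: unit_vec_def)
qed

lemma simple_root: "k \<in> I \<Longrightarrow> simple k \<in> R"
  using col_adj[of k k] by (auto simp: R_roots simple is_root_def E_unit)

lemma psi_lin_comb:
  "\<psi> (lin_comb G (simple ` I) c) i = (if i \<in> I then c (simple i) else 0)"
proof -
  have "\<psi> (lin_comb G (simple ` I) c) i = (\<Sum>\<alpha>\<in>simple ` I. \<psi> (\<alpha> [^] c \<alpha>) i)"
    unfolding lin_comb_def using simple(1) by (intro psi_finprod) auto
  also have "\<dots> = (\<Sum>k\<in>I. \<psi> (simple k [^] c (simple k)) i)"
    using simple_inj by (simp add: sum.reindex)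
  also have "\<dots> = (\<Sum>k\<in>I. c (simple k) * unit_vec k i)"
    by (intro sum.cong refl) (simp add: psi_int_pow simple)
  finally show ?thesis using unit_expand by simp
qed

lemma lin_comb_carrier: "lin_comb G (simple ` I) c \<in> carrier G"
  unfolding lin_comb_def using simple(1) by (intro finprod_closed) auto

text \<open>The coefficients in this base are the coordinates under \<open>\<psi>\<close>, so the
  sign condition is exactly \<open>root_sign\<close>.\<close>

lemma simple_base: "root_base G R (simple ` I)"
  unfolding root_base_def
proof (intro conjI allI impI ballI)
  show "simple ` I \<subseteq> R" using simple_root by blast
next
  fix c \<alpha> assume one: "lin_comb G (simple ` I) c = \<one>" and "\<alpha> \<in> simple ` I"
  then obtain k where "k \<in> I" "\<alpha> = simple k" by blast
  then show "c \<alpha> = 0" using psi_lin_comb[of c k] psi_one[of k] one by simp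
next
  fix \<beta> assume \<beta>: "\<beta> \<in> R"
  define c where "c = (\<lambda>x. \<psi> \<beta> (inv_into I simple x))"
  have c: "c (simple k) = \<psi> \<beta> k" if "k \<in> I" for k
    using that simple_inj by (simp add: c_def)
  have "\<beta> = lin_comb G (simple ` I) c"
  proof (rule psi_eqI)
    show "\<psi> \<beta> i = \<psi> (lin_comb G (simple ` I) c) i" for i
      using c psi_supported[of \<beta>] \<beta> R_carrier by (auto simp: psi_lin_comb supported_def)
  qed (use \<beta> R_carrier lin_comb_carrier in auto)
  moreover have "(\<forall>\<alpha>\<in>simple ` I. 0 \<le> c \<alpha>) \<or> (\<forall>\<alpha>\<in>simple ` I. c \<alpha> \<le> 0)"
    using root_sign[of "\<psi> \<beta>"] \<beta> c by (auto simp: R_roots nonneg_vec_def)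
  ultimately show "\<exists>c. \<beta> = lin_comb G (simple ` I) c \<and>
      ((\<forall>\<alpha>\<in>simple ` I. 0 \<le> c \<alpha>) \<or> (\<forall>\<alpha>\<in>simple ` I. c \<alpha> \<le> 0))" by blast
qed

lemma R_dynkin: "has_simply_laced_dynkin_diagram G B R I adj"
  unfolding has_simply_laced_dynkin_diagram_def
proof (intro exI conjI ballI impI)
  show "root_base G R (simple ` I)" by (rule simple_base)
  show "bij_betw simple I (simple ` I)" using simple_inj by (simp add: bij_betw_def)
next
  fix i j assume ij: "i \<in> I" "j \<in> I" "i \<noteq> j"
  have "B (simple i) (simple j) = - of_bool (adj i j)"
    using ij col_adj[of i j] adj_commute[of i j] by (auto simp: B_def simple E_unit)
  moreover have "B (simple j) (simple i) = B (simple i) (simple j)" by (simp add: B_def)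
  ultimately show "cartan B (simple i) (simple j) * cartan B (simple j) (simple i) = edge_mult adj i j"
    using ij simple_root by (simp add: cartan_root edge_mult_def)
qed

end

section \<open>The mesh lattice and its Euler form\<close>

lemma of_nat_bit_eq_0_iff: "(of_nat n :: bit) = 0 \<longleftrightarrow> even n"
proof (induction n)
  case (Suc n)
  then show ?case by (cases "of_nat n :: bit") auto
qed simp

locale mesh_lattice = periodic_diagram I adj col h
  for I :: "'i set" and adj :: "'i \<Rightarrow> 'i \<Rightarrow> bool" and col :: "'i \<Rightarrow> bool" and h :: nat +
  fixes p :: "'i \<Rightarrow> bit"
  assumes col_p: "\<And>i. i \<in> I \<Longrightarrow> col i \<longleftrightarrow> p i = 0"
begin

abbreviation V :: "('i \<times> nat) set" where "V \<equiv> Ihat I p h"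
abbreviation F :: "(('i \<times> nat) \<Rightarrow>\<^sub>0 int) monoid" where "F \<equiv> free_Abelian_group V"
abbreviation J :: "(('i \<times> nat) \<Rightarrow>\<^sub>0 int) set" where "J \<equiv> mesh_subgroup I adj p h"
abbreviation Q :: "(('i \<times> nat) \<Rightarrow>\<^sub>0 int) set monoid" where "Q \<equiv> lattice_Q I adj p h"
abbreviation cls :: "(('i \<times> nat) \<Rightarrow>\<^sub>0 int) \<Rightarrow> (('i \<times> nat) \<Rightarrow>\<^sub>0 int) set" where "cls a \<equiv> J #>\<^bsub>F\<^esub> a"

lemma V_iff: "(i, n) \<in> V \<longleftrightarrow> adm i n \<and> n < 2 * h"
proof -
  have "p i + of_nat n = 0 \<longleftrightarrow> (of_nat n :: bit) = p i"
    by (cases "p i"; cases "of_nat n :: bit") auto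
  also have "\<dots> \<longleftrightarrow> (even n \<longleftrightarrow> p i = 0)"
    using of_nat_bit_eq_0_iff[of n] by (cases "p i"; cases "of_nat n :: bit") auto
  finally have "p i + of_nat n = 0 \<longleftrightarrow> (even n \<longleftrightarrow> p i = 0)" .
  then show ?thesis using col_p[of i] by (auto simp: Ihat_def adm_def)
qed

lemma finite_V: "finite V"
proof (rule finite_subset)
  show "V \<subseteq> I \<times> {..<2 * h}" by (auto simp: Ihat_def)
  show "finite (I \<times> {..<2 * h})" using finite_I by simp
qed

definition vec :: "'i \<times> nat \<Rightarrow> 'i \<Rightarrow> int" where
  "vec q = rt (fst q) (snd q)"

lemma vec_root: "q \<in> V \<Longrightarrow> is_root (vec q)"
  using root_rt V_iff[of "fst q" "snd q"] by (simp add: vec_def)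

lemma vec_inj: "inj_on vec V"
proof (rule inj_onI)
  fix x y assume "x \<in> V" "y \<in> V" "vec x = vec y"
  then show "x = y"
    using rt_adm_inj[of "fst x" "snd x" "fst y" "snd y"] V_iff[of "fst x" "snd x"] V_iff[of "fst y" "snd y"]
    by (simp add: vec_def prod_eq_iff)
qed

lemma vec_onto: "is_root v \<Longrightarrow> \<exists>q\<in>V. vec q = v"
proof -
  assume "is_root v"
  then obtain k n where "adm k n" "n < 2 * h" "rt k n = v" by (rule root_is_rt)
  then show ?thesis using V_iff by (intro bexI[of _ "(k, n)"]) (simp_all add: vec_def)
qed

lemma V_mod: "adm i n \<Longrightarrow> (i, n mod (2 * h)) \<in> V"
  using rt_mod(2) h_pos by (simp add: V_iff)

lemma vec_mod: "adm i n \<Longrightarrow> vec (i, n mod (2 * h)) = rt i n"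
  using rt_mod(1) by (simp add: vec_def)

lemma shift_mod: "shift h (n mod (2 * h)) k = (n + k) mod (2 * h)"
  by (simp add: shift_def mod_add_left_eq)

lemma shift_V:
  assumes "(i, n) \<in> V"
  shows "(i, shift h n 2) \<in> V" "vec (i, shift h n 2) = rt i (Suc (Suc n))"
    and "j \<in> nb i \<Longrightarrow> (j, shift h n 1) \<in> V" "j \<in> nb i \<Longrightarrow> vec (j, shift h n 1) = rt j (Suc n)"
  using assms adm_nb[of i n j] V_mod[of i "Suc (Suc n)"] V_mod[of j "Suc n"]
    vec_mod[of i "Suc (Suc n)"] vec_mod[of j "Suc n"]
  by (auto simp: V_iff shift_def adm_def)

section \<open>The mesh subgroup as a kernel\<close>

definition \<Phi> :: "(('i \<times> nat) \<Rightarrow>\<^sub>0 int) \<Rightarrow> 'i \<Rightarrow> int" where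
  "\<Phi> a i = (\<Sum>q\<in>V. poly_mapping.lookup a q * vec q i)"

lemma Phi_zero [simp]: "\<Phi> 0 i = 0"
  by (simp add: \<Phi>_def)

lemma Phi_add [simp]: "\<Phi> (a + b) i = \<Phi> a i + \<Phi> b i"
  by (simp add: \<Phi>_def lookup_add distrib_right sum.distrib)

lemma Phi_diff [simp]: "\<Phi> (a - b) i = \<Phi> a i - \<Phi> b i"
  by (simp add: \<Phi>_def lookup_minus left_diff_distrib sum_subtractf)

lemma Phi_uminus [simp]: "\<Phi> (- a) i = - \<Phi> a i"
  using Phi_diff[of 0 a i] by simp

lemma Phi_sum: "\<Phi> (\<Sum>x\<in>K. f x) i = (\<Sum>x\<in>K. \<Phi> (f x) i)"
  by (induction K rule: infinite_finite_induct) simp_all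

lemma Phi_cmul: "\<Phi> (frag_cmul c a) i = c * \<Phi> a i"
  by (simp add: \<Phi>_def sum_distrib_left mult.assoc)

lemma Phi_frag [simp]: "q \<in> V \<Longrightarrow> \<Phi> (frag_of q) i = vec q i"
proof -
  assume q: "q \<in> V"
  have "\<Phi> (frag_of q) i = (\<Sum>r\<in>V. if r = q then vec r i else 0)"
    unfolding \<Phi>_def by (intro sum.cong) auto
  then show ?thesis using q finite_V by simp
qed

lemma Phi_supported: "supported (\<Phi> a)"
  using vec_root by (auto simp: \<Phi>_def supported_def is_root_def intro!: sum.neutral)

lemma Phi_mesh:
  assumes "q \<in> V"
  shows "\<Phi> (mesh_rel I adj h q) i = 0"
proof -
  obtain k n where q: "q = (k, n)" by (cases q)
  have k: "adm k n" using assms V_iff q by simp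
  have "\<Phi> (mesh_rel I adj h q) i = rt k n i - (\<Sum>j\<in>nb k. rt j (Suc n) i) + rt k (Suc (Suc n)) i"
    using assms shift_V[of k n] by (simp add: mesh_rel_def q Phi_sum vec_def[of "(k, n)"])
  then show ?thesis using rt_mesh[OF k, of i] by simp
qed

lemma mesh_rel_keys: "q \<in> V \<Longrightarrow> Poly_Mapping.keys (mesh_rel I adj h q) \<subseteq> V"
proof -
  assume q: "q \<in> V"
  obtain k n where kn: "q = (k, n)" by (cases q)
  have "mesh_rel I adj h q \<in> carrier F"
  proof -
    interpret comm_group F by (rule abelian_free_Abelian_group)
    have diff: "a - b \<in> carrier F" if "a \<in> carrier F" "b \<in> carrier F" for a b
      using that keys_diff[of a b] by auto
    have "(\<Sum>j\<in>nb k. frag_of (j, shift h n 1)) \<in> carrier F"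
      using q kn shift_V(3) by (intro sum_closed_free_Abelian_group) auto
    moreover have "frag_of (k, n) \<in> carrier F" "frag_of (k, shift h n 2) \<in> carrier F"
      using q kn shift_V(1) by simp_all
    ultimately show ?thesis
      using m_closed diff unfolding mesh_rel_def kn by (simp only: split mult_free_Abelian_group)
  qed
  then show ?thesis by simp
qed

lemma J_subgroup: "subgroup J F"
  unfolding mesh_subgroup_def using mesh_rel_keys
  by (intro group.generate_is_subgroup) auto

lemma J_keys: "a \<in> J \<Longrightarrow> Poly_Mapping.keys a \<subseteq> V"
proof -
  assume "a \<in> J"
  then have "a \<in> carrier F" using subgroup.subset[OF J_subgroup] by blast
  then show ?thesis by simp
qed

lemma J_diff: "a \<in> J \<Longrightarrow> b \<in> J \<Longrightarrow> a - b \<in> J"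
  using subgroup.m_closed[OF J_subgroup, of a "- b"] subgroup.m_inv_closed[OF J_subgroup, of b] J_keys[of b]
  by simp

lemma J_zero: "0 \<in> J"
  using subgroup.one_closed[OF J_subgroup] by simp

lemma J_uminus: "a \<in> J \<Longrightarrow> - a \<in> J"
  using J_diff[OF J_zero, of a] by simp

lemma J_add: "a \<in> J \<Longrightarrow> b \<in> J \<Longrightarrow> a + b \<in> J"
  using J_diff[of a "- b"] J_uminus[of b] by simp

lemma J_sum: "(\<And>x. x \<in> K \<Longrightarrow> f x \<in> J) \<Longrightarrow> (\<Sum>x\<in>K. f x) \<in> J"
  by (induction K rule: infinite_finite_induct) (simp_all add: J_zero J_add)

lemma J_mesh: "q \<in> V \<Longrightarrow> mesh_rel I adj h q \<in> J"
  unfolding mesh_subgroup_def by (intro generate.incl) auto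

lemma Phi_J:
  assumes "a \<in> J"
  shows "\<Phi> a i = 0"
proof -
  have "Poly_Mapping.keys a \<subseteq> V \<and> \<Phi> a i = 0"
    using assms unfolding mesh_subgroup_def
  proof (induction rule: generate.induct)
    case one
    then show ?case by simp
  next
    case (incl a)
    then show ?case using Phi_mesh mesh_rel_keys by blast
  next
    case (inv a)
    then have "Poly_Mapping.keys a \<subseteq> V" "\<Phi> a i = 0" using Phi_mesh mesh_rel_keys by blast+
    then show ?case by simp
  next
    case (eng a b)
    then have "Poly_Mapping.keys (a + b) \<subseteq> V" using keys_add[of a b] by blast
    then show ?case using eng by simp
  qed
  then show ?thesis by simp
qed

text \<open>Lifts of the unit vectors. They are the vertices of the slice \<open>n \<in> {- 1, 0}\<close>, up to sign.\<close>

definition lift :: "'i \<Rightarrow> ('i \<times> nat) \<Rightarrow>\<^sub>0 int" where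
  "lift k = (if col k then frag_of (k, 0) else - frag_of (k, 2 * h - 1))"

text \<open>The defect between a vertex and its expansion in the lifts. It obeys the mesh relations
  modulo \<open>J\<close> and vanishes on the slice of the lifts, so it lies in \<open>J\<close> at
  every vertex. Columns are unrolled to allow induction.\<close>

definition rem :: "'i \<Rightarrow> nat \<Rightarrow> ('i \<times> nat) \<Rightarrow>\<^sub>0 int" where
  "rem k n = frag_of (k, n mod (2 * h)) - (\<Sum>l\<in>I. frag_cmul (rt k n l) (lift l))"

lemma rem_mesh:
  assumes "adm k n"
  shows "rem k n + rem k (Suc (Suc n)) - (\<Sum>j\<in>nb k. rem j (Suc n)) \<in> J"
proof -
  have "(\<Sum>j\<in>nb k. \<Sum>l\<in>I. frag_cmul (rt j (Suc n) l) (lift l)) =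
      (\<Sum>l\<in>I. \<Sum>j\<in>nb k. frag_cmul (rt j (Suc n) l) (lift l))"
    by (rule sum.swap)
  also have "\<dots> = (\<Sum>l\<in>I. frag_cmul (\<Sum>j\<in>nb k. rt j (Suc n) l) (lift l))"
  proof (intro sum.cong refl)
    fix l
    show "(\<Sum>j\<in>nb k. frag_cmul (rt j (Suc n) l) (lift l)) = frag_cmul (\<Sum>j\<in>nb k. rt j (Suc n) l) (lift l)"
      by (rule poly_mapping_eqI) (simp add: lookup_sum sum_distrib_right)
  qed
  also have "\<dots> = (\<Sum>l\<in>I. frag_cmul (rt k n l) (lift l) + frag_cmul (rt k (Suc (Suc n)) l) (lift l))"
    by (simp only: rt_mesh[OF assms, symmetric] frag_cmul_distrib)
  finally have eq: "(\<Sum>j\<in>nb k. \<Sum>l\<in>I. frag_cmul (rt j (Suc n) l) (lift l)) =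
      (\<Sum>l\<in>I. frag_cmul (rt k n l) (lift l)) + (\<Sum>l\<in>I. frag_cmul (rt k (Suc (Suc n)) l) (lift l))"
    by (simp only: sum.distrib)
  have "mesh_rel I adj h (k, n mod (2 * h)) =
      frag_of (k, n mod (2 * h)) - (\<Sum>j\<in>nb k. frag_of (j, Suc n mod (2 * h))) + frag_of (k, Suc (Suc n) mod (2 * h))"
    by (simp add: mesh_rel_def shift_mod)
  then have "rem k n + rem k (Suc (Suc n)) - (\<Sum>j\<in>nb k. rem j (Suc n)) = mesh_rel I adj h (k, n mod (2 * h))"
    unfolding rem_def sum_subtractf eq by (simp add: algebra_simps)
  then show ?thesis using J_mesh V_mod[OF assms] by simp
qed

text \<open>Columns \<open>2 * h - 1\<close> and \<open>2 * h\<close> represent -1 and 0 as adjacent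
  natural numbers.\<close>

lemma rem_base:
  assumes "k \<in> I"
  shows "col k \<Longrightarrow> rem k (2 * h) = 0" "\<not> col k \<Longrightarrow> rem k (2 * h - 1) = 0"
proof -
  have unit: "(\<Sum>l\<in>I. frag_cmul (c * unit_vec k l) (lift l)) = frag_cmul c (lift k)" for c
  proof -
    have "(\<Sum>l\<in>I. frag_cmul (c * unit_vec k l) (lift l)) = (\<Sum>l\<in>I. if l = k then frag_cmul c (lift l) else 0)"
      by (intro sum.cong) (auto simp: unit_vec_def)
    then show ?thesis using assms finite_I by simp
  qed
  show "rem k (2 * h) = 0" if "col k"
    using unit[of 1] that rt_add[of k 0 h] cox_pow_h by (simp add: rem_def rt_def lift_def)
  have "Suc (2 * h - 1) div 2 = h" "(2 * h - 1) mod (2 * h) = 2 * h - 1" using h_pos by auto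
  then show "rem k (2 * h - 1) = 0" if "\<not> col k"
    using unit[of "-1"] that cox_pow_h by (simp add: rem_def rt_def lift_def)
qed

lemma rem_J: "adm k (2 * h - 1 + n) \<Longrightarrow> rem k (2 * h - 1 + n) \<in> J"
proof (induction n arbitrary: k rule: induct_nat_012)
  case 0
  then have "\<not> col k" "k \<in> I" using h_pos by (auto simp: adm_def)
  then show ?case using rem_base(2) J_zero by simp
next
  case 1
  then have "col k" "k \<in> I" using h_pos by (auto simp: adm_def)
  then show ?case using rem_base(1) J_zero h_pos by simp
next
  case (ge2 n)
  let ?n = "2 * h - 1 + n"
  have k: "adm k ?n" using ge2.prems by (simp add: adm_def)
  have "(\<Sum>j\<in>nb k. rem j (Suc ?n)) \<in> J"
    using ge2.IH(2) adm_nb[OF k] by (intro J_sum) simp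
  then have "(rem k ?n + rem k (Suc (Suc ?n)) - (\<Sum>j\<in>nb k. rem j (Suc ?n))) + (\<Sum>j\<in>nb k. rem j (Suc ?n)) - rem k ?n \<in> J"
    using J_diff[OF J_add[OF rem_mesh[OF k]] ge2.IH(1)[OF k]] by blast
  then show ?case by (simp add: algebra_simps)
qed

text \<open>A normal form modulo \<open>J\<close>: the lifts span the quotient, with the values of
  \<open>\<Phi>\<close> as coefficients. Hence the kernel of \<open>\<Phi>\<close> is no larger than
  \<open>J\<close>.\<close>

lemma reduce:
  assumes "Poly_Mapping.keys a \<subseteq> V"
  shows "a - (\<Sum>l\<in>I. frag_cmul (\<Phi> a l) (lift l)) \<in> J"
  using assms
proof (induction a rule: frag_induction)
  case zero
  then show ?case by (simp add: J_zero)
next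
  case (one q)
  obtain k n where q: "q = (k, n)" by (cases q)
  then have k: "adm k n" "n < 2 * h" using one V_iff by auto
  \<comment> \<open>One period is added so that the column lies to the right of the slice where the
    induction of \<open>rem_J\<close> starts.\<close>
  have eq: "2 * h - 1 + Suc n = n + 2 * h" using h_pos by simp
  have "adm k (2 * h - 1 + Suc n)" unfolding eq using k(1) by (simp add: adm_def)
  then have "rem k (n + 2 * h) \<in> J" using rem_J[of k "Suc n"] unfolding eq by blast
  moreover have "rt k (n + 2 * h) = rt k n" by (simp add: rt_add cox_pow_h)
  ultimately show ?case using one k(2) by (simp add: rem_def q vec_def)
next
  case (diff a b)
  have eq: "(a - (\<Sum>l\<in>I. frag_cmul (\<Phi> a l) (lift l))) - (b - (\<Sum>l\<in>I. frag_cmul (\<Phi> b l) (lift l))) =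
      (a - b) - (\<Sum>l\<in>I. frag_cmul (\<Phi> (a - b) l) (lift l))"
    by (simp add: frag_cmul_diff_distrib sum_subtractf algebra_simps)
  show ?case using J_diff[OF diff] unfolding eq .
qed

lemma J_eq: "J = {a. Poly_Mapping.keys a \<subseteq> V \<and> (\<forall>i. \<Phi> a i = 0)}"
proof (intro equalityI subsetI)
  fix a assume "a \<in> {a. Poly_Mapping.keys a \<subseteq> V \<and> (\<forall>i. \<Phi> a i = 0)}"
  then show "a \<in> J" using reduce[of a] by simp
next
  fix a assume "a \<in> J"
  then show "a \<in> {a. Poly_Mapping.keys a \<subseteq> V \<and> (\<forall>i. \<Phi> a i = 0)}" using J_keys[of a] Phi_J[of a] by blast
qed

section \<open>The quotient group and its coordinates\<close>

lemma cls_eq_iff: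
  assumes "Poly_Mapping.keys a \<subseteq> V" "Poly_Mapping.keys b \<subseteq> V"
  shows "cls a = cls b \<longleftrightarrow> \<Phi> a = \<Phi> b"
proof -
  interpret comm_group F by (rule abelian_free_Abelian_group)
  have "cls a = cls b \<longleftrightarrow> b \<in> cls a"
    using repr_independence[OF _ _ J_subgroup, of b a] repr_independenceD[OF J_subgroup, of b a] assms by auto
  also have "\<dots> \<longleftrightarrow> (\<exists>j\<in>J. b = j + a)"
    by (auto simp: r_coset_def)
  also have "\<dots> \<longleftrightarrow> b - a \<in> J"
    by (metis add_diff_cancel diff_add_cancel)
  also have "\<dots> \<longleftrightarrow> \<Phi> a = \<Phi> b"
    using assms keys_diff[of b a] by (auto simp: J_eq fun_eq_iff)
  finally show ?thesis .
qed

lemma Q_carrier: "carrier Q = cls ` {a. Poly_Mapping.keys a \<subseteq> V}"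
  by (simp add: lattice_Q_def carrier_FactGroup) (auto simp: free_Abelian_group_def)

lemma Q_normal: "J \<lhd> F"
  using J_subgroup comm_group.normal_iff_subgroup[OF abelian_free_Abelian_group] by blast

lemma Q_mult:
  assumes "Poly_Mapping.keys a \<subseteq> V" "Poly_Mapping.keys b \<subseteq> V"
  shows "cls a \<otimes>\<^bsub>Q\<^esub> cls b = cls (a + b)"
  using normal.rcos_sum[OF Q_normal, of a b] assms by (simp add: lattice_Q_def)

lemma Q_comm_group: "comm_group Q"
  unfolding lattice_Q_def
  by (rule comm_group.abelian_FactGroup[OF abelian_free_Abelian_group J_subgroup])

text \<open>By \<open>cls_eq_iff\<close> the value does not depend on the chosen
  representative.\<close>

definition \<psi> :: "(('i \<times> nat) \<Rightarrow>\<^sub>0 int) set \<Rightarrow> 'i \<Rightarrow> int" where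
  "\<psi> C = \<Phi> (SOME a. Poly_Mapping.keys a \<subseteq> V \<and> C = cls a)"

lemma psi_cls:
  assumes "Poly_Mapping.keys a \<subseteq> V"
  shows "\<psi> (cls a) = \<Phi> a"
proof -
  let ?b = "SOME b. Poly_Mapping.keys b \<subseteq> V \<and> cls a = cls b"
  have "Poly_Mapping.keys ?b \<subseteq> V \<and> cls a = cls ?b"
    by (rule someI[of _ a]) (use assms in simp)
  then show ?thesis unfolding \<psi>_def using cls_eq_iff[OF assms, of ?b] by simp
qed

lemma vertex_class_cls: "vertex_class I adj p h q = cls (frag_of q)"
  by (simp add: vertex_class_def)

lemma psi_vertex: "q \<in> V \<Longrightarrow> \<psi> (vertex_class I adj p h q) = vec q"
  by (simp add: vertex_class_cls psi_cls fun_eq_iff)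

lemma lift_keys: "k \<in> I \<Longrightarrow> Poly_Mapping.keys (lift k) \<subseteq> V"
  using h_pos by (auto simp: lift_def V_iff adm_def)

lemma Phi_lift: "k \<in> I \<Longrightarrow> \<Phi> (lift k) i = unit_vec k i"
proof -
  assume k: "k \<in> I"
  have "Suc (2 * h - 1) div 2 = h" using h_pos by auto
  moreover have "col k \<Longrightarrow> (k, 0) \<in> V" "\<not> col k \<Longrightarrow> (k, 2 * h - 1) \<in> V"
    using k h_pos by (auto simp: V_iff adm_def)
  ultimately show ?thesis by (auto simp: lift_def vec_def rt_def cox_pow_h)
qed

lemma psi_image: "\<psi> ` carrier Q = {v. supported v}"
proof (intro equalityI subsetI)
  fix v assume "v \<in> \<psi> ` carrier Q"
  then show "v \<in> {v. supported v}" using psi_cls Phi_supported by (auto simp: Q_carrier)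
next
  fix v assume v: "v \<in> {v. supported v}"
  define a where "a = (\<Sum>k\<in>I. frag_cmul (v k) (lift k))"
  have "a \<in> carrier F"
    unfolding a_def using lift_keys by (intro sum_closed_free_Abelian_group) (auto dest: subsetD[OF keys_cmul])
  then have a: "Poly_Mapping.keys a \<subseteq> V" by simp
  have "\<Phi> a i = (\<Sum>k\<in>I. v k * unit_vec k i)" for i
    unfolding a_def Phi_sum Phi_cmul using Phi_lift by (intro sum.cong) auto
  then have "\<Phi> a = v" using v by (auto simp: fun_eq_iff unit_expand supported_def)
  then have "\<psi> (cls a) = v" using psi_cls[OF a] by simp
  moreover have "cls a \<in> carrier Q" unfolding Q_carrier using a by blast
  ultimately show "v \<in> \<psi> ` carrier Q" by blast
qed

lemma Q_generated: "generate Q (vertex_class I adj p h ` V) = carrier Q"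
proof
  interpret Q: comm_group Q by (rule Q_comm_group)
  have vc: "vertex_class I adj p h ` V \<subseteq> carrier Q"
    unfolding Q_carrier vertex_class_cls by (auto simp: keys_frag_of)
  then show "generate Q (vertex_class I adj p h ` V) \<subseteq> carrier Q"
    by (rule Q.generate_incl)
  have sub: "subgroup (generate Q (vertex_class I adj p h ` V)) Q"
    using vc by (rule Q.generate_is_subgroup)
  let ?H = "generate Q (vertex_class I adj p h ` V)"
  have "cls a \<in> ?H" if "Poly_Mapping.keys a \<subseteq> V" for a
    using that
  proof (induction a rule: free_Abelian_group_induct[consumes 1, case_names zero diff vertex])
    case zero
    have "cls 0 = \<one>\<^bsub>Q\<^esub>"
    proof -
      have "cls 0 \<in> carrier Q" unfolding Q_carrier by (rule imageI) simp
      then show ?thesis using Q_mult[of 0 0] Q.r_cancel_one by simp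
    qed
    then show ?case using subgroup.one_closed[OF sub] by simp
  next
    case (diff a b)
    have ab: "Poly_Mapping.keys (a - b) \<subseteq> V" using diff keys_diff[of a b] by blast
    then have in_Q: "cls (a - b) \<in> carrier Q" "cls b \<in> carrier Q" "cls a \<in> carrier Q"
      using diff unfolding Q_carrier by blast+
    have "cls a = cls (a - b) \<otimes>\<^bsub>Q\<^esub> cls b"
      using Q_mult[OF ab diff(2)] by simp
    then have "cls (a - b) = cls a \<otimes>\<^bsub>Q\<^esub> inv\<^bsub>Q\<^esub> cls b"
      using Q.inv_solve_right[OF in_Q(1,3,2)] by blast
    then show ?case
      using subgroup.m_closed[OF sub diff(3) subgroup.m_inv_closed[OF sub diff(4)]] by simp
  next
    case (vertex q)
    then have "cls (frag_of q) \<in> vertex_class I adj p h ` V" unfolding vertex_class_cls by blast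
    then show ?case by (rule generate.incl)
  qed
  then show "carrier Q \<subseteq> ?H" by (auto simp: Q_carrier)
qed

section \<open>Identification and uniqueness of the Euler form\<close>

definition euler :: "'i \<times> nat \<Rightarrow> 'i \<times> nat \<Rightarrow> int" where
  "euler x y = (if x \<in> V \<and> y \<in> V then E (vec x) (vec y) else 0)"

lemma euler_is_euler_form: "is_euler_form I adj p h euler"
  unfolding is_euler_form_def
proof (intro conjI allI impI ballI)
  fix i j n assume "(i, n) \<in> V \<and> (j, n) \<in> V"
  then show "euler (i, n) (j, n) = of_bool (i = j)"
    using E_same[of i n j] by (simp add: euler_def vec_def V_iff)
next
  fix i j n assume ij: "(i, n) \<in> V \<and> (j, shift h n 1) \<in> V"
  then have adm: "adm i n" "adm j (Suc n)"
  proof -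
    \<comment> \<open>Wrapping around at the even number \<open>2 * h\<close> keeps parities, so
      admissibility can be read in the unrolled column.\<close>
    have "even (shift h n 1) \<longleftrightarrow> even (Suc n)"
      by (simp add: shift_def dvd_mod_iff)
    then show "adm i n" "adm j (Suc n)" using ij by (auto simp: V_iff adm_def)
  qed
  then have "euler (i, n) (j, shift h n 1) = E (rt i n) (rt j (Suc n))"
    using ij vec_mod[of j "Suc n"] by (simp add: euler_def vec_def[of "(i, n)"] shift_def)
  then show "euler (i, n) (j, shift h n 1) = edge_mult adj i j"
    using E_next[OF adm] by (simp add: edge_mult_def)
next
  fix q r assume q: "q \<in> V" and r: "r \<in> V"
  obtain i n where rin: "r = (i, n)" by (cases r)
  have "(\<Sum>j\<in>nb i. euler q (j, shift h n 1)) = (\<Sum>j\<in>nb i. E (vec q) (rt j (Suc n)))"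
    using q r rin shift_V(3,4)[of i n] by (intro sum.cong) (auto simp: euler_def)
  then have "euler q (i, n) - (\<Sum>j\<in>nb i. euler q (j, shift h n 1)) + euler q (i, shift h n 2) = 0"
    using q r rin shift_V(1,2)[of i n] E_mesh[of i n "vec q"]
    by (simp add: euler_def V_iff vec_def[of "(i, n)"])
  then show "case r of (i, n) \<Rightarrow> euler q (i, n) - (\<Sum>j\<in>nb i. euler q (j, shift h n 1)) + euler q (i, shift h n 2) = 0"
    by (simp add: rin)
qed

lemma euler_form_mesh:
  assumes "is_euler_form I adj p h E'" "q \<in> V" "(k, m) \<in> V"
  shows "E' q (k, m) - (\<Sum>j\<in>nb k. E' q (j, shift h m 1)) + E' q (k, shift h m 2) = 0"
proof -
  have "\<forall>q\<in>V. \<forall>r\<in>V. case r of (i, n) \<Rightarrow>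
      E' q (i, n) - (\<Sum>j\<in>nb i. E' q (j, shift h n 1)) + E' q (i, shift h n 2) = 0"
    using assms(1) unfolding is_euler_form_def by (elim conjE)
  from bspec[OF bspec[OF this assms(2)] assms(3)] show ?thesis by simp
qed

text \<open>For fixed \<open>q\<close>, the difference of two Euler forms vanishes in the column of
  \<open>q\<close> and in the next one; the mesh relation in the second argument propagates this to
  the right, around the whole cycle.\<close>

lemma euler_form_unique:
  assumes E1: "is_euler_form I adj p h E1" and E2: "is_euler_form I adj p h E2"
    and q: "q \<in> V" and r: "r \<in> V"
  shows "E1 q r = E2 q r"
proof -
  obtain i n where qin: "q = (i, n)" by (cases q)
  have i: "adm i n" "n < 2 * h" using q qin V_iff by auto
  define D where "D m k = E1 q (k, m mod (2 * h)) - E2 q (k, m mod (2 * h))" for m k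
  have D: "D (n + t) k = 0" if "adm k (n + t)" for t k
    using that
  proof (induction t arbitrary: k rule: induct_nat_012)
    case 0
    then have "(k, n) \<in> V" using i V_iff by simp
    then have "E1 q (k, n) = of_bool (i = k)" "E2 q (k, n) = of_bool (i = k)"
      using E1 E2 q unfolding is_euler_form_def qin by blast+
    then show ?case using i by (simp add: D_def)
  next
    case 1
    then have "(k, shift h n 1) \<in> V" using V_mod[of k "Suc n"] by (simp add: shift_def)
    then have "E1 q (k, shift h n 1) = edge_mult adj i k" "E2 q (k, shift h n 1) = edge_mult adj i k"
      using E1 E2 q unfolding is_euler_form_def qin by blast+
    then show ?case by (simp add: D_def shift_def)
  next
    case (ge2 t)
    let ?m = "(n + t) mod (2 * h)"
    have k: "adm k (n + t)" using ge2.prems by (simp add: adm_def)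
    have "(k, ?m) \<in> V" using V_mod[OF k] .
    then have "E1 q (k, ?m) - (\<Sum>j\<in>nb k. E1 q (j, shift h ?m 1)) + E1 q (k, shift h ?m 2) = 0"
      "E2 q (k, ?m) - (\<Sum>j\<in>nb k. E2 q (j, shift h ?m 1)) + E2 q (k, shift h ?m 2) = 0"
      using euler_form_mesh[OF E1 q] euler_form_mesh[OF E2 q] by blast+
    then have "D (n + t) k - (\<Sum>j\<in>nb k. D (n + Suc t) j) + D (n + Suc (Suc t)) k = 0"
      by (simp add: D_def shift_mod sum_subtractf)
    moreover have "D (n + Suc t) j = 0" if "j \<in> nb k" for j
      using ge2.IH(2) adm_nb[OF k that] by simp
    ultimately show ?case using ge2.IH(1)[OF k] by simp
  qed
  obtain k m where r': "r = (k, m)" by (cases r)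
  have k: "adm k m" "m < 2 * h" using r r' V_iff by auto
  \<comment> \<open>A full period is added because column \<open>m\<close> may lie to the left of
    column \<open>n\<close>.\<close>
  define t where "t = m + 2 * h - n"
  have "n + t = m + 2 * h" using i by (simp add: t_def)
  then show ?thesis using D[of k t] k r' by (simp add: D_def adm_def)
qed

lemma euler_form_eq: "euler_form I adj p h = euler"
  unfolding euler_form_def
proof (rule the_equality)
  show "is_euler_form I adj p h euler \<and> (\<forall>q r. q \<notin> V \<or> r \<notin> V \<longrightarrow> euler q r = 0)"
    using euler_is_euler_form by (simp add: euler_def)
next
  fix E' assume E': "is_euler_form I adj p h E' \<and> (\<forall>q r. q \<notin> V \<or> r \<notin> V \<longrightarrow> E' q r = 0)"
  show "E' = euler"
  proof (intro ext)
    fix q r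
    show "E' q r = euler q r"
    proof (cases "q \<in> V \<and> r \<in> V")
      case True
      then show ?thesis using euler_form_unique[of E' euler q r] E' euler_is_euler_form by simp
    next
      case False
      then have "E' q r = 0" using E' by blast
      then show ?thesis using False by (simp only: euler_def if_False)
    qed
  qed
qed

end

section \<open>The root system formed by the vertices\<close>

context mesh_lattice
begin

lemma psi_inj: "inj_on \<psi> (carrier Q)"
proof (rule inj_onI)
  fix x y assume "x \<in> carrier Q" "y \<in> carrier Q" and eq: "\<psi> x = \<psi> y"
  then obtain a b where "Poly_Mapping.keys a \<subseteq> V" "x = cls a" "Poly_Mapping.keys b \<subseteq> V" "y = cls b"
    unfolding Q_carrier by blast
  then show "x = y" using eq by (simp add: psi_cls cls_eq_iff)
qed

lemma vertex_in_Q: "q \<in> V \<Longrightarrow> vertex_class I adj p h q \<in> carrier Q"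
  unfolding Q_carrier vertex_class_cls by (rule imageI) (simp add: keys_frag_of)

lemma embedding: "lattice_embedding I adj col h Q \<psi> (vertex_class I adj p h ` V)"
proof (intro lattice_embedding.intro lattice_embedding_axioms.intro)
  show "\<psi> (x \<otimes>\<^bsub>Q\<^esub> y) = (\<lambda>i. \<psi> x i + \<psi> y i)" if xy: "x \<in> carrier Q" "y \<in> carrier Q" for x y
  proof -
    obtain a b where ab: "Poly_Mapping.keys a \<subseteq> V" "x = cls a" "Poly_Mapping.keys b \<subseteq> V" "y = cls b"
      using xy unfolding Q_carrier by blast
    then have "Poly_Mapping.keys (a + b) \<subseteq> V" using keys_add[of a b] by blast
    then show ?thesis using ab by (simp add: Q_mult psi_cls fun_eq_iff)
  qed
  \<comment> \<open>The completeness of the vertices among the roots enters here, through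
    \<open>vec_onto\<close>.\<close>
  show "vertex_class I adj p h ` V = {x \<in> carrier Q. is_root (\<psi> x)}"
  proof (intro equalityI subsetI)
    fix x assume "x \<in> vertex_class I adj p h ` V"
    then show "x \<in> {x \<in> carrier Q. is_root (\<psi> x)}"
      using vertex_in_Q vec_root psi_vertex by auto
  next
    fix x assume x: "x \<in> {x \<in> carrier Q. is_root (\<psi> x)}"
    then obtain q where q: "q \<in> V" "vec q = \<psi> x" using vec_onto by blast
    then have "vertex_class I adj p h q = x"
      using x psi_inj vertex_in_Q psi_vertex by (metis (mono_tags, lifting) inj_onD mem_Collect_eq)
    then show "x \<in> vertex_class I adj p h ` V" using q(1) by blast
  qed
qed (use psi_inj psi_image finite_V Q_generated Q_comm_group periodic_diagram_axioms in auto)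

lemma vertex_class_inj: "inj_on (vertex_class I adj p h) V"
  using vec_inj psi_vertex by (metis (mono_tags, lifting) inj_onI inj_onD)

lemma vertices_form_root_system:
  "\<exists>B. biadditive Q B \<and>
    (\<forall>x\<in>V. \<forall>y\<in>V. B (vertex_class I adj p h x) (vertex_class I adj p h y) = sym_euler_form I adj p h x y) \<and>
    symmetric_form Q B \<and> positive_definite Q B \<and> inj_on (vertex_class I adj p h) V \<and>
    root_system Q B (vertex_class I adj p h ` V) \<and>
    has_simply_laced_dynkin_diagram Q B (vertex_class I adj p h ` V) I adj"
proof -
  interpret emb: lattice_embedding I adj col h Q \<psi> "vertex_class I adj p h ` V"
    by (rule embedding)
  have "emb.B (vertex_class I adj p h x) (vertex_class I adj p h y) = sym_euler_form I adj p h x y"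
    if "x \<in> V" "y \<in> V" for x y
    using that by (simp add: emb.B_def psi_vertex sym_euler_form_def euler_form_eq euler_def)
  then show ?thesis
    using emb.B_biadditive emb.B_symmetric emb.B_posdef vertex_class_inj emb.R_root_system emb.R_dynkin
    by blast
qed

end

theorem theorem7p5:
  fixes I :: "'i set" and adj :: "'i \<Rightarrow> 'i \<Rightarrow> bool" and h :: nat and p :: "'i \<Rightarrow> bit"
  assumes "ADE_diagram I adj"
    and "coxeter_number I adj h"
    and "\<And>i j. i \<in> I \<Longrightarrow> j \<in> I \<Longrightarrow> adj i j \<Longrightarrow> p i = p j + 1"
  shows "\<exists>B. biadditive (lattice_Q I adj p h) B \<and>
    (\<forall>x\<in>Ihat I p h. \<forall>y\<in>Ihat I p h.
       B (vertex_class I adj p h x) (vertex_class I adj p h y) = sym_euler_form I adj p h x y) \<and>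
    symmetric_form (lattice_Q I adj p h) B \<and>
    positive_definite (lattice_Q I adj p h) B \<and>
    inj_on (vertex_class I adj p h) (Ihat I p h) \<and>
    root_system (lattice_Q I adj p h) B (vertex_class I adj p h ` Ihat I p h) \<and>
    has_simply_laced_dynkin_diagram (lattice_Q I adj p h) B
      (vertex_class I adj p h ` Ihat I p h) I adj"
proof -
  obtain r par g d where T: "tree_diagram I adj r par g" and d: "subadditive_on I adj d"
    using ADE_good[OF assms(1)] unfolding good_diagram_def by blast
  \<comment> \<open>Colour \<open>True\<close> marks the rows of \<open>Ihat\<close> that contain
    column 0.\<close>
  define col where "col = (\<lambda>i. p i = 0)"
  have col: "col j = (\<not> col i)" if "i \<in> I" "j \<in> I" "adj i j" for i j
    using assms(3)[OF that] unfolding col_def by (cases "p i"; cases "p j") auto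
  interpret bipartite_diagram I adj col
  proof unfold_locales
    show "finite I" by (rule tree_finite[OF T])
    show "adj j i" if "i \<in> I" "j \<in> I" "adj i j" for i j using tree_sym[OF T that] .
    show "col j = (\<not> col i)" if "i \<in> I" "j \<in> I" "adj i j" for i j using col[OF that] .
  qed
  obtain c where c: "coxeter_element I adj c" "0 < h" "c ^^ h = id"
      "\<And>m. 0 < m \<Longrightarrow> m < h \<Longrightarrow> c ^^ m \<noteq> id"
    using assms(2) unfolding coxeter_number_def by blast
  obtain \<xi> where \<xi>: "slice_map I adj col \<xi> c"
    using coxeter_slice_map[where col = col, OF T _ c(1)] col by blast
  \<comment> \<open>Both directions are needed: one transports the relation at \<open>h\<close>, the
    other the minimality of \<open>h\<close>.\<close>
  have pow: "c ^^ m = id \<longleftrightarrow> cox ^^ m = id" for m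
    using slice_map_pow_id[OF finite_I \<xi> cox_slice_map] slice_map_pow_id[OF finite_I cox_slice_map \<xi>] by blast
  interpret mesh_lattice I adj col h p
  proof unfold_locales
    show "S = I" if "S \<subseteq> I" "S \<noteq> {}" "\<And>i j. i \<in> S \<Longrightarrow> j \<in> nb i \<Longrightarrow> j \<in> S" for S
      using tree_connected[OF T that] .
    show "0 < E v v" if "supported v" "v \<noteq> (\<lambda>i. 0)" for v
      using d _ that
    proof (rule E_posdef)
      show "S = I" if "S \<subseteq> I" "S \<noteq> {}" "\<And>i j. i \<in> S \<Longrightarrow> j \<in> nb i \<Longrightarrow> j \<in> S" for S
        using tree_connected[OF T that] .
    qed
    show "0 < h" by (rule c(2))
    show "cox ^^ h = id" using c(3) pow by blast
    show "cox ^^ m \<noteq> id" if "0 < m" "m < h" for m using c(4)[OF that] pow by blast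
    show "col i \<longleftrightarrow> p i = 0" for i by (simp add: col_def)
  qed
  show ?thesis by (rule vertices_form_root_system)
qed

end
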